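(* Let $K$ be a local field with finite residue field $k$ of characteristic $p$ and cardinality $q$, let $e>0$ be an integer with $e\not\equiv 0\pmod p$, and let $f>0$ be an integer such that $q^f\equiv 1\pmod e$. Let $K_f$ be the unramified extension of $K$ of degree $f$, with residue field $k_f$, and $G_f=\mathrm{Gal}(K_f|K)$. Let $D\subset K_f^\times/K_f^{\times e}$ be a $G_f$-stable ramified line, so that $L=K_f(\sqrt[e]{D})$ is Galois over $K$, and put $\Gamma=\mathrm{Gal}(L|K)$. Identify $\mathrm{Gal}(L|K_f)$ with ${}_eK_f^\times={}_ek_f^\times$ as described in the context. Then the class in $H^2(G_f,{}_ek_f^\times)_q$ of the extension of groups $$1\to {}_eK_f^\times\to\Gamma\to G_f\to 1$$ is equal to the class $[D]\in H^2(G_f,{}_ek_f^\times)_q$ of the stable ramified line $D$.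
   Context: A local field is a field complete for a discrete valuation with finite residue field. For an abelian group $A$ written multiplicatively, ${}_eA$ is the kernel of $x\mapsto x^e$. Residue field elements are identified with their Teichmüller lifts, so that $k_f^\times\subset K_f^\times$ and ${}_eK_f^\times={}_ek_f^\times$. Ramified lines: let $\bar w_f:K_f^\times/K_f^{\times e}\to\mathbf Z/e\mathbf Z$ be induced by the normalised valuation of $K_f$. A ramified line is a subgroup $D\subset K_f^\times/K_f^{\times e}$ on which $\bar w_f$ restricts to an isomorphism $D\to\mathbf Z/e\mathbf Z$. It is generated by the image of a uniformiser $\varpi$ of $K_f$, and $K_f(\sqrt[e]{D})=K_f(\sqrt[e]{\varpi})$. Identification of the inertia group: $\mathrm{Gal}(L|K_f)\to{}_eK_f^\times$, $\tau\mapsto\tau(y)/y$ for any $y\in L$ with $y^e=\varpi$; it is an isomorphism of $G_f$-modules, independent of the choices of $\varpi$ and $y$. Cohomology: $\sigma\in G_f$ denotes the canonical generator, inducing $x\mapsto x^q$ on $k_f$. For the $G_f$-module $C={}_ek_f^\times$, on which $\sigma$ acts by $x\mapsto x^q$, $H^2(G_f,C)_q$ is the kernel of $x\mapsto x^{q-1}$ on $C$ modulo the image of $x\mapsto x^{1+q+\cdots+q^{f-1}}$ on $C$; the class of an extension $1\to C\to\Gamma\to G_f\to1$ (inducing the given action of $G_f$ on $C$) is the class of $\tilde\sigma^f\in C$, for any lift $\tilde\sigma\in\Gamma$ of $\sigma$. The class $[D]$: choose a uniformiser $\pi$ of $K$ and $\xi\in k_f^\times$ such that $D$ is generated by the image of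 $\xi\pi$. Since $D$ is $G_f$-stable, $\xi^{q-1}=\alpha^e$ for some $\alpha\in k_f^\times$. Put $\zeta=N_f(\alpha)$, where $N_f:k_f^\times\to k^\times$ is the norm map. Then $\zeta$ lies in ${}_ek_f^\times$ and $\zeta^{q-1}=1$, and $[D]$ is the class of $\zeta$ in $H^2(G_f,{}_ek_f^\times)_q$; it does not depend on the choices of $\pi$, $\xi$, $\alpha$. *)

theory Defs
  imports "HOL-Algebra.Algebra" "HOL-Number_Theory.Cong"
begin

text \<open>
  The library defines \<open>mult_of\<close> twice, identically; the one of \<open>Multiplicative_Group\<close> is used here.
\<close>

hide_const (open) Ring_Divisibility.mult_of


section \<open>Local fields\<close>

text \<open>
  Normalised discrete valuations are integer-valued functions on the nonzero elements of a field;
  the value at zero, conceptually infinity, is left unconstrained and is never used.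
\<close>

locale discretely_valued_field = field F for F :: "('a, 'm) ring_scheme" (structure) and v :: "'a \<Rightarrow> int" +
  assumes val_surj: "v ` carrier (mult_of F) = UNIV"
    and val_mult: "\<lbrakk> x \<in> carrier (mult_of F); y \<in> carrier (mult_of F) \<rbrakk> \<Longrightarrow> v (x \<otimes> y) = v x + v y"
    and val_add: "\<lbrakk> x \<in> carrier (mult_of F); y \<in> carrier (mult_of F); x \<oplus> y \<noteq> \<zero> \<rbrakk>
                    \<Longrightarrow> min (v x) (v y) \<le> v (x \<oplus> y)"

definition val_ge :: "('a, 'm) ring_scheme \<Rightarrow> ('a \<Rightarrow> int) \<Rightarrow> int \<Rightarrow> 'a set" where
  "val_ge F v n = {x \<in> carrier F. x = \<zero>\<^bsub>F\<^esub> \<or> n \<le> v x}"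

abbreviation valuation_ring :: "('a, 'm) ring_scheme \<Rightarrow> ('a \<Rightarrow> int) \<Rightarrow> ('a, 'm) ring_scheme" where
  "valuation_ring F v \<equiv> F\<lparr>carrier := val_ge F v 0\<rparr>"

abbreviation residue_field :: "('a, 'm) ring_scheme \<Rightarrow> ('a \<Rightarrow> int) \<Rightarrow> 'a set ring" where
  "residue_field F v \<equiv> valuation_ring F v Quot val_ge F v 1"

definition residue :: "('a, 'm) ring_scheme \<Rightarrow> ('a \<Rightarrow> int) \<Rightarrow> 'a \<Rightarrow> 'a set" where
  "residue F v x = val_ge F v 1 +>\<^bsub>valuation_ring F v\<^esub> x"

definition val_Cauchy :: "('a, 'm) ring_scheme \<Rightarrow> ('a \<Rightarrow> int) \<Rightarrow> (nat \<Rightarrow> 'a) \<Rightarrow> bool" where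
  "val_Cauchy F v s \<longleftrightarrow> (\<forall>n. \<exists>N. \<forall>i\<ge>N. \<forall>j\<ge>N. s i \<ominus>\<^bsub>F\<^esub> s j \<in> val_ge F v n)"

definition val_converges :: "('a, 'm) ring_scheme \<Rightarrow> ('a \<Rightarrow> int) \<Rightarrow> (nat \<Rightarrow> 'a) \<Rightarrow> 'a \<Rightarrow> bool" where
  "val_converges F v s l \<longleftrightarrow> (\<forall>n. \<exists>N. \<forall>i\<ge>N. s i \<ominus>\<^bsub>F\<^esub> l \<in> val_ge F v n)"

locale local_field = discretely_valued_field +
  assumes complete: "\<lbrakk> range s \<subseteq> carrier F; val_Cauchy F v s \<rbrakk> \<Longrightarrow> \<exists>l \<in> carrier F. val_converges F v s l"
    and finite_residue_field: "finite (carrier (residue_field F v))"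

definition uniformiser :: "('a, 'm) ring_scheme \<Rightarrow> ('a \<Rightarrow> int) \<Rightarrow> 'a \<Rightarrow> bool" where
  "uniformiser F v \<pi> \<longleftrightarrow> \<pi> \<in> carrier (mult_of F) \<and> v \<pi> = 1"

definition characteristic :: "('a, 'm) ring_scheme \<Rightarrow> nat" where
  "characteristic R = group.ord (add_monoid R) \<one>\<^bsub>R\<^esub>"

text \<open>
  An element of the residue field is a coset of the maximal ideal, so that membership of \<open>x\<close> in
  \<open>a\<close> says that \<open>x\<close> reduces to \<open>a\<close>.
\<close>

definition teichmueller :: "('a, 'm) ring_scheme \<Rightarrow> ('a \<Rightarrow> int) \<Rightarrow> 'a set \<Rightarrow> 'a" where
  "teichmueller F v a = (THE x. x \<in> a \<and> x [^]\<^bsub>F\<^esub> order (residue_field F v) = x)"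


section \<open>Extensions of local fields and Galois groups\<close>

text \<open>
  In what follows the fields are subfields of an ambient field \<open>\<Omega>\<close>. For \<open>K \<subseteq> F\<close>, the image in the
  residue field of \<open>F\<close> of the valuation ring of \<open>K\<close> is a copy of the residue field of \<open>K\<close>.
\<close>

definition residue_subfield ::
  "('a, 'm) ring_scheme \<Rightarrow> 'a set \<Rightarrow> ('a \<Rightarrow> int) \<Rightarrow> 'a set \<Rightarrow> ('a \<Rightarrow> int) \<Rightarrow> 'a set set" where
  "residue_subfield \<Omega> K v F w =
     residue (\<Omega>\<lparr>carrier := F\<rparr>) w ` carrier (valuation_ring (\<Omega>\<lparr>carrier := K\<rparr>) v)"

text \<open>
  A finite extension of local fields is unramified if the residue extension has the same degree;
  separability of the residue extension is automatic, the residue fields being finite. Both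
  valuations are normalised, so \<open>w\<close> extends \<open>v\<close> only up to a positive factor, the ramification index.
\<close>

definition unramified_extension ::
  "('a, 'm) ring_scheme \<Rightarrow> 'a set \<Rightarrow> ('a \<Rightarrow> int) \<Rightarrow> 'a set \<Rightarrow> ('a \<Rightarrow> int) \<Rightarrow> nat \<Rightarrow> bool" where
  "unramified_extension \<Omega> K v F w n \<longleftrightarrow>
     K \<subseteq> F \<and>
     ring.dimension \<Omega> n K F \<and>
     (\<exists>r>0. \<forall>x \<in> carrier (mult_of (\<Omega>\<lparr>carrier := K\<rparr>)). w x = r * v x) \<and>
     ring.dimension (residue_field (\<Omega>\<lparr>carrier := F\<rparr>) w) n
       (residue_subfield \<Omega> K v F w) (carrier (residue_field (\<Omega>\<lparr>carrier := F\<rparr>) w))"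

definition galois_group :: "('a, 'm) ring_scheme \<Rightarrow> 'a set \<Rightarrow> ('a \<Rightarrow> 'a) monoid" where
  "galois_group F K = (BijGroup (carrier F))
     \<lparr>carrier := {\<tau> \<in> Bij (carrier F). \<tau> \<in> ring_hom F F \<and> (\<forall>x\<in>K. \<tau> x = x)}\<rparr>"

definition galois_norm :: "('a, 'm) ring_scheme \<Rightarrow> 'a set \<Rightarrow> 'a \<Rightarrow> 'a" where
  "galois_norm F K x = (\<Otimes>\<^bsub>F\<^esub>\<tau> \<in> carrier (galois_group F K). \<tau> x)"

definition induces_frobenius ::
  "('a, 'm) ring_scheme \<Rightarrow> ('a \<Rightarrow> int) \<Rightarrow> nat \<Rightarrow> ('a \<Rightarrow> 'a) \<Rightarrow> bool" where
  "induces_frobenius F w q \<sigma> \<longleftrightarrow>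
     (\<forall>x \<in> carrier (valuation_ring F w). \<sigma> x \<in> carrier (valuation_ring F w) \<and>
        residue F w (\<sigma> x) = residue F w x [^]\<^bsub>residue_field F w\<^esub> q)"


section \<open>Ramified lines\<close>

definition torsion :: "('a, 'm) monoid_scheme \<Rightarrow> nat \<Rightarrow> ('a, 'm) monoid_scheme" where
  "torsion G e = G\<lparr>carrier := {x \<in> carrier G. x [^]\<^bsub>G\<^esub> e = \<one>\<^bsub>G\<^esub>}\<rparr>"

definition powers :: "('a, 'm) monoid_scheme \<Rightarrow> nat \<Rightarrow> 'a set" where
  "powers G e = (\<lambda>x. x [^]\<^bsub>G\<^esub> e) ` carrier G"

definition power_classes :: "('a, 'm) ring_scheme \<Rightarrow> nat \<Rightarrow> 'a set monoid" where
  "power_classes F e = mult_of F Mod powers (mult_of F) e"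

definition power_class :: "('a, 'm) ring_scheme \<Rightarrow> nat \<Rightarrow> 'a \<Rightarrow> 'a set" where
  "power_class F e x = powers (mult_of F) e #>\<^bsub>mult_of F\<^esub> x"

definition induced_valuation :: "('a \<Rightarrow> int) \<Rightarrow> nat \<Rightarrow> 'a set \<Rightarrow> int" where
  "induced_valuation w e c = the_elem ((\<lambda>x. w x mod int e) ` c)"

definition ramified_line :: "('a, 'm) ring_scheme \<Rightarrow> ('a \<Rightarrow> int) \<Rightarrow> nat \<Rightarrow> 'a set set \<Rightarrow> bool" where
  "ramified_line F w e D \<longleftrightarrow>
     subgroup D (power_classes F e) \<and>
     induced_valuation w e \<in> iso ((power_classes F e)\<lparr>carrier := D\<rparr>) (integer_mod_group e)"

definition stable_line :: "('a \<Rightarrow> 'a) monoid \<Rightarrow> 'a set set \<Rightarrow> bool" where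
  "stable_line G D \<longleftrightarrow> (\<forall>\<tau> \<in> carrier G. (\<lambda>c. \<tau> ` c) ` D = D)"

text \<open>The union \<open>\<Union>D\<close> consists of the elements of \<open>F\<close> whose class modulo \<open>e\<close>-th powers is in \<open>D\<close>.\<close>

definition adjoin_roots :: "('a, 'm) ring_scheme \<Rightarrow> 'a set \<Rightarrow> nat \<Rightarrow> 'a set set \<Rightarrow> 'a set" where
  "adjoin_roots \<Omega> F e D = generate_field \<Omega> (F \<union> {y \<in> carrier \<Omega>. y [^]\<^bsub>\<Omega>\<^esub> e \<in> \<Union>D})"

definition line_generator :: "('a, 'm) ring_scheme \<Rightarrow> nat \<Rightarrow> 'a set set \<Rightarrow> 'a \<Rightarrow> bool" where
  "line_generator F e D x \<longleftrightarrow> x \<in> carrier (mult_of F) \<and> generate (power_classes F e) {power_class F e x} = D"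

text \<open>
  The image of \<open>\<tau>(y)/y\<close>, an \<open>e\<close>-th root of unity of \<open>F\<close>, in the residue field of \<open>F\<close>, where \<open>y \<in> L\<close>
  and \<open>y^e\<close> is a uniformiser of \<open>F\<close> generating \<open>D\<close>. Reduction is the inverse of the identification of
  the \<open>e\<close>-torsion of the residue field with that of \<open>F\<close> by Teichmueller lifts.
\<close>

definition inertia_character ::
  "('a, 'm) ring_scheme \<Rightarrow> 'a set \<Rightarrow> ('a \<Rightarrow> int) \<Rightarrow> nat \<Rightarrow> 'a set set \<Rightarrow> 'a set \<Rightarrow> ('a \<Rightarrow> 'a) \<Rightarrow> 'a set" where
  "inertia_character \<Omega> F w e D L \<tau> = residue (\<Omega>\<lparr>carrier := F\<rparr>) w
     (THE z. \<exists>u. \<exists>y \<in> L. uniformiser (\<Omega>\<lparr>carrier := F\<rparr>) w u \<and> line_generator (\<Omega>\<lparr>carrier := F\<rparr>) e D u \<and>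
        y [^]\<^bsub>\<Omega>\<^esub> e = u \<and> z = \<tau> y \<otimes>\<^bsub>\<Omega>\<^esub> inv\<^bsub>\<Omega>\<^esub> y)"


section \<open>Group extensions and cohomology classes\<close>

text \<open>
  The second cohomology of a cyclic group of order \<open>f\<close> with coefficients in a commutative group \<open>C\<close>
  on which a given generator acts by \<open>x \<mapsto> x^q\<close>.
\<close>

definition H2_denominator :: "('a, 'm) monoid_scheme \<Rightarrow> nat \<Rightarrow> nat \<Rightarrow> 'a set" where
  "H2_denominator C q f = (\<lambda>x. x [^]\<^bsub>C\<^esub> (\<Sum>i<f. q ^ i)) ` carrier C"

definition H2 :: "('a, 'm) monoid_scheme \<Rightarrow> nat \<Rightarrow> nat \<Rightarrow> 'a set monoid" where
  "H2 C q f = (C\<lparr>carrier := kernel C C (\<lambda>x. x [^]\<^bsub>C\<^esub> (q - 1))\<rparr>) Mod H2_denominator C q f"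

definition H2_class :: "('a, 'm) monoid_scheme \<Rightarrow> nat \<Rightarrow> nat \<Rightarrow> 'a \<Rightarrow> 'a set" where
  "H2_class C q f x = H2_denominator C q f #>\<^bsub>C\<^esub> x"

text \<open>
  An extension of \<open>G\<close> by \<open>C\<close> is given by the projection \<open>\<rho> : \<Gamma> \<rightarrow> G\<close> and an isomorphism \<open>\<theta>\<close> of its
  kernel with \<open>C\<close>; conjugation by lifts of \<open>\<sigma>\<close> is required to induce \<open>x \<mapsto> x^q\<close> on \<open>C\<close>.
\<close>

definition cyclic_extension ::
  "('c, 'm) monoid_scheme \<Rightarrow> nat \<Rightarrow> ('g, 'n) monoid_scheme \<Rightarrow> ('h, 'k) monoid_scheme \<Rightarrow> 'h
     \<Rightarrow> ('g \<Rightarrow> 'h) \<Rightarrow> ('g \<Rightarrow> 'c) \<Rightarrow> bool" where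
  "cyclic_extension C q \<Gamma> G \<sigma> \<rho> \<theta> \<longleftrightarrow>
     group C \<and> group \<Gamma> \<and> group G \<and>
     \<rho> \<in> epi \<Gamma> G \<and>
     \<theta> \<in> iso (\<Gamma>\<lparr>carrier := kernel \<Gamma> G \<rho>\<rparr>) C \<and>
     (\<forall>s \<in> carrier \<Gamma>. \<forall>t \<in> kernel \<Gamma> G \<rho>. \<rho> s = \<sigma> \<longrightarrow>
        \<theta> (s \<otimes>\<^bsub>\<Gamma>\<^esub> t \<otimes>\<^bsub>\<Gamma>\<^esub> inv\<^bsub>\<Gamma>\<^esub> s) = \<theta> t [^]\<^bsub>C\<^esub> q)"

definition extension_class ::
  "('c, 'm) monoid_scheme \<Rightarrow> nat \<Rightarrow> nat \<Rightarrow> ('g, 'n) monoid_scheme \<Rightarrow> 'h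
     \<Rightarrow> ('g \<Rightarrow> 'h) \<Rightarrow> ('g \<Rightarrow> 'c) \<Rightarrow> 'c set" where
  "extension_class C q f \<Gamma> \<sigma> \<rho> \<theta> =
     (THE c. \<exists>s \<in> carrier \<Gamma>. \<rho> s = \<sigma> \<and> c = H2_class C q f (\<theta> (s [^]\<^bsub>\<Gamma>\<^esub> f)))"

definition line_class ::
  "('a, 'm) ring_scheme \<Rightarrow> 'a set \<Rightarrow> ('a \<Rightarrow> int) \<Rightarrow> 'a set \<Rightarrow> ('a \<Rightarrow> int) \<Rightarrow> nat \<Rightarrow> nat \<Rightarrow> nat
     \<Rightarrow> 'a set set \<Rightarrow> 'a set set" where
  "line_class \<Omega> K v F w q e f D =
     (let kF = residue_field (\<Omega>\<lparr>carrier := F\<rparr>) w in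
      THE c. \<exists>\<pi> \<xi> \<alpha>. uniformiser (\<Omega>\<lparr>carrier := K\<rparr>) v \<pi> \<and>
        \<xi> \<in> carrier (mult_of kF) \<and>
        line_generator (\<Omega>\<lparr>carrier := F\<rparr>) e D (teichmueller (\<Omega>\<lparr>carrier := F\<rparr>) w \<xi> \<otimes>\<^bsub>\<Omega>\<^esub> \<pi>) \<and>
        \<alpha> \<in> carrier (mult_of kF) \<and>
        \<xi> [^]\<^bsub>kF\<^esub> (q - 1) = \<alpha> [^]\<^bsub>kF\<^esub> e \<and>
        c = H2_class (torsion (mult_of kF) e) q f (galois_norm kF (residue_subfield \<Omega> K v F w) \<alpha>))"

end

theory Submission
  imports Defs
begin

text \<open>
  Let \<open>F\<close> be the unramified extension \<open>K\<^sub>f\<close>. Write \<open>D\<close> as the line of \<open>u = \<xi>\<pi>\<close> with \<open>\<xi>\<close> a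
  Teichmueller representative, and let \<open>y\<close> be an \<open>e\<close>-th root of \<open>u\<close>; comparing valuations,
  \<open>y\<close> has degree \<open>e\<close> over \<open>F\<close>, and \<open>L = F(y)\<close>. Stability of \<open>D\<close> means
  \<open>\<sigma>(u) = \<xi>\<^sup>q\<^sup>-\<^sup>1 u = b\<^sup>e u\<close> for some \<open>b\<close>, so \<open>\<sigma>\<close> lifts to \<open>L\<close> by \<open>y \<mapsto> b y\<close>. The \<open>f\<close>-th power of the lift
  multiplies \<open>y\<close> by \<open>b \<sigma>(b) \<sigma>\<^sup>2(b) \<dots>\<close>, whose residue is the norm of the residue \<open>\<alpha>\<close> of \<open>b\<close>; and
  \<open>\<alpha>\<^sup>e = \<xi>\<^sup>q\<^sup>-\<^sup>1\<close>, which is the equation defining the class of the line. A change of the lift, of \<open>\<pi>\<close>,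
  of \<open>\<xi>\<close> or of \<open>\<alpha>\<close> multiplies the norm by the norm of an \<open>e\<close>-th root of unity.
\<close>


section \<open>Discretely valued fields\<close>

text \<open>The definition of an unramified extension equates the field degree and the residue
  degree, but leaves open the factor between the two valuations. That this factor is 1
  (\<open>val_K\<close>) is the main obstacle on the side of \<open>F\<close>: it makes a
  uniformiser of \<open>K\<close> one of \<open>F\<close>, and it makes \<open>\<sigma>\<close>
  preserve \<open>w\<close>, so that \<open>\<sigma>\<close> fixes the class of a generator of
  \<open>D\<close>. No valuation on \<open>L\<close> is constructed; degrees and lifts are settled
  over \<open>F\<close>, by the constant coefficient of a minimal polynomial and by division with
  remainder. The Galois groups of \<open>F\<close> over \<open>K\<close> and of the residue
  extension are both found by counting roots, from one element with f distinct conjugates.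
  Teichmueller representatives matter because \<open>\<sigma>\<close> acts on them by q-th powers
  exactly, not only modulo the maximal ideal. Both classes are definite descriptions, so each needs
  independence of choices: every choice changes \<alpha> by an e-th root of unity and a (q-1)-st
  power, and the norm exponent S = 1 + q + ... + q^(f-1) kills the latter because S(q-1) = q^f -
  1.\<close>

lemma (in field) nonzero_inv:
  assumes "x \<in> carrier R" "x \<noteq> \<zero>"
  shows "inv x \<in> carrier R" "inv x \<noteq> \<zero>" "x \<otimes> inv x = \<one>" "inv x \<otimes> x = \<one>"
  using subfield_m_inv[OF carrier_is_subfield, of x] assms by auto

context discretely_valued_field
begin

lemma val_one: "v \<one> = 0"
  using val_mult[of \<one> \<one>] by simp

lemma val_pow: "\<lbrakk>x \<in> carrier F; x \<noteq> \<zero>\<rbrakk> \<Longrightarrow> x [^] (n::nat) \<noteq> \<zero> \<and> v (x [^] n) = int n * v x"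
proof (induction n)
  case 0
  then show ?case by (simp add: val_one)
next
  case (Suc n)
  then have "x [^] n \<in> carrier (mult_of F)" "x \<in> carrier (mult_of F)" by auto
  with Suc show ?case
    using val_mult[of "x [^] n" x] integral[of "x [^] n" x] by (auto simp: algebra_simps)
qed

lemma val_uminus:
  assumes "x \<in> carrier F" "x \<noteq> \<zero>"
  shows "v (\<ominus> x) = v x"
proof -
  have n: "\<ominus> \<one> \<noteq> \<zero>" by (metis local.minus_minus minus_zero one_closed one_not_zero)
  have "v (\<ominus> \<one> \<otimes> \<ominus> \<one>) = v (\<ominus> \<one>) + v (\<ominus> \<one>)"
    using n by (intro val_mult) auto
  then have "v (\<ominus> \<one>) = 0" by (simp add: l_minus r_minus val_one)
  moreover have "v (\<ominus> \<one> \<otimes> x) = v (\<ominus> \<one>) + v x"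
    using n assms by (intro val_mult) auto
  ultimately show ?thesis using assms by (simp add: l_minus)
qed

lemma val_inv:
  assumes "x \<in> carrier F" "x \<noteq> \<zero>"
  shows "v (inv x) = - v x"
  using val_mult[of x "inv x"] nonzero_inv[OF assms] assms by (simp add: val_one)

lemma mem_val_ge: "x \<in> val_ge F v n \<longleftrightarrow> x \<in> carrier F \<and> (x = \<zero> \<or> n \<le> v x)"
  by (simp add: val_ge_def)

lemma val_ge_carrier: "x \<in> val_ge F v n \<Longrightarrow> x \<in> carrier F"
  by (simp add: val_ge_def)

lemma val_ge_zero: "\<zero> \<in> val_ge F v n"
  by (simp add: val_ge_def)

lemma val_ge_mono: "x \<in> val_ge F v n \<Longrightarrow> m \<le> n \<Longrightarrow> x \<in> val_ge F v m"
  by (auto simp: val_ge_def)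

lemma val_ge_add: "\<lbrakk>x \<in> val_ge F v n; y \<in> val_ge F v n\<rbrakk> \<Longrightarrow> x \<oplus> y \<in> val_ge F v n"
  using val_add[of x y] by (cases "x = \<zero>"; cases "y = \<zero>") (auto simp: val_ge_def)

lemma val_ge_uminus: "x \<in> val_ge F v n \<Longrightarrow> \<ominus> x \<in> val_ge F v n"
  using val_uminus[of x] by (cases "x = \<zero>") (auto simp: val_ge_def)

lemma val_ge_minus: "\<lbrakk>x \<in> val_ge F v n; y \<in> val_ge F v n\<rbrakk> \<Longrightarrow> x \<ominus> y \<in> val_ge F v n"
  by (simp add: minus_eq val_ge_add val_ge_uminus)

lemma val_ge_mult: "\<lbrakk>x \<in> val_ge F v m; y \<in> val_ge F v n\<rbrakk> \<Longrightarrow> x \<otimes> y \<in> val_ge F v (m + n)"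
  using val_mult[of x y] by (cases "x = \<zero>"; cases "y = \<zero>") (auto simp: val_ge_def)

lemma val_ge_Inter:
  assumes "\<And>n::nat. x \<in> val_ge F v (int n)"
  shows "x = \<zero>"
proof (rule ccontr)
  assume "x \<noteq> \<zero>"
  then have "int n \<le> v x" for n using assms[of n] by (simp add: val_ge_def)
  from this[of "nat (v x + 1)"] show False by linarith
qed

lemma val_ge_minus_commute: 
  assumes "x \<in> carrier F" "y \<in> carrier F" "x \<ominus> y \<in> val_ge F v n"
  shows "y \<ominus> x \<in> val_ge F v n"
proof -
  have "y \<ominus> x = \<ominus> (x \<ominus> y)" using assms(1,2) by (simp add: minus_eq minus_add a_comm)
  then show ?thesis using val_ge_uminus[OF assms(3)] by simp
qed

lemma val_ge_minus_trans: 
  assumes "x \<in> carrier F" "y \<in> carrier F" "z \<in> carrier F"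
    "x \<ominus> y \<in> val_ge F v n" "y \<ominus> z \<in> val_ge F v n"
  shows "x \<ominus> z \<in> val_ge F v n"
proof -
  have "x \<ominus> z = (x \<ominus> y) \<oplus> (y \<ominus> z)" using assms(1-3) by algebra
  then show ?thesis using val_ge_add[OF assms(4,5)] by simp
qed

section \<open>The valuation ring, its maximal ideal and the residue field\<close>

abbreviation O\<^sub>F where "O\<^sub>F \<equiv> val_ge F v 0"

lemma one_integer: "\<one> \<in> O\<^sub>F"
  by (simp add: mem_val_ge val_one)

lemma subring_integers: "subring O\<^sub>F F"
  by (rule subringI) (use val_ge_mult[of _ 0 _ 0] in \<open>auto simp: val_ge_carrier val_ge_uminus val_ge_add one_integer\<close>)

lemma integer_mult: "\<lbrakk>x \<in> O\<^sub>F; y \<in> O\<^sub>F\<rbrakk> \<Longrightarrow> x \<otimes> y \<in> O\<^sub>F"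
  using val_ge_mult[of x 0 y 0] by simp

lemma integer_pow: "x \<in> O\<^sub>F \<Longrightarrow> x [^] (n::nat) \<in> O\<^sub>F"
  by (induction n) (auto simp: one_integer integer_mult)

lemma cring_integers: "cring (valuation_ring F v)"
  using subcring_iff subcringI' subring_integers val_ge_carrier by (metis subsetI)

lemma ring_integers: "ring (valuation_ring F v)"
  using cring_integers cring.axioms(1) by blast

lemma a_inv_integer: "x \<in> O\<^sub>F \<Longrightarrow> \<ominus>\<^bsub>valuation_ring F v\<^esub> x = \<ominus> x"
proof -
  assume x: "x \<in> O\<^sub>F"
  interpret O: ring "valuation_ring F v" by (rule ring_integers)
  show ?thesis
    using O.minus_equality[of "\<ominus> x" x] x val_ge_uminus[OF x] val_ge_carrier[OF x] l_neg by simp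
qed

lemma a_minus_integer: "\<lbrakk>x \<in> O\<^sub>F; y \<in> O\<^sub>F\<rbrakk> \<Longrightarrow> x \<ominus>\<^bsub>valuation_ring F v\<^esub> y = x \<ominus> y"
  by (simp add: a_minus_def a_inv_integer)

lemma ideal_maximal: "ideal (val_ge F v 1) (valuation_ring F v)"
proof (rule idealI[OF ring_integers])
  interpret O: ring "valuation_ring F v" by (rule ring_integers)
  show "subgroup (val_ge F v 1) (add_monoid (valuation_ring F v))"
  proof (rule group.subgroupI[OF O.add.group_axioms])
    fix a assume "a \<in> val_ge F v 1"
    then have "\<ominus>\<^bsub>valuation_ring F v\<^esub> a \<in> val_ge F v 1"
      using a_inv_integer val_ge_mono[of a 1 0] val_ge_uminus[of a 1] by simp
    then show "inv\<^bsub>add_monoid (valuation_ring F v)\<^esub> a \<in> val_ge F v 1"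
      by (simp add: a_inv_def)
  qed (use val_ge_zero[of 1] in \<open>auto simp: val_ge_add intro: val_ge_mono[where n=1]\<close>)
next
  fix a x assume "a \<in> val_ge F v 1" "x \<in> carrier (valuation_ring F v)"
  then show "x \<otimes>\<^bsub>valuation_ring F v\<^esub> a \<in> val_ge F v 1" "a \<otimes>\<^bsub>valuation_ring F v\<^esub> x \<in> val_ge F v 1"
    using val_ge_mult[of a 1 x 0] val_ge_mult[of x 0 a 1] by simp_all
qed

lemma one_not_maximal: "\<one> \<notin> val_ge F v 1"
  by (simp add: mem_val_ge val_one)

lemma integer_unit:
  assumes "x \<in> O\<^sub>F" "x \<notin> val_ge F v 1"
  shows "x \<noteq> \<zero>" "v x = 0" "inv x \<in> O\<^sub>F"
  using assms val_inv[of x] nonzero_inv[of x] by (auto simp: mem_val_ge)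

lemma maximalideal_maximal: "maximalideal (val_ge F v 1) (valuation_ring F v)"
proof (rule maximalidealI[OF ideal_maximal])
  show "carrier (valuation_ring F v) \<noteq> val_ge F v 1"
    using one_integer one_not_maximal by auto
next
  fix J assume J: "ideal J (valuation_ring F v)" "val_ge F v 1 \<subseteq> J" "J \<subseteq> carrier (valuation_ring F v)"
  show "J = val_ge F v 1 \<or> J = carrier (valuation_ring F v)"
  proof (cases "J \<subseteq> val_ge F v 1")
    case False
    then obtain x where x: "x \<in> J" "x \<notin> val_ge F v 1" by auto
    with J have xO: "x \<in> O\<^sub>F" by auto
    have "x \<otimes> inv x = \<one>" using nonzero_inv[of x] integer_unit[OF xO x(2)] xO val_ge_carrier by blast
    then have "\<one> \<in> J"
      using ideal.I_r_closed[OF J(1) x(1), of "inv x"] integer_unit[OF xO x(2)] by simp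
    then have "J = carrier (valuation_ring F v)"
      using ideal.one_imp_carrier[OF J(1)] by simp
    then show ?thesis ..
  qed (use J in auto)
qed

abbreviation k\<^sub>F where "k\<^sub>F \<equiv> residue_field F v"
abbreviation res where "res \<equiv> residue F v"

lemma field_residue_field: "field k\<^sub>F"
  by (rule maximalideal.quotient_is_field[OF maximalideal_maximal cring_integers])

lemma residue_ring_hom: "ring_hom_ring (valuation_ring F v) k\<^sub>F res"
  using ideal.rcos_ring_hom_ring[OF ideal_maximal] unfolding residue_def by simp

lemma residue_closed: "x \<in> O\<^sub>F \<Longrightarrow> res x \<in> carrier k\<^sub>F"
  using ring_hom_ring.homh[OF residue_ring_hom] ring_hom_memE(1) by fastforce

lemma residue_mult: "\<lbrakk>x \<in> O\<^sub>F; y \<in> O\<^sub>F\<rbrakk> \<Longrightarrow> res (x \<otimes> y) = res x \<otimes>\<^bsub>k\<^sub>F\<^esub> res y"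
  using ring_hom_mult[OF ring_hom_ring.homh[OF residue_ring_hom], of x y] by simp

lemma residue_add: "\<lbrakk>x \<in> O\<^sub>F; y \<in> O\<^sub>F\<rbrakk> \<Longrightarrow> res (x \<oplus> y) = res x \<oplus>\<^bsub>k\<^sub>F\<^esub> res y"
  using ring_hom_add[OF ring_hom_ring.homh[OF residue_ring_hom], of x y] by simp

lemma residue_one: "res \<one> = \<one>\<^bsub>k\<^sub>F\<^esub>"
  using ring_hom_one[OF ring_hom_ring.homh[OF residue_ring_hom]] by simp

lemma residue_zero: "res \<zero> = \<zero>\<^bsub>k\<^sub>F\<^esub>"
  using ring_hom_zero[OF ring_hom_ring.homh[OF residue_ring_hom] ring_integers] field_residue_field
  by (simp add: fieldE(1) cring.axioms(1))

lemma residue_pow: "x \<in> O\<^sub>F \<Longrightarrow> res (x [^] (n::nat)) = res x [^]\<^bsub>k\<^sub>F\<^esub> n"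
proof -
  assume x: "x \<in> O\<^sub>F"
  interpret k: field k\<^sub>F by (rule field_residue_field)
  show ?thesis by (induction n) (use x in \<open>auto simp: residue_one residue_mult integer_pow\<close>)
qed

lemma residue_eq_iff:
  assumes "x \<in> O\<^sub>F" "y \<in> O\<^sub>F"
  shows "res x = res y \<longleftrightarrow> x \<ominus> y \<in> val_ge F v 1"
proof -
  interpret I: ideal "val_ge F v 1" "valuation_ring F v" by (rule ideal_maximal)
  show ?thesis
    using ring.quotient_eq_iff_same_a_r_cos[OF ring_integers ideal_maximal, of x y] a_minus_integer assms
    by (auto simp: residue_def)
qed

lemma residue_eq_zero_iff: "x \<in> O\<^sub>F \<Longrightarrow> res x = \<zero>\<^bsub>k\<^sub>F\<^esub> \<longleftrightarrow> x \<in> val_ge F v 1"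
  using residue_eq_iff[of x \<zero>] by (simp add: residue_zero val_ge_zero val_ge_carrier minus_eq)

lemma residue_surj: "a \<in> carrier k\<^sub>F \<Longrightarrow> \<exists>x \<in> O\<^sub>F. res x = a"
  by (auto simp: FactRing_def A_RCOSETS_def' residue_def)

text \<open>\<open>teichmueller\<close> speaks of membership in a coset; this turns it into
  integrality and an equation between residues.\<close>

lemma mem_residue_class:
  assumes "a \<in> carrier k\<^sub>F"
  shows "x \<in> a \<longleftrightarrow> x \<in> O\<^sub>F \<and> res x = a"
proof -
  interpret I: ideal "val_ge F v 1" "valuation_ring F v" by (rule ideal_maximal)
  from residue_surj[OF assms] obtain y where y: "y \<in> O\<^sub>F" "res y = a" by auto
  have sub: "a \<subseteq> O\<^sub>F"
    using I.a_r_coset_subset_G[OF I.a_subset, of y] y by (auto simp: residue_def)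
  have *: "x \<in> a \<longleftrightarrow> x \<ominus> y \<in> val_ge F v 1" if "x \<in> O\<^sub>F"
    using that y a_minus_integer I.a_rcos_module[of y x] by (simp add: residue_def a_minus_def)
  show ?thesis using * residue_eq_iff[of x y] y sub by auto
qed

end

text \<open>The cofactor is the sum of the a^i b^(n-i). Its n+1 terms agree modulo the maximal
  ideal, so its residue is the derivative of X^(n+1) at the residue of \<open>a\<close>. For n+1 = Q
  this vanishes, which is how a Q-th power gains valuation.\<close>

lemma (in discretely_valued_field) pow_diff_factor:
  assumes "a \<in> O\<^sub>F" "b \<in> O\<^sub>F" "res a = res b"
  shows "\<exists>c \<in> O\<^sub>F. a [^] Suc n \<ominus> b [^] Suc n = (a \<ominus> b) \<otimes> c \<and>
           res c = [Suc n] \<cdot>\<^bsub>k\<^sub>F\<^esub> (res a [^]\<^bsub>k\<^sub>F\<^esub> n)"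
proof -
  interpret k: field k\<^sub>F by (rule field_residue_field)
  note car = assms(1,2)[THEN val_ge_carrier]
  note rc = residue_closed[OF assms(1)]
  show ?thesis
  proof (induction n)
    case 0
    then show ?case using car rc by (intro bexI[of _ \<one>]) (auto simp: residue_one one_integer)
  next
    case (Suc n)
    then obtain c where c: "c \<in> O\<^sub>F" "a [^] Suc n \<ominus> b [^] Suc n = (a \<ominus> b) \<otimes> c"
      "res c = [Suc n] \<cdot>\<^bsub>k\<^sub>F\<^esub> (res a [^]\<^bsub>k\<^sub>F\<^esub> n)" by blast
    define A B where "A = a [^] Suc n" and "B = b [^] Suc n"
    have AB: "A \<in> carrier F" "B \<in> carrier F" "A \<in> O\<^sub>F" "B \<in> O\<^sub>F"
      unfolding A_def B_def using car assms(1,2) integer_pow integer_mult by auto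
    note cc = c(1)[THEN val_ge_carrier]
    have "a [^] Suc (Suc n) \<ominus> b [^] Suc (Suc n) = A \<otimes> a \<ominus> B \<otimes> b"
      by (simp add: A_def B_def)
    also have "\<dots> = a \<otimes> (A \<ominus> B) \<oplus> (a \<ominus> b) \<otimes> B"
      using car AB(1,2) by algebra
    also have "\<dots> = (a \<ominus> b) \<otimes> (a \<otimes> c \<oplus> B)"
      unfolding c(2)[folded A_def B_def] using car AB(1,2) cc by algebra
    finally have 1: "a [^] Suc (Suc n) \<ominus> b [^] Suc (Suc n) = (a \<ominus> b) \<otimes> (a \<otimes> c \<oplus> B)" .
    have "res (a \<otimes> c \<oplus> B) = res a \<otimes>\<^bsub>k\<^sub>F\<^esub> res c \<oplus>\<^bsub>k\<^sub>F\<^esub> res B"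
      using assms(1) c(1) AB by (simp add: residue_add residue_mult integer_mult)
    also have "res B = res a [^]\<^bsub>k\<^sub>F\<^esub> Suc n"
      unfolding B_def using residue_pow[OF assms(2), of "Suc n"] assms(3) by simp
    also have "res a \<otimes>\<^bsub>k\<^sub>F\<^esub> res c = [Suc n] \<cdot>\<^bsub>k\<^sub>F\<^esub> (res a [^]\<^bsub>k\<^sub>F\<^esub> Suc n)"
      unfolding c(3) using rc k.add_pow_rdistr[of "res a" "res a [^]\<^bsub>k\<^sub>F\<^esub> n" "Suc n"]
      by (simp add: k.m_comm del: k.add.nat_pow_Suc)
    finally have "res (a \<otimes> c \<oplus> B) = [Suc (Suc n)] \<cdot>\<^bsub>k\<^sub>F\<^esub> (res a [^]\<^bsub>k\<^sub>F\<^esub> Suc n)"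
      by simp
    moreover have "a \<otimes> c \<oplus> B \<in> O\<^sub>F"
      using assms(1) c(1) AB by (intro val_ge_add integer_mult)
    ultimately show ?case using 1 by blast
  qed
qed

lemma (in discretely_valued_field) pow_val_ge_cong:
  assumes "a \<in> O\<^sub>F" "b \<in> O\<^sub>F" "a \<ominus> b \<in> val_ge F v i" "1 \<le> i"
  shows "a [^] (n::nat) \<ominus> b [^] n \<in> val_ge F v i"
proof (cases n)
  case 0
  then show ?thesis using assms by (simp add: minus_eq r_neg val_ge_zero)
next
  case (Suc m)
  have "res a = res b"
    using assms val_ge_mono[OF assms(3), of 1] by (simp add: residue_eq_iff)
  from pow_diff_factor[OF assms(1,2) this, of m] obtain c where
    "c \<in> O\<^sub>F" "a [^] Suc m \<ominus> b [^] Suc m = (a \<ominus> b) \<otimes> c" by blast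
  then show ?thesis using val_ge_mult[OF assms(3), of c 0] by (simp add: Suc)
qed


section \<open>Teichmueller representatives and roots of one-units\<close>

context local_field
begin

abbreviation Q where "Q \<equiv> order k\<^sub>F"

lemma Q_gt_1: "1 < Q"
proof -
  interpret k: field k\<^sub>F by (rule field_residue_field)
  have "card {\<zero>\<^bsub>k\<^sub>F\<^esub>, \<one>\<^bsub>k\<^sub>F\<^esub>} \<le> card (carrier k\<^sub>F)"
    by (rule card_mono) (auto simp: finite_residue_field)
  then show ?thesis using k.one_not_zero by (simp add: order_def)
qed

lemma residue_field_pow_order:
  assumes "a \<in> carrier k\<^sub>F"
  shows "a [^]\<^bsub>k\<^sub>F\<^esub> Q = a" "a \<noteq> \<zero>\<^bsub>k\<^sub>F\<^esub> \<Longrightarrow> a [^]\<^bsub>k\<^sub>F\<^esub> (Q - 1) = \<one>\<^bsub>k\<^sub>F\<^esub>"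
proof -
  interpret k: field k\<^sub>F by (rule field_residue_field)
  show *: "a [^]\<^bsub>k\<^sub>F\<^esub> (Q - 1) = \<one>\<^bsub>k\<^sub>F\<^esub>" if "a \<noteq> \<zero>\<^bsub>k\<^sub>F\<^esub>"
    using group.pow_order_eq_1[OF k.field_mult_group, of a] that assms k.order_mult_of finite_residue_field
    by (simp add: Multiplicative_Group.nat_pow_mult_of)
  show "a [^]\<^bsub>k\<^sub>F\<^esub> Q = a"
  proof (cases "a = \<zero>\<^bsub>k\<^sub>F\<^esub>")
    case True
    then show ?thesis using Q_gt_1 k.nat_pow_zero by simp
  next
    case False
    have "a [^]\<^bsub>k\<^sub>F\<^esub> Suc (Q - 1) = a" using *[OF False] assms by simp
    then show ?thesis using Q_gt_1 by simp
  qed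
qed

text \<open>The residue of the cofactor in \<open>pow_diff_factor\<close> is a Q-fold multiple, and
  Q, the order of the additive group of the residue field, annihilates it. The Q-th power is thus
  contracting on each residue class, which drives the limits below.\<close>

lemma pow_order_cong:
  assumes "a \<in> O\<^sub>F" "b \<in> O\<^sub>F" "a \<ominus> b \<in> val_ge F v i" "1 \<le> i"
  shows "a [^] Q \<ominus> b [^] Q \<in> val_ge F v (i + 1)"
proof -
  interpret k: field k\<^sub>F by (rule field_residue_field)
  have "res a = res b"
    using assms val_ge_mono[OF assms(3), of 1] by (simp add: residue_eq_iff)
  from pow_diff_factor[OF assms(1,2) this, of "Q - 1"] Q_gt_1 obtain c where
    c: "c \<in> O\<^sub>F" "a [^] Q \<ominus> b [^] Q = (a \<ominus> b) \<otimes> c"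
      "res c = [Q] \<cdot>\<^bsub>k\<^sub>F\<^esub> (res a [^]\<^bsub>k\<^sub>F\<^esub> (Q - 1))" by auto
  have "[Q] \<cdot>\<^bsub>k\<^sub>F\<^esub> x = \<zero>\<^bsub>k\<^sub>F\<^esub>" if "x \<in> carrier k\<^sub>F" for x
    using group.pow_order_eq_1[OF k.add.is_group, of x] that by (simp add: order_def add_pow_def)
  then have "res c = \<zero>\<^bsub>k\<^sub>F\<^esub>"
    unfolding c(3) using residue_closed[OF assms(1)] by simp
  then have "c \<in> val_ge F v 1" using residue_eq_zero_iff[OF c(1)] by simp
  then show ?thesis unfolding c(2) by (rule val_ge_mult[OF assms(3)])
qed

lemma pow_order_power_cong:
  assumes "a \<in> O\<^sub>F" "b \<in> O\<^sub>F" "a \<ominus> b \<in> val_ge F v 1"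
  shows "a [^] (Q ^ n) \<ominus> b [^] (Q ^ n) \<in> val_ge F v (int n + 1)"
proof (induction n)
  case 0
  then show ?case using assms by (simp add: val_ge_carrier)
next
  case (Suc n)
  from pow_order_cong[OF integer_pow[OF assms(1)] integer_pow[OF assms(2)] Suc] 
  show ?case using assms(1,2)[THEN val_ge_carrier] by (simp add: nat_pow_pow mult.commute add.commute)
qed

text \<open>By the ultrametric inequality a bound on consecutive differences bounds all later ones,
  and the bound passes to the limit.\<close>

lemma convergent_sequence:
  assumes "\<And>n. s n \<in> carrier F" "\<And>n. s (Suc n) \<ominus> s n \<in> val_ge F v (int n)"
  obtains l where "l \<in> carrier F" "\<And>n. s n \<ominus> l \<in> val_ge F v (int n)"
proof -
  have tele: "s (n + k) \<ominus> s n \<in> val_ge F v (int n)" for n k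
  proof (induction k)
    case 0
    then show ?case using assms(1) by (simp add: minus_eq r_neg val_ge_zero)
  next
    case (Suc k)
    then show ?case
      using val_ge_minus_trans[OF assms(1,1,1) val_ge_mono[OF assms(2)[of "n + k"], of "int n"] Suc] by simp
  qed
  have tele': "s i \<ominus> s j \<in> val_ge F v (int n)" if "i \<ge> n" "j \<ge> n" for i j n
    using val_ge_minus_trans[OF assms(1,1,1) tele[of n "i - n"] 
        val_ge_minus_commute[OF assms(1,1) tele[of n "j - n"]]] that by simp
  have "val_Cauchy F v s"
    unfolding val_Cauchy_def
  proof
    fix m
    have "\<forall>i\<ge>nat m. \<forall>j\<ge>nat m. s i \<ominus> s j \<in> val_ge F v m"
      using val_ge_mono[OF tele'[of "nat m"]] by simp
    then show "\<exists>N. \<forall>i\<ge>N. \<forall>j\<ge>N. s i \<ominus> s j \<in> val_ge F v m" ..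
  qed
  with complete[of s] assms(1) obtain l where l: "l \<in> carrier F" "val_converges F v s l" by auto
  have "s n \<ominus> l \<in> val_ge F v (int n)" for n
  proof -
    from l(2) obtain N where N: "\<And>i. i \<ge> N \<Longrightarrow> s i \<ominus> l \<in> val_ge F v (int n)"
      unfolding val_converges_def by blast
    show ?thesis
      using val_ge_minus_trans[OF assms(1,1) l(1) tele'[of n n "max n N"] N[of "max n N"]] by simp
  qed
  with l(1) show ?thesis using that by blast
qed

text \<open>Both elements equal their own Q^n-th powers, whose difference lies in ever higher powers
  of the maximal ideal.\<close>

lemma teichmueller_unique:
  assumes "s \<in> O\<^sub>F" "t \<in> O\<^sub>F" "res s = res t" "s [^] Q = s" "t [^] Q = t"
  shows "s = t"
proof -
  note car = assms(1,2)[THEN val_ge_carrier]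
  have p: "x [^] (Q ^ n) = x" if "x \<in> O\<^sub>F" "x [^] Q = x" for x n
    by (induction n) (use that val_ge_carrier in \<open>auto simp: nat_pow_pow[symmetric]\<close>)
  have "s \<ominus> t \<in> val_ge F v (int n)" for n
    using val_ge_mono[OF pow_order_power_cong[OF assms(1,2), of n], of "int n"] assms p[of s n] p[of t n]
    by (simp add: residue_eq_iff)
  then have "s \<ominus> t = \<zero>" by (rule val_ge_Inter)
  then show ?thesis using car by (simp add: r_right_minus_eq)
qed

text \<open>The representative is the limit of x^(Q^n), which converges because \<open>x\<close> and
  x^Q have the same residue. The limit is fixed by the Q-th power since that only shifts the
  sequence.\<close>

lemma teichmueller_exists:
  assumes "x \<in> O\<^sub>F"
  shows "\<exists>t \<in> O\<^sub>F. res t = res x \<and> t [^] Q = t"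
proof -
  note xc = assms[THEN val_ge_carrier]
  let ?s = "\<lambda>n. x [^] (Q ^ n)"
  have 1: "x [^] Q \<ominus> x \<in> val_ge F v 1"
    using residue_eq_iff[OF integer_pow[OF assms] assms, of Q]
    by (simp add: residue_pow[OF assms] residue_field_pow_order residue_closed[OF assms])
  have "?s (Suc n) \<ominus> ?s n \<in> val_ge F v (int n + 1)" for n
    using pow_order_power_cong[OF integer_pow[OF assms] assms 1, of n] xc by (simp add: nat_pow_pow)
  then have "?s (Suc n) \<ominus> ?s n \<in> val_ge F v (int n)" for n
    by (rule val_ge_mono) simp
  then obtain t where t: "t \<in> carrier F" "\<And>n. ?s n \<ominus> t \<in> val_ge F v (int n)"
    using convergent_sequence[of ?s] xc by (metis nat_pow_closed)
  have "x \<ominus> t \<in> O\<^sub>F" using t(2)[of 0] xc by simp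
  then have "x \<ominus> (x \<ominus> t) \<in> O\<^sub>F" using assms val_ge_minus by blast
  moreover have "x \<ominus> (x \<ominus> t) = t" using xc t(1) by algebra
  ultimately have tO: "t \<in> O\<^sub>F" by simp
  have "res (?s 1) = res t"
    using residue_eq_iff[OF integer_pow[OF assms] tO] t(2)[of 1] by simp
  then have rt: "res t = res x"
    by (simp add: residue_pow[OF assms] residue_field_pow_order residue_closed[OF assms])
  have "t [^] Q \<ominus> t \<in> val_ge F v (int n)" for n
  proof -
    have "?s (Suc n) \<ominus> t \<in> val_ge F v (int (Suc n))" by (rule t(2))
    then have "?s (Suc n) [^] Q \<ominus> t [^] Q \<in> val_ge F v (int n)"
      using val_ge_mono[OF pow_order_cong[OF integer_pow[OF assms] tO], of "Q ^ Suc n" "int (Suc n)" "int n"] by simp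
    then have "t [^] Q \<ominus> ?s (Suc (Suc n)) \<in> val_ge F v (int n)"
      using val_ge_minus_commute xc t(1) by (simp add: nat_pow_pow mult.commute)
    moreover have "?s (Suc (Suc n)) \<ominus> t \<in> val_ge F v (int n)"
      using val_ge_mono[OF t(2)[of "Suc (Suc n)"], of "int n"] by simp
    ultimately show ?thesis
      by (rule val_ge_minus_trans[rotated 3]) (use xc t(1) in auto)
  qed
  then have "t [^] Q \<ominus> t = \<zero>" by (rule val_ge_Inter)
  then have "t [^] Q = t" using t(1) by (simp add: r_right_minus_eq)
  with rt tO show ?thesis by blast
qed

section \<open>The Teichmueller map and roots of unity\<close>

abbreviation teich where "teich \<equiv> teichmueller F v"

lemma teichmueller:
  assumes "a \<in> carrier k\<^sub>F"
  shows "teich a \<in> O\<^sub>F" "res (teich a) = a" "teich a [^] Q = teich a"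
proof -
  obtain x where x: "x \<in> O\<^sub>F" "res x = a" using residue_surj[OF assms] by blast
  then obtain t where t: "t \<in> O\<^sub>F" "res t = a" "t [^] Q = t" using teichmueller_exists by blast
  have "teich a = t"
    unfolding teichmueller_def
    by (rule the_equality) (use t teichmueller_unique mem_residue_class[OF assms] in auto)
  with t show "teich a \<in> O\<^sub>F" "res (teich a) = a" "teich a [^] Q = teich a" by auto
qed

lemma teichmueller_carrier: "a \<in> carrier k\<^sub>F \<Longrightarrow> teich a \<in> carrier F"
  using teichmueller(1) val_ge_carrier by blast

lemma root_of_unity_integer:
  assumes "x \<in> carrier F" "x [^] (n::nat) = \<one>" "0 < n"
  shows "x \<noteq> \<zero>" "v x = 0" "x \<in> O\<^sub>F"
proof -
  show x0: "x \<noteq> \<zero>" using assms nat_pow_zero[of n] one_not_zero by auto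
  have "int n * v x = 0" using val_pow[OF assms(1) x0, of n] assms(2) val_one by simp
  then show "v x = 0" using assms(3) by simp
  then show "x \<in> O\<^sub>F" using assms(1) by (simp add: mem_val_ge)
qed

text \<open>Such a root of unity is itself a fixed point of the Q-th power, hence the representative
  of its own residue.\<close>

lemma teichmueller_residue:
  assumes "x \<in> carrier F" "x [^] (Q - 1) = \<one>"
  shows "teich (res x) = x"
proof -
  note x = root_of_unity_integer[OF assms]
  have "x [^] Suc (Q - 1) = x" using assms by simp
  then have "x [^] Q = x" using Q_gt_1 by simp
  then show ?thesis
    using teichmueller_unique[of "teich (res x)" x] teichmueller[OF residue_closed] x Q_gt_1 by simp
qed

lemma teichmueller_nonzero:
  assumes "a \<in> carrier k\<^sub>F" "a \<noteq> \<zero>\<^bsub>k\<^sub>F\<^esub>"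
  shows "teich a \<noteq> \<zero>" "v (teich a) = 0" "teich a [^] (Q - 1) = \<one>"
proof -
  have "teich a \<notin> val_ge F v 1"
    using teichmueller[OF assms(1)] assms(2) residue_eq_zero_iff[of "teich a"] by simp
  then show 0: "teich a \<noteq> \<zero>" "v (teich a) = 0" 
    using integer_unit teichmueller(1)[OF assms(1)] by auto
  have "teich a [^] (Q - 1) \<otimes> teich a = \<one> \<otimes> teich a"
    using teichmueller(3)[OF assms(1)] teichmueller_carrier[OF assms(1)] Q_gt_1
    by (simp add: nat_pow_Suc[symmetric] del: nat_pow_Suc)
  then show "teich a [^] (Q - 1) = \<one>"
    using m_rcancel[of "teich a" "teich a [^] (Q - 1)" \<one>] teichmueller_carrier[OF assms(1)] 0 by simp
qed

lemma teichmueller_eqI: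
  assumes "x \<in> O\<^sub>F" "x [^] Q = x" "res x = a"
  shows "teich a = x"
  using teichmueller_unique[of "teich a" x] teichmueller[of a] residue_closed assms by blast

lemma teichmueller_pow:
  assumes "a \<in> carrier k\<^sub>F"
  shows "teich (a [^]\<^bsub>k\<^sub>F\<^esub> (n::nat)) = teich a [^] n"
proof (rule teichmueller_eqI)
  show "(teich a [^] n) [^] Q = teich a [^] n"
    using teichmueller(3)[OF assms] teichmueller_carrier[OF assms]
    by (simp add: nat_pow_pow mult.commute[of n]) (simp add: nat_pow_pow[symmetric])
qed (use assms in \<open>auto simp: teichmueller integer_pow residue_pow\<close>)

text \<open>
  If \<open>Q - 1 = e M\<close>, then \<open>1/e = -M (1 + Q + Q\<^sup>2 + \<dots>)\<close> in the \<open>p\<close>-adic integers; the root is the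
  corresponding power of \<open>u\<close>.
\<close>

lemma one_unit_root:
  assumes "u \<in> O\<^sub>F" "res u = \<one>\<^bsub>k\<^sub>F\<^esub>" "e dvd Q - 1"
  shows "\<exists>y \<in> carrier F. y [^] e = u"
proof -
  interpret k: field k\<^sub>F by (rule field_residue_field)
  obtain M where M: "Q - 1 = e * M" using assms(3) by blast
  have unot: "u \<notin> val_ge F v 1" using assms(1,2) residue_eq_zero_iff[OF assms(1)] k.one_not_zero by auto
  note u = integer_unit[OF assms(1) unot] 
  note uc = assms(1)[THEN val_ge_carrier]
  define w where "w = inv u"
  have w: "w \<in> O\<^sub>F" "w \<in> carrier F" "u \<otimes> w = \<one>" 
    unfolding w_def using u uc nonzero_inv by auto
  have "res u \<otimes>\<^bsub>k\<^sub>F\<^esub> res w = \<one>\<^bsub>k\<^sub>F\<^esub>" 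
    using residue_mult[OF assms(1) w(1)] w(3) residue_one by simp
  then have "res w = res \<one>" using assms residue_closed[OF w(1)] by (simp add: residue_one)
  then have w1: "w \<ominus> \<one> \<in> val_ge F v 1" using residue_eq_iff[OF w(1) one_integer] by simp
  have wQ: "w [^] (Q ^ n) \<ominus> \<one> \<in> val_ge F v (int n + 1)" for n
    using pow_order_power_cong[OF w(1) one_integer w1, of n] by simp
  \<comment> \<open>The inverse \<open>w\<close> absorbs the minus sign in the exponent:
    \<open>s n\<close> is w^(M(1 + Q + ... + Q^(n-1))). As 1 + e M (1 + ... + Q^(n-1)) = Q^n, its
    e-th power is w^(Q^n - 1) = u w^(Q^n), which tends to \<open>u\<close>.\<close>
  define s where "s = rec_nat \<one> (\<lambda>n x. x \<otimes> w [^] (M * Q ^ n))"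
  have s0: "s 0 = \<one>" and sSuc: "\<And>n. s (Suc n) = s n \<otimes> w [^] (M * Q ^ n)" by (auto simp: s_def)
  have sO: "s n \<in> O\<^sub>F" for n
    by (induction n) (auto simp: s0 sSuc one_integer integer_mult integer_pow w)
  note sc = sO[THEN val_ge_carrier]
  have se: "s n [^] e = u \<otimes> w [^] (Q ^ n)" for n
  proof (induction n)
    case 0
    then show ?case using w by (simp add: s0)
  next
    case (Suc n)
    have "e * (M * Q ^ n) + Q ^ n = (e * M + 1) * Q ^ n" by (simp add: algebra_simps)
    also have "e * M + 1 = Q" using M Q_gt_1 by linarith
    finally have eM: "Q ^ n + e * (M * Q ^ n) = Q ^ Suc n" by simp
    have "s (Suc n) [^] e = (u \<otimes> w [^] (Q ^ n)) \<otimes> w [^] (e * (M * Q ^ n))"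
      unfolding sSuc Suc[symmetric] using w(2) sc
      by (simp add: nat_pow_distrib nat_pow_pow mult.commute)
    also have "\<dots> = u \<otimes> w [^] (Q ^ n + e * (M * Q ^ n))"
      using uc w(2) by (simp add: m_assoc nat_pow_mult)
    finally show ?case unfolding eM .
  qed
  have "s (Suc n) \<ominus> s n \<in> val_ge F v (int n)" for n
  proof -
    have "(w [^] (Q ^ n)) [^] M \<ominus> \<one> [^] M \<in> val_ge F v (int n + 1)"
      by (rule pow_val_ge_cong[OF integer_pow[OF w(1)] one_integer wQ]) simp
    then have "w [^] (M * Q ^ n) \<ominus> \<one> \<in> val_ge F v (int n)"
      using w(2) val_ge_mono[of _ "int n + 1" "int n"] by (simp add: nat_pow_pow mult.commute)
    from val_ge_mult[OF sO this] have "s n \<otimes> (w [^] (M * Q ^ n) \<ominus> \<one>) \<in> val_ge F v (int n)" by simp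
    moreover have "s n \<otimes> (x \<ominus> \<one>) = s n \<otimes> x \<ominus> s n" if "x \<in> carrier F" for x 
      using sc[of n] that by algebra
    ultimately show ?thesis using w(2) by (simp add: sSuc)
  qed
  then obtain y where y: "y \<in> carrier F" "\<And>n. s n \<ominus> y \<in> val_ge F v (int n)"
    using convergent_sequence[of s] sc by blast
  have "s 0 \<ominus> (s 0 \<ominus> y) \<in> O\<^sub>F" using y(2)[of 0] sO[of 0] val_ge_minus by simp
  moreover have "s 0 \<ominus> (s 0 \<ominus> y) = y" using sc[of 0] y(1) by algebra
  ultimately have yO: "y \<in> O\<^sub>F" by simp
  have "y [^] e \<ominus> u \<in> val_ge F v (int n)" for n
  proof -
    have "s (Suc n) [^] e \<ominus> y [^] e \<in> val_ge F v (int (Suc n))"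
      by (rule pow_val_ge_cong[OF sO yO y(2)]) simp
    then have "y [^] e \<ominus> s (Suc n) [^] e \<in> val_ge F v (int n)"
      using val_ge_mono[OF val_ge_minus_commute] sc y(1) by simp
    moreover have "s (Suc n) [^] e \<ominus> u \<in> val_ge F v (int n)"
    proof -
      have "u \<otimes> (w [^] (Q ^ Suc n) \<ominus> \<one>) \<in> val_ge F v (int n)"
        using val_ge_mono[OF val_ge_mult[OF assms(1) wQ[of "Suc n"]], of "int n"] by simp
      moreover have "u \<otimes> (x \<ominus> \<one>) = u \<otimes> x \<ominus> u" if "x \<in> carrier F" for x 
        using uc that by algebra
      ultimately show ?thesis unfolding se using w(2) by simp
    qed
    ultimately show ?thesis
      by (rule val_ge_minus_trans[rotated 3]) (use sc y(1) uc in auto)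
  qed
  then have "y [^] e \<ominus> u = \<zero>" by (rule val_ge_Inter)
  then show ?thesis using y(1) uc by (auto simp: r_right_minus_eq)
qed

end


section \<open>Extensions of homomorphisms\<close>

text \<open>Coordinates in a basis identify \<open>E\<close> with the lists of length n over
  \<open>K\<close>. This yields the order q^f of the residue field of the unramified
  extension.\<close>

lemma (in ring) card_of_dimension:
  assumes "subfield K R" "dimension n K E"
  shows "card E = card K ^ n"
proof -
  obtain Us where Us: "set Us \<subseteq> carrier R" "independent K Us" "length Us = n" "Span K Us = E"
    using exists_base[OF assms] by blast
  let ?A = "{Ks. set Ks \<subseteq> K \<and> length Ks = n}"
  have mem: "combine Ks Us \<in> E" if "Ks \<in> ?A" for Ks
    using that Span_mem_iff_length_version[OF assms(1) Us(1), of "combine Ks Us"] Us(3,4) by auto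
  have uni: "\<exists>!Ks. Ks \<in> ?A \<and> x = combine Ks Us" if "x \<in> E" for x
    using unique_decomposition[OF assms(1) Us(2), of x] that unfolding Us(3,4) by simp
  have *: "bij_betw (\<lambda>Ks. combine Ks Us) ?A E"
    unfolding bij_betw_def
  proof
    show "inj_on (\<lambda>Ks. combine Ks Us) ?A"
    proof (rule inj_onI)
      fix Ks Ks' assume "Ks \<in> ?A" "Ks' \<in> ?A" "combine Ks Us = combine Ks' Us"
      then show "Ks = Ks'" using uni[OF mem[of Ks]] by metis
    qed
    show "(\<lambda>Ks. combine Ks Us) ` ?A = E"
      using mem uni by blast
  qed
  show "card E = card K ^ n"
  proof (cases "finite K")
    case True
    then show ?thesis using bij_betw_same_card[OF *] card_lists_length_eq[of K n] by simp
  next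
    \<comment> \<open>The cardinality of an infinite set is 0, so n = 0 must be separated: there 0^0
      = 1 counts the zero space.\<close>
    case False
    show ?thesis
    proof (cases n)
      case 0
      then have "E = {\<zero>}" using dimension_zero[OF assms(1), of E] assms(2) by blast
      then show ?thesis using 0 by simp
    next
      case (Suc m)
      have inj: "inj_on (\<lambda>k. k # replicate m \<zero>) K" by (rule inj_onI) simp
      have "(\<lambda>k. k # replicate m \<zero>) ` K \<subseteq> ?A"
        using Suc subringE(2)[OF subfieldE(1)[OF assms(1)]] by auto
      then have "infinite ?A" using False inj finite_subset finite_imageD by blast
      then have "infinite E" using bij_betw_finite[OF *] by simp
      with False Suc show ?thesis by simp
    qed
  qed
qed

lemma (in field) card_roots_le_degree:
  assumes "p \<in> carrier (poly_ring R)" "p \<noteq> []" "A \<subseteq> carrier R" "\<And>x. x \<in> A \<Longrightarrow> eval p x = \<zero>"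
  shows "finite A" "card A \<le> degree p"
proof -
  have sub: "A \<subseteq> set_mset (roots p)"
    using assms roots_mem_iff_is_root[OF assms(1)] by (auto simp: is_root_def)
  then show "finite A" using finite_subset by blast
  have "card (set_mset M) \<le> size M" for M :: "'a multiset"
    by (induction M) (auto simp: card_insert_if le_SucI)
  note le = this[of "roots p"]
  have "card A \<le> card (set_mset (roots p))" by (rule card_mono[OF _ sub]) simp
  also have "\<dots> \<le> size (roots p)" by (rule le)
  also have "\<dots> \<le> degree p" by (rule size_roots_le_degree[OF assms(1)])
  finally show "card A \<le> degree p" .
qed

lemma (in ring) eval_subring_hom:
  assumes "subring E R" "s \<in> ring_hom (R\<lparr>carrier := E\<rparr>) R" "set p \<subseteq> E" "x \<in> E"
  shows "s (eval p x) = eval (map s p) (s x)"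
proof -
  interpret s: ring_hom_ring "R\<lparr>carrier := E\<rparr>" R s
    using ring_hom_ringI2[OF subring_is_ring[OF assms(1)] ring_axioms assms(2)] .
  show ?thesis using s.eval_hom'[of x p] assms by simp
qed

lemma (in ring) homs_agree_simple_extension:
  assumes "s \<in> ring_hom (R\<lparr>carrier := E\<rparr>) R" "t \<in> ring_hom (R\<lparr>carrier := E\<rparr>) R" "subring E R"
    and "K \<subseteq> E" "z \<in> E" "\<And>x. x \<in> K \<Longrightarrow> s x = t x" "s z = t z"
    and "x \<in> simple_extension K z"
  shows "s x = t x"
proof -
  have "x \<in> E \<and> s x = t x" using assms(8)
  proof (induction rule: simple_extension.induct)
    case zero
    then show ?case
      using ring_hom_zero[OF assms(1) subring_is_ring[OF assms(3)] ring_axioms]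
        ring_hom_zero[OF assms(2) subring_is_ring[OF assms(3)] ring_axioms] subringE(2)[OF assms(3)] by simp
  next
    case (lin a b)
    then have b: "b \<in> E" "a \<in> E" "a \<otimes> z \<in> E" "a \<otimes> z \<oplus> b \<in> E"
      using assms subringE(6,7)[OF assms(3)] by auto
    have *: "h (a \<otimes> z \<oplus> b) = h a \<otimes> h z \<oplus> h b" if "h \<in> ring_hom (R\<lparr>carrier := E\<rparr>) R" for h
      using ring_hom_add[OF that, of "a \<otimes> z" b] ring_hom_mult[OF that, of a z] b assms(5) by simp
    show ?case unfolding *[OF assms(1)] *[OF assms(2)] using lin(2,3) assms(6)[OF lin(2)] assms(7) b by simp
  qed
  then show ?thesis ..
qed

text \<open>
  An endomorphism \<open>s\<close> of an extension of degree \<open>n\<close> which moves one element \<open>z\<close> to \<open>n\<close> distinct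
  conjugates: the extension is then generated by \<open>z\<close> and its endomorphisms are the powers of \<open>s\<close>.
\<close>

locale cyclic_generation = field R for R (structure) +
  fixes K E s z n
  assumes K: "subfield K R" and E: "subfield E R" and KE: "K \<subseteq> E" and dim: "dimension n K E"
    and hom: "s \<in> ring_hom (R\<lparr>carrier := E\<rparr>) (R\<lparr>carrier := E\<rparr>)" and fixK: "\<And>x. x \<in> K \<Longrightarrow> s x = x"
    and z: "z \<in> E" and distinct: "inj_on (\<lambda>i. (s ^^ i) z) {..<n}"
begin

lemma E_carrier: "x \<in> E \<Longrightarrow> x \<in> carrier R"
  using subfieldE(3)[OF E] by blast

lemma hom_carrier_mono:
  "t \<in> ring_hom (R\<lparr>carrier := E\<rparr>) (R\<lparr>carrier := E\<rparr>) \<Longrightarrow> t \<in> ring_hom (R\<lparr>carrier := E\<rparr>) R"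
  using E_carrier by (auto simp: ring_hom_def)

lemma funpow_hom: "s ^^ i \<in> ring_hom (R\<lparr>carrier := E\<rparr>) (R\<lparr>carrier := E\<rparr>)"
proof (induction i)
  case 0
  then show ?case by (simp add: ring_hom_def)
next
  case (Suc i)
  show ?case using ring_hom_trans[OF Suc hom] by (simp only: funpow.simps)
qed

lemma funpow_fix: "x \<in> K \<Longrightarrow> (s ^^ i) x = x"
  by (induction i) (auto simp: fixK)

lemma eval_hom_fixing:
  assumes "t \<in> ring_hom (R\<lparr>carrier := E\<rparr>) (R\<lparr>carrier := E\<rparr>)" "\<And>x. x \<in> K \<Longrightarrow> t x = x"
    and "p \<in> carrier (K[X])" "x \<in> E"
  shows "eval p (t x) = t (eval p x)"
proof -
  have p: "set p \<subseteq> K" using assms(3) by (simp add: polynomial_incl univ_poly_carrier)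
  then have "map t p = p" using assms(2) by (intro map_idI) auto
  then show ?thesis
    using eval_subring_hom[OF subfieldE(1)[OF E] hom_carrier_mono[OF assms(1)], of p x] p KE assms(4) by auto
qed

lemma funpow_root:
  assumes "p \<in> carrier (K[X])" "eval p z = \<zero>"
  shows "(s ^^ i) z \<in> E" "eval p ((s ^^ i) z) = \<zero>"
proof -
  show "(s ^^ i) z \<in> E" using ring_hom_memE(1)[OF funpow_hom[of i]] z by simp
  have "(s ^^ i) \<zero> = \<zero>"
    by (rule funpow_fix) (use subringE(2)[OF subfieldE(1)[OF K]] in simp)
  then show "eval p ((s ^^ i) z) = \<zero>"
    using eval_hom_fixing[OF funpow_hom funpow_fix assms(1) z] assms(2) by simp
qed

text \<open>The coefficients of \<open>p\<close> are fixed by \<open>s\<close>, so the n distinct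
  conjugates of \<open>z\<close> are all roots of \<open>p\<close>.\<close>

lemma degree_ge:
  assumes "p \<in> carrier (K[X])" "p \<noteq> []" "eval p z = \<zero>"
  shows "n \<le> degree p"
proof -
  have "card ((\<lambda>i. (s ^^ i) z) ` {..<n}) \<le> degree p"
    using funpow_root[OF assms(1,3)] E_carrier
    by (intro card_roots_le_degree[OF carrier_polynomial_shell[OF subfieldE(1)[OF K] assms(1)] assms(2)]) auto
  then show ?thesis using card_image[OF distinct] by simp
qed

lemma algebraic_generator: "(algebraic over K) z"
  using finite_dimension_imp_algebraic[OF K subfieldE(1)[OF E] finite_dimensionI[OF dim] z] .

lemmas Irr_z = IrrE[OF K E_carrier[OF z] algebraic_generator]

text \<open>The degree d is at least n by \<open>degree_ge\<close>, and at most n because 1, z, ...,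
  z^(d-1) are independent in a space of dimension n. Equality makes them a basis.\<close>

lemma degree_Irr: "degree (Irr K z) = n" and simple_extension_eq: "simple_extension K z = E"
  and Span_eq: "Span K (exp_base z n) = E"
proof -
  let ?d = "degree (Irr K z)"
  have ne: "Irr K z \<noteq> []" using Irr_z(2) pirreducibleE(1)[OF subfieldE(1)[OF K] Irr_z(1)] by blast
  have 1: "n \<le> ?d" using degree_ge[OF Irr_z(1) ne Irr_z(4)] .
  have ind: "independent K (exp_base z ?d)"
    using exp_base_independent[OF K E_carrier[OF z] algebraic_generator] .
  have sub: "simple_extension K z \<subseteq> E"
    using simple_extension_subring_incl[OF subfieldE(1)[OF E] KE z] .
  have Sp: "Span K (exp_base z ?d) = simple_extension K z"
    using Span_exp_base[OF K E_carrier[OF z] algebraic_generator] .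
  have setE: "set (exp_base z ?d) \<subseteq> E"
    using Span_base_incl[OF K exp_base_closed[OF E_carrier[OF z]]] Sp sub by blast
  have 2: "?d \<le> n"
    using independent_length_le_dimension[OF K dim ind setE] by (simp add: exp_base_def)
  show d: "?d = n" using 1 2 by simp
  then show "Span K (exp_base z n) = E"
    using independent_length_eq_dimension[OF K dim ind setE] by (simp add: exp_base_def)
  then show "simple_extension K z = E" using Sp d by simp
qed

lemma element_as_eval:
  assumes "x \<in> E"
  obtains p where "p \<in> carrier (K[X])" "length p \<le> n" "x = eval p z"
  using assms Span_eq_eval_img[OF K E_carrier[OF z], of n] Span_eq by auto

text \<open>The image of \<open>z\<close> is again a root of its minimal polynomial, whose n
  possible roots are already used up by the conjugates under \<open>s\<close>.\<close>

lemma hom_is_funpow: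
  assumes "t \<in> ring_hom (R\<lparr>carrier := E\<rparr>) (R\<lparr>carrier := E\<rparr>)" "\<And>x. x \<in> K \<Longrightarrow> t x = x"
  shows "\<exists>i<n. \<forall>x\<in>E. t x = (s ^^ i) x"
proof -
  let ?p = "Irr K z"
  have ne: "Irr K z \<noteq> []" using Irr_z(2) pirreducibleE(1)[OF subfieldE(1)[OF K] Irr_z(1)] by blast
  have tz: "t z \<in> E" "eval ?p (t z) = \<zero>"
    using ring_hom_memE(1)[OF assms(1)] z eval_hom_fixing[OF assms Irr_z(1) z] Irr_z(4)
      assms(2)[OF subringE(2)[OF subfieldE(1)[OF K]]] by auto
  let ?A = "(\<lambda>i. (s ^^ i) z) ` {..<n}"
  have "t z \<in> ?A"
  proof (rule ccontr)
    assume "t z \<notin> ?A"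
    then have "card (insert (t z) ?A) = Suc n" using card_image[OF distinct] by simp
    moreover have "card (insert (t z) ?A) \<le> degree ?p"
      using funpow_root[OF Irr_z(1,4)] E_carrier tz
      by (intro card_roots_le_degree[OF carrier_polynomial_shell[OF subfieldE(1)[OF K] Irr_z(1)] ne]) auto
    ultimately show False using degree_Irr by simp
  qed
  then obtain i where i: "i < n" "t z = (s ^^ i) z" by auto
  have "t x = (s ^^ i) x" if "x \<in> E" for x
    by (rule homs_agree_simple_extension[OF hom_carrier_mono[OF assms(1)] hom_carrier_mono[OF funpow_hom]
          subfieldE(1)[OF E] KE z]) (use assms(2) i funpow_fix that simple_extension_eq in auto)
  with i show ?thesis by blast
qed

end

text \<open>Vieta: p(0) is the leading coefficient times the product of the -r over the roots with
  multiplicity, and each (-r)^e is \<open>c\<close>. Using -r instead of r avoids a sign depending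
  on the degree. For a minimal polynomial this does the work of a norm from
  \<open>L\<close>.\<close>

lemma (in algebraically_closed) const_coeff_of_power_roots:
  assumes "p \<in> carrier (poly_ring L)" "p \<noteq> []" "c \<in> carrier L"
    and "\<And>r. r \<in> carrier L \<Longrightarrow> eval p r = \<zero> \<Longrightarrow> (\<ominus> r) [^] (e::nat) = c"
  shows "eval p \<zero> [^] e = lead_coeff p [^] e \<otimes> c [^] (degree p)"
  using assms
proof (induction "degree p" arbitrary: p)
  case 0
  then obtain a where "p = [a]" "a \<in> carrier L"
    using polynomial_incl[of "carrier L" p] by (cases p) (auto simp: univ_poly_carrier)
  then show ?case by simp
next
  case (Suc d p)
  interpret UP: ring "poly_ring L" by (rule univ_poly_is_ring[OF carrier_is_subring])
  have "splitted p" by (rule roots_over_carrier) fact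
  then have "roots p \<noteq> {#}" using Suc(2) by (auto simp: splitted_def)
  then obtain a where a: "a \<in> carrier L" "a \<in># roots p" "[\<one>, \<ominus> a] \<in> carrier (poly_ring L)"
    "[\<one>, \<ominus> a] pdivides p" using Suc(3) by blast
  from a(4) obtain q where q: "q \<in> carrier (poly_ring L)" "p = [\<one>, \<ominus> a] \<otimes>\<^bsub>poly_ring L\<^esub> q"
    unfolding pdivides_def by blast
  then have qn: "q \<noteq> []" using Suc(4) UP.r_null[OF a(3)]
    by (auto simp: univ_poly_zero)
  have pp: "polynomial (carrier L) [\<one>, \<ominus> a]" "polynomial (carrier L) q"
    using a(3) q(1) by (auto simp: univ_poly_carrier)
  have p: "p = poly_mult [\<one>, \<ominus> a] q" using q(2) by (simp add: univ_poly_mult)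
  have deg: "degree q = d"
    using Suc(2) qn poly_mult_degree_eq[OF carrier_is_subring pp] p by simp
  have qc: "set q \<subseteq> carrier L" using polynomial_in_carrier[OF carrier_is_subring pp(2)] .
  have ev: "eval p x = (x \<ominus> a) \<otimes> eval q x" if "x \<in> carrier L" for x
    unfolding p using eval_poly_mult[of "[\<one>, \<ominus> a]" q x] qc a(1) that by (simp add: minus_eq)
  have lc: "lead_coeff p = lead_coeff q"
  proof -
    have "lead_coeff p = \<one> \<otimes> lead_coeff q"
      unfolding p using poly_mult_lead_coeff[OF carrier_is_subring pp] qn by simp
    moreover have "lead_coeff q \<in> carrier L" using qc qn by (cases q) auto
    ultimately show ?thesis by simp
  qed
  have lq: "lead_coeff q \<in> carrier L" using qc qn by (cases q) auto
  have ra: "eval p a = \<zero>" using a(2) roots_mem_iff_is_root[OF Suc(3)] by (simp add: is_root_def)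
  have eq0: "eval q \<zero> \<in> carrier L" by (rule eval_in_carrier[OF qc]) simp
  have "eval q \<zero> [^] e = lead_coeff q [^] e \<otimes> c [^] degree q"
  proof (rule Suc(1)[OF deg[symmetric] q(1) qn Suc(5)])
    fix r assume "r \<in> carrier L" "eval q r = \<zero>"
    then show "(\<ominus> r) [^] e = c" using Suc(6)[of r] ev[of r] a(1) by simp
  qed
  moreover have "eval p \<zero> = \<ominus> a \<otimes> eval q \<zero>" using ev[of \<zero>] a(1) by (simp add: minus_eq)
  ultimately show ?case
    using Suc(6)[OF a(1) ra] Suc(5) a(1) eq0 lq unfolding lc deg Suc(2)[symmetric]
    by (simp add: nat_pow_distrib m_ac)
qed

text \<open>The homomorphism theorem with the image f(A) in place of a quotient: the value at f(a)
  is read off from a chosen preimage, and \<open>ker\<close> makes it independent of the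
  choice.\<close>

lemma ring_hom_factor:
  assumes "ring_hom_ring A B f" "ring_hom_ring A C g"
    and ker: "\<And>a. a \<in> carrier A \<Longrightarrow> f a = \<zero>\<^bsub>B\<^esub> \<Longrightarrow> g a = \<zero>\<^bsub>C\<^esub>"
  shows "\<exists>t \<in> ring_hom (B\<lparr>carrier := f ` carrier A\<rparr>) C. \<forall>a \<in> carrier A. t (f a) = g a"
proof -
  interpret f: ring_hom_ring A B f by fact
  interpret g: ring_hom_ring A C g by fact
  define t where "t x = g (SOME a. a \<in> carrier A \<and> f a = x)" for x
  have eq: "g a = g b" if "a \<in> carrier A" "b \<in> carrier A" "f a = f b" for a b
  proof -
    have "f (a \<oplus>\<^bsub>A\<^esub> \<ominus>\<^bsub>A\<^esub> b) = \<zero>\<^bsub>B\<^esub>" using that by (simp add: f.S.r_neg)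
    then have "g (a \<oplus>\<^bsub>A\<^esub> \<ominus>\<^bsub>A\<^esub> b) = \<zero>\<^bsub>C\<^esub>" using ker that by simp
    then have "g a \<ominus>\<^bsub>C\<^esub> g b = \<zero>\<^bsub>C\<^esub>" using that by (simp add: g.S.minus_eq)
    then show ?thesis using that by simp
  qed
  have t: "t (f a) = g a" if "a \<in> carrier A" for a
  proof -
    have "(SOME a'. a' \<in> carrier A \<and> f a' = f a) \<in> carrier A \<and> f (SOME a'. a' \<in> carrier A \<and> f a' = f a) = f a"
      using that by (intro someI[of "\<lambda>a'. a' \<in> carrier A \<and> f a' = f a" a]) simp
    then show ?thesis unfolding t_def using eq that by blast
  qed
  have "t \<in> ring_hom (B\<lparr>carrier := f ` carrier A\<rparr>) C"
  proof (rule ring_hom_memI)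
    fix x y assume "x \<in> carrier (B\<lparr>carrier := f ` carrier A\<rparr>)" "y \<in> carrier (B\<lparr>carrier := f ` carrier A\<rparr>)"
    then obtain a b where ab: "a \<in> carrier A" "b \<in> carrier A" "x = f a" "y = f b" by auto
    show "t (x \<otimes>\<^bsub>B\<lparr>carrier := f ` carrier A\<rparr>\<^esub> y) = t x \<otimes>\<^bsub>C\<^esub> t y"
      using t[of "a \<otimes>\<^bsub>A\<^esub> b"] t[of a] t[of b] ab by simp
    show "t (x \<oplus>\<^bsub>B\<lparr>carrier := f ` carrier A\<rparr>\<^esub> y) = t x \<oplus>\<^bsub>C\<^esub> t y"
      using t[of "a \<oplus>\<^bsub>A\<^esub> b"] t[of a] t[of b] ab by simp
  next
    show "t \<one>\<^bsub>B\<lparr>carrier := f ` carrier A\<rparr>\<^esub> = \<one>\<^bsub>C\<^esub>" using t[of "\<one>\<^bsub>A\<^esub>"] by simp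
  qed (use t in auto)
  with t show ?thesis by blast
qed

text \<open>F(y) is the image of F[X] under evaluation at \<open>y\<close>, so it is enough that
  applying \<open>s\<close> to coefficients and evaluating at \<open>y'\<close> kills every p
  vanishing at \<open>y\<close>. The remainder of such a p modulo \<open>p0\<close> also vanishes at
  \<open>y\<close> and has smaller degree, hence is zero by \<open>min\<close>; minimality of the
  degree takes the place of irreducibility.\<close>

lemma (in domain) hom_extension:
  assumes F: "subfield F R" and s: "s \<in> ring_hom (R\<lparr>carrier := F\<rparr>) R"
    and y: "y \<in> carrier R" and y': "y' \<in> carrier R"
    and p0: "p0 \<in> carrier (F[X])" "p0 \<noteq> []"
    and min: "\<And>p. p \<in> carrier (F[X]) \<Longrightarrow> p \<noteq> [] \<Longrightarrow> eval p y = \<zero> \<Longrightarrow> degree p0 \<le> degree p"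
    and p0y: "eval p0 y = \<zero>" and p0y': "eval (map s p0) y' = \<zero>"
  shows "\<exists>t \<in> ring_hom (R\<lparr>carrier := simple_extension F y\<rparr>) R. (\<forall>x\<in>F. t x = s x) \<and> t y = y'"
proof -
  note Fr = subfieldE(1)[OF F] and Fc = subfieldE(3)[OF F]
  interpret s: ring_hom_ring "R\<lparr>carrier := F\<rparr>" R s
    using ring_hom_ringI2[OF subring_is_ring[OF Fr] ring_axioms s] .
  have inc: "set p \<subseteq> F" if "p \<in> carrier (F[X])" for p
    using that by (simp add: polynomial_incl univ_poly_carrier)
  have sF: "s x \<in> carrier R" if "x \<in> F" for x using s.hom_closed that by simp
  have minc: "set (map s p) \<subseteq> carrier R" if "set p \<subseteq> F" for p using that sF by auto
  define g where "g p = eval (map s p) y'" for p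
  have g: "g \<in> ring_hom (F[X]) R"
  proof (rule ring_hom_memI)
    fix p assume "p \<in> carrier (F[X])"
    then show "g p \<in> carrier R" unfolding g_def using eval_in_carrier[OF minc[OF inc] y'] by blast
  next
    fix p q assume pq: "p \<in> carrier (F[X])" "q \<in> carrier (F[X])"
    note i = pq[THEN inc]
    have cp: "set (poly_add p q) \<subseteq> F" "set (poly_mult p q) \<subseteq> F"
      using inc[OF ring.ring_simprules(1)[OF univ_poly_is_ring[OF Fr] pq]]
        inc[OF ring.ring_simprules(5)[OF univ_poly_is_ring[OF Fr] pq]] 
      by (simp_all add: univ_poly_add univ_poly_mult)
    \<comment> \<open>The coefficientwise image is compared with a polynomial only up to leading
      zeros, which \<open>eval\<close> does not see.\<close>
    have "normalize (map s (poly_add p q)) = poly_add (map s p) (map s q)"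
      using s.poly_add_hom'[of p q] i poly_add_consistent[OF Fr] by simp
    then have "eval (map s (poly_add p q)) y' = eval (map s p) y' \<oplus> eval (map s q) y'"
      using eval_normalize[OF minc[OF cp(1)] y'] eval_poly_add[OF minc[OF i(1)] minc[OF i(2)] y'] by simp
    then show "g (p \<oplus>\<^bsub>F[X]\<^esub> q) = g p \<oplus> g q" by (simp add: g_def univ_poly_add)
    have "normalize (map s (poly_mult p q)) = poly_mult (map s p) (map s q)"
      using s.poly_mult_hom'[of p q] i poly_mult_consistent[OF Fr] by simp
    then have "eval (map s (poly_mult p q)) y' = eval (map s p) y' \<otimes> eval (map s q) y'"
      using eval_normalize[OF minc[OF cp(2)] y'] eval_poly_mult[OF minc[OF i(1)] minc[OF i(2)] y'] by simp
    then show "g (p \<otimes>\<^bsub>F[X]\<^esub> q) = g p \<otimes> g q" by (simp add: g_def univ_poly_mult)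
  next
    show "g \<one>\<^bsub>F[X]\<^esub> = \<one>" using s.hom_one y' by (simp add: g_def univ_poly_one)
  qed
  note evy = eval_is_hom[OF Fr y]
  interpret P: domain "F[X]" by (rule univ_poly_is_domain[OF Fr])
  have gr: "ring_hom_ring (F[X]) R g" using ring_hom_ringI2[OF P.ring_axioms ring_axioms g] .
  have "g p = \<zero>" if p: "p \<in> carrier (F[X])" "eval p y = \<zero>" for p
  proof -
    define b r where "b = p pdiv p0" and "r = p pmod p0"
    have br: "b \<in> carrier (F[X])" "r \<in> carrier (F[X])" "p = (p0 \<otimes>\<^bsub>F[X]\<^esub> b) \<oplus>\<^bsub>F[X]\<^esub> r"
      "r = [] \<or> degree r < degree p0"
      using long_division_closed[OF F p(1) p0(1)] pdiv_pmod[OF F p(1) p0(1)] pmod_degree[OF F p(1) p0]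
      by (auto simp: b_def r_def)
    have "eval p y = eval p0 y \<otimes> eval b y \<oplus> eval r y"
      using br(3) ring_hom_add[OF evy, of "p0 \<otimes>\<^bsub>F[X]\<^esub> b" r] ring_hom_mult[OF evy, of p0 b] br p0 by simp
    then have "eval r y = \<zero>"
      using p(2) p0y ring_hom_closed[OF evy br(1)] ring_hom_closed[OF evy br(2)] by simp
    then have "r = []" using min[OF br(2)] br(4) by fastforce
    then have "g r = \<zero>" by (simp add: g_def)
    moreover have "g p = g p0 \<otimes> g b \<oplus> g r"
      using br(3) ring_hom_add[OF g, of "p0 \<otimes>\<^bsub>F[X]\<^esub> b" r] ring_hom_mult[OF g, of p0 b] br p0 by simp
    moreover have "g p0 = \<zero>" using p0y' by (simp add: g_def)
    ultimately show ?thesis using ring_hom_closed[OF g br(1)] by simp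
  qed
  from ring_hom_factor[OF eval_ring_hom[OF Fr y] gr this]
  obtain t where t: "t \<in> ring_hom (R\<lparr>carrier := (\<lambda>p. eval p y) ` carrier (F[X])\<rparr>) R"
    "\<And>p. p \<in> carrier (F[X]) \<Longrightarrow> t (eval p y) = g p" by blast
  have "t x = s x" if "x \<in> F" for x
  proof -
    have xc: "x \<in> carrier R" using that Fc by auto
    \<comment> \<open>The constant polynomial is the empty list when \<open>x\<close> is zero, hence
      the normalisation.\<close>
    have pc: "normalize [x] \<in> carrier (F[X])"
      using normalize_gives_polynomial[of "[x]" F] that by (simp add: univ_poly_carrier)
    have "eval (normalize [x]) y = x" using eval_normalize[of "[x]" y] xc y by simp
    moreover have "g (normalize [x]) = s x" using sF[OF that] y' s.hom_zero by (auto simp: g_def)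
    ultimately show ?thesis using t(2)[OF pc] by simp
  qed
  moreover have "t y = y'"
    using t(2)[OF var_closed(1)[OF Fr]] eval_var[OF y] y' s.hom_one s.hom_zero by (simp add: g_def var_def)
  ultimately show ?thesis
    using t(1) simple_extension_as_eval_img[OF Fc y] by auto
qed

text \<open>The coefficient list of X^n - u, highest degree first. For n = 0 the truncated
  subtraction would give X - u, so the facts on degree and values assume 0 < n.\<close>

definition (in ring) power_minus :: "nat \<Rightarrow> 'a \<Rightarrow> 'a list" where
  "power_minus n u = \<one> # replicate (n - 1) \<zero> @ [\<ominus> u]"

lemma (in domain) power_minus_closed:
  assumes "subring K R" "u \<in> K" 
  shows "power_minus n u \<in> carrier (K[X])"
  using assms subringE(2,3,5)[OF assms(1)] one_not_zero
  by (auto simp: power_minus_def univ_poly_carrier[symmetric] polynomial_def)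

lemma (in ring) degree_power_minus: "0 < n \<Longrightarrow> degree (power_minus n u) = n"
  by (simp add: power_minus_def)

lemma (in ring) eval_power_minus:
  assumes "0 < n" "u \<in> carrier R" "x \<in> carrier R"
  shows "eval (power_minus n u) x = x [^] n \<ominus> u"
  using assms eval_replicate[of "[\<ominus> u]" x "n - 1"] 
  by (simp add: power_minus_def minus_eq)

lemma (in field) card_nth_roots_le:
  assumes "0 < n" "u \<in> carrier R" "A \<subseteq> carrier R" "\<And>x. x \<in> A \<Longrightarrow> x [^] (n::nat) = u"
  shows "finite A" "card A \<le> n"
proof -
  have *: "power_minus n u \<in> carrier (poly_ring R)"
    by (rule power_minus_closed[OF carrier_is_subring assms(2)])
  have ne: "power_minus n u \<noteq> []" by (simp add: power_minus_def)
  have "eval (power_minus n u) x = \<zero>" if "x \<in> A" for x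
    using eval_power_minus[OF assms(1,2), of x] assms(2,3) assms(4)[OF that] that by (auto simp: minus_eq r_neg)
  from card_roots_le_degree[OF * ne assms(3) this] 
  show "finite A" "card A \<le> n" unfolding degree_power_minus[OF assms(1)] by simp_all
qed

lemma (in ring) normalize_eq_Nil: "normalize p = [] \<Longrightarrow> set p \<subseteq> {\<zero>}"
  using normalize_trick[of p] by (metis append_Nil2 set_replicate_conv_if empty_subsetI subset_refl)

text \<open>Used to compare the residue field of \<open>K\<close> with its copy inside that of
  \<open>F\<close>: different sets of cosets, but reductions with the same fibres.\<close>

lemma card_image_eqI:
  assumes "\<And>x y. x \<in> A \<Longrightarrow> y \<in> A \<Longrightarrow> f x = f y \<longleftrightarrow> g x = g y"
  shows "card (f ` A) = card (g ` A)"
proof (rule bij_betw_same_card)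
  show "bij_betw (\<lambda>c. g (inv_into A f c)) (f ` A) (g ` A)"
    unfolding bij_betw_def
  proof
    have inv: "inv_into A f (f x) \<in> A \<and> g (inv_into A f (f x)) = g x" if "x \<in> A" for x
      using assms that by (metis f_inv_into_f imageI inv_into_into)
    show "inj_on (\<lambda>c. g (inv_into A f c)) (f ` A)"
      by (rule inj_onI) (use inv assms in auto)
    show "(\<lambda>c. g (inv_into A f c)) ` f ` A = g ` A"
      using inv by (auto simp: image_image)
  qed
qed

lemma (in field) subfield_nat_pow: 
  "([^]\<^bsub>R\<lparr>carrier := F\<rparr>\<^esub>) = (([^]) :: 'a \<Rightarrow> nat \<Rightarrow> 'a)"
  by (auto simp: fun_eq_iff nat_pow_def)

lemma (in field) subfield_inv: 
  assumes "subfield F R" "x \<in> F" "x \<noteq> \<zero>"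
  shows "inv\<^bsub>R\<lparr>carrier := F\<rparr>\<^esub> x = inv x"
proof -
  interpret F: field "R\<lparr>carrier := F\<rparr>" using subfield_iff(2)[OF assms(1)] .
  have "inv x \<in> F" "x \<otimes> inv x = \<one>" using subfield_m_inv[OF assms(1), of x] assms by auto
  then show ?thesis using F.comm_inv_char[of x "inv x"] assms(2) by simp
qed

lemma (in ring) subring_minus: 
  assumes "subring F R" "x \<in> F" "y \<in> F"
  shows "x \<ominus>\<^bsub>R\<lparr>carrier := F\<rparr>\<^esub> y = x \<ominus> y"
proof -
  interpret F: ring "R\<lparr>carrier := F\<rparr>" using subring_is_ring[OF assms(1)] .
  have "\<ominus>\<^bsub>R\<lparr>carrier := F\<rparr>\<^esub> y = \<ominus> y"
    using F.minus_equality[of "\<ominus> y" y] subringE(1,5)[OF assms(1)] assms(3) l_neg by auto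
  then show ?thesis by (simp add: a_minus_def)
qed


section \<open>The unramified extension\<close>

locale unramified_frobenius = algebraically_closed \<Omega> for \<Omega> :: "('a, 'm) ring_scheme" (structure) +
  fixes K F :: "'a set" and v w :: "'a \<Rightarrow> int" and q f :: nat and \<sigma> :: "'a \<Rightarrow> 'a"
  assumes K: "subfield K \<Omega>" and locK: "local_field (\<Omega>\<lparr>carrier := K\<rparr>) v"
    and q: "q = order (residue_field (\<Omega>\<lparr>carrier := K\<rparr>) v)" and f: "0 < f"
    and F: "subfield F \<Omega>" and locF: "local_field (\<Omega>\<lparr>carrier := F\<rparr>) w"
    and unr: "unramified_extension \<Omega> K v F w f"
    and sigma: "\<sigma> \<in> carrier (galois_group (\<Omega>\<lparr>carrier := F\<rparr>) K)"
    and frob: "induces_frobenius (\<Omega>\<lparr>carrier := F\<rparr>) w q \<sigma>"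
begin

sublocale LK: local_field "\<Omega>\<lparr>carrier := K\<rparr>" v by (rule locK)
sublocale LF: local_field "\<Omega>\<lparr>carrier := F\<rparr>" w by (rule locF)

abbreviation \<F> where "\<F> \<equiv> \<Omega>\<lparr>carrier := F\<rparr>"
text \<open>
  Not an abbreviation: the simplifier would collapse the two nested updates of the carrier in
  \<open>residue_field \<F> w\<close> and so change the shape of the term.
\<close>

definition M where "M = residue_field \<F> w"
abbreviation k' where "k' \<equiv> residue_subfield \<Omega> K v F w"
abbreviation O\<^sub>K where "O\<^sub>K \<equiv> val_ge (\<Omega>\<lparr>carrier := K\<rparr>) v 0"
abbreviation O\<^sub>L where "O\<^sub>L \<equiv> val_ge \<F> w 0"
abbreviation res where "res \<equiv> residue \<F> w"
abbreviation T where "T \<equiv> teichmueller \<F> w"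

sublocale M: field M unfolding M_def by (rule LF.field_residue_field)

lemmas residue_closed = LF.residue_closed[folded M_def] 
  and residue_mult = LF.residue_mult[folded M_def]
  and residue_add = LF.residue_add[folded M_def]
  and residue_one = LF.residue_one[folded M_def]
  and residue_zero = LF.residue_zero[folded M_def]
  and residue_pow = LF.residue_pow[folded M_def, unfolded subfield_nat_pow]
  and residue_surj = LF.residue_surj[folded M_def]
  and residue_eq_zero_iff = LF.residue_eq_zero_iff[folded M_def]
  and residue_ring_hom = LF.residue_ring_hom[folded M_def]
  and finite_M = LF.finite_residue_field[folded M_def]
  and teichmueller_closed = LF.teichmueller(1)[folded M_def]
  and residue_teich = LF.teichmueller(2)[folded M_def]
  and teich_carrier = LF.teichmueller_carrier[folded M_def]
  and teich_pow = LF.teichmueller_pow[folded M_def, unfolded subfield_nat_pow]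

lemmas Fr = subfieldE(1)[OF F] and Kr = subfieldE(1)[OF K]

lemma F_carrier: "x \<in> F \<Longrightarrow> x \<in> carrier \<Omega>" using subfieldE(3)[OF F] by blast

lemma KF: "K \<subseteq> F" and dimKF: "dimension f K F" and dim_res: "ring.dimension M f k' (carrier M)"
  using unr unfolding unramified_extension_def M_def by blast+

lemma ramification: "\<exists>r>0. \<forall>x\<in>K - {\<zero>}. w x = r * v x"
  using unr by (auto simp: unramified_extension_def)

text \<open>The factor between the valuations is a positive integer, so it changes neither the sign
  of a value nor whether the value is at least 1. That it equals 1 is not yet known here.\<close>

lemma val_ge_0_iff: "x \<in> K \<Longrightarrow> x \<in> val_ge \<F> w 0 \<longleftrightarrow> x \<in> O\<^sub>K"
  and val_ge_1_iff: "x \<in> K \<Longrightarrow> x \<in> val_ge \<F> w 1 \<longleftrightarrow> x \<in> val_ge (\<Omega>\<lparr>carrier := K\<rparr>) v 1"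
proof -
  obtain r where r: "r > 0" "\<And>x. x \<in> K - {\<zero>} \<Longrightarrow> w x = r * v x" using ramification by blast
  show "x \<in> K \<Longrightarrow> x \<in> val_ge \<F> w 0 \<longleftrightarrow> x \<in> O\<^sub>K"
    using r KF by (auto simp: val_ge_def zero_le_mult_iff)
  show "x \<in> K \<Longrightarrow> x \<in> val_ge \<F> w 1 \<longleftrightarrow> x \<in> val_ge (\<Omega>\<lparr>carrier := K\<rparr>) v 1"
    using r(2)[of x] KF r(1) zero_less_mult_iff[of r "v x"]
    by (cases "x = \<zero>") (auto simp: val_ge_def int_one_le_iff_zero_less)
qed

lemma OK_subset: "O\<^sub>K \<subseteq> O\<^sub>L"
  using val_ge_0_iff LK.val_ge_carrier by auto

lemma residue_K_eq_iff:
  assumes "x \<in> O\<^sub>K" "y \<in> O\<^sub>K"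
  shows "LK.res x = LK.res y \<longleftrightarrow> res x = res y"
proof -
  have xy: "x \<in> K" "y \<in> K" using assms LK.val_ge_carrier by auto
  then have xyF: "x \<in> F" "y \<in> F" using KF by auto
  have "x \<ominus>\<^bsub>\<Omega>\<lparr>carrier := K\<rparr>\<^esub> y = x \<ominus> y" "x \<ominus>\<^bsub>\<F>\<^esub> y = x \<ominus> y"
    using subring_minus[OF Kr xy] subring_minus[OF Fr xyF] by auto
  moreover have "x \<ominus> y \<in> K" using xy subringE(5,7)[OF Kr] by (simp add: minus_eq)
  ultimately show ?thesis
    using LK.residue_eq_iff[OF assms] LF.residue_eq_iff[of x y] assms OK_subset val_ge_1_iff[of "x \<ominus> y"] by auto
qed

lemma k'_eq: "k' = res ` O\<^sub>K" by (simp add: residue_subfield_def)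

lemma card_k': "card k' = q"
proof -
  have "carrier (residue_field (\<Omega>\<lparr>carrier := K\<rparr>) v) = LK.res ` O\<^sub>K"
    using LK.residue_surj LK.residue_closed by auto
  then show ?thesis
    unfolding k'_eq q order_def using card_image_eqI[of O\<^sub>K LK.res res] residue_K_eq_iff by auto
qed

lemma q_gt_1: "1 < q" using LK.Q_gt_1 q by simp

lemma k'_pow: "a \<in> k' \<Longrightarrow> a [^]\<^bsub>M\<^esub> q = a"
proof -
  assume "a \<in> k'"
  then obtain x where x: "x \<in> O\<^sub>K" "a = res x" unfolding k'_eq by auto
  have "LK.res (x [^] q) = LK.res x"
    using LK.residue_pow[OF x(1), of q] LK.residue_field_pow_order(1)[OF LK.residue_closed[OF x(1)]]
    by (simp add: q subfield_nat_pow)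
  then have "res (x [^] q) = res x"
    using residue_K_eq_iff[OF _ x(1)] LK.integer_pow[OF x(1), of q] by (simp add: subfield_nat_pow)
  moreover have "res (x [^] q) = res x [^]\<^bsub>M\<^esub> q"
    using residue_pow[of x q] x(1) OK_subset by auto
  ultimately show ?thesis using x(2) by simp
qed

text \<open>Every element satisfies a^q = a, so a^(q-2) inverts a nonzero one; q is at least 2, and
  the subtraction is a true one.\<close>

lemma subfield_k': "subfield k' M"
proof -
  have sub: "subring O\<^sub>K (valuation_ring \<F> w)"
  proof -
    interpret O: ring "valuation_ring \<F> w" by (rule LF.ring_integers)
    show ?thesis
      by (rule O.ring_incl_imp_subring) (use OK_subset LK.ring_integers in auto)
  qed
  have "subring k' M"
    unfolding k'_eq by (rule ring_hom_ring.img_is_subring[OF residue_ring_hom sub])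
  then show ?thesis
  proof (rule M.subfieldI')
    fix a assume a: "a \<in> k' - {\<zero>\<^bsub>M\<^esub>}"
    then have aM: "a \<in> carrier M" using subringE(1)[OF \<open>subring k' M\<close>] by auto
    have "a [^]\<^bsub>M\<^esub> n \<in> k'" for n :: nat
      using a subringE(3,6)[OF \<open>subring k' M\<close>] by (induction n) auto
    moreover have "Suc (Suc (q - 2)) = q" using q_gt_1 by simp
    then have "a [^]\<^bsub>M\<^esub> Suc (Suc (q - 2)) = a" using k'_pow[of a] a by (simp only:) simp
    then have "a \<otimes>\<^bsub>M\<^esub> a [^]\<^bsub>M\<^esub> (q - 2) = \<one>\<^bsub>M\<^esub>"
      using M.m_rcancel[of a "a [^]\<^bsub>M\<^esub> (q - 2) \<otimes>\<^bsub>M\<^esub> a" "\<one>\<^bsub>M\<^esub>"] a aM by (simp add: M.m_comm)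
    ultimately show "inv\<^bsub>M\<^esub> a \<in> k'" using M.comm_inv_char[of a "a [^]\<^bsub>M\<^esub> (q - 2)"] aM by simp
  qed
qed

lemma order_M: "order M = q ^ f"
  using M.card_of_dimension[OF subfield_k' dim_res] card_k' by (simp add: order_def)

lemma Q_gt_1: "1 < q ^ f" using q_gt_1 f by (rule one_less_power)

lemma pow_M: "a \<in> carrier M \<Longrightarrow> a [^]\<^bsub>M\<^esub> (q ^ f) = a"
  "a \<in> carrier M \<Longrightarrow> a \<noteq> \<zero>\<^bsub>M\<^esub> \<Longrightarrow> a [^]\<^bsub>M\<^esub> (q ^ f - 1) = \<one>\<^bsub>M\<^esub>"
  using LF.residue_field_pow_order[of a] unfolding M_def[symmetric] order_M by simp_all

lemma pow_M_nonzero: "a \<in> carrier M \<Longrightarrow> a \<noteq> \<zero>\<^bsub>M\<^esub> \<Longrightarrow> a [^]\<^bsub>M\<^esub> (n::nat) \<noteq> \<zero>\<^bsub>M\<^esub>"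
  by (induction n) (auto simp: M.integral_iff)

section \<open>The action of \<open>\<sigma>\<close> on \<open>F\<close> and of Frobenius on the
  residue field\<close>

lemma sigma_bij: "bij_betw \<sigma> F F" and sigma_hom: "\<sigma> \<in> ring_hom \<F> \<F>" and sigma_fix: "x \<in> K \<Longrightarrow> \<sigma> x = x"
  and sigma_ext: "\<sigma> \<in> extensional F"
  using sigma by (auto simp: galois_group_def Bij_def)

lemma sigma_integer: "x \<in> O\<^sub>L \<Longrightarrow> \<sigma> x \<in> O\<^sub>L"
  and residue_sigma: "x \<in> O\<^sub>L \<Longrightarrow> res (\<sigma> x) = res x [^]\<^bsub>M\<^esub> q"
  using frob unfolding induces_frobenius_def M_def by auto

lemma sigma_closed: "x \<in> F \<Longrightarrow> \<sigma> x \<in> F" and sigma_mult: "x \<in> F \<Longrightarrow> y \<in> F \<Longrightarrow> \<sigma> (x \<otimes> y) = \<sigma> x \<otimes> \<sigma> y"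
  and sigma_add: "x \<in> F \<Longrightarrow> y \<in> F \<Longrightarrow> \<sigma> (x \<oplus> y) = \<sigma> x \<oplus> \<sigma> y" and sigma_one: "\<sigma> \<one> = \<one>"
  using ring_hom_memE[OF sigma_hom] by auto

lemma sigma_zero: "\<sigma> \<zero> = \<zero>" by (rule sigma_fix) (rule subringE(2)[OF Kr])

lemma F_pow: "x \<in> F \<Longrightarrow> x [^] (n::nat) \<in> F"
  using LF.nat_pow_closed[of x n] by (simp add: subfield_nat_pow)

lemma sigma_pow: "x \<in> F \<Longrightarrow> \<sigma> (x [^] (n::nat)) = \<sigma> x [^] n"
  by (induction n) (auto simp: sigma_one sigma_mult F_pow)

lemma sigma_nonzero: "x \<in> F \<Longrightarrow> x \<noteq> \<zero> \<Longrightarrow> \<sigma> x \<noteq> \<zero>"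
  using sigma_bij sigma_zero subringE(2)[OF Fr] by (auto simp: bij_betw_def inj_on_def)

abbreviation \<phi> where "\<phi> a \<equiv> a [^]\<^bsub>M\<^esub> q"

text \<open>Additivity of the q-th power is read off from \<open>\<sigma>\<close>, whose reduction
  it is, rather than from the binomial theorem in characteristic p.\<close>

lemma frobenius_hom: "\<phi> \<in> ring_hom M M"
proof (rule ring_hom_memI)
  fix a b assume "a \<in> carrier M" "b \<in> carrier M"
  then obtain x y where xy: "x \<in> O\<^sub>L" "y \<in> O\<^sub>L" "a = res x" "b = res y" 
    using residue_surj by metis
  then have xyF: "x \<in> F" "y \<in> F" using LF.val_ge_carrier by auto
  have "x \<oplus> y \<in> O\<^sub>L" "x \<otimes> y \<in> O\<^sub>L" using LF.val_ge_add[of x 0 y] LF.integer_mult[of x y] xy by auto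
  then have "res (\<sigma> (x \<oplus> y)) = \<phi> (res (x \<oplus> y))" "res (\<sigma> (x \<otimes> y)) = \<phi> (res (x \<otimes> y))"
    using residue_sigma by auto
  then show "\<phi> (a \<oplus>\<^bsub>M\<^esub> b) = \<phi> a \<oplus>\<^bsub>M\<^esub> \<phi> b" "\<phi> (a \<otimes>\<^bsub>M\<^esub> b) = \<phi> a \<otimes>\<^bsub>M\<^esub> \<phi> b"
    using xy xyF sigma_add sigma_mult sigma_integer residue_sigma residue_add[of x y] 
      residue_mult[of x y] residue_add[of "\<sigma> x" "\<sigma> y"] residue_mult[of "\<sigma> x" "\<sigma> y"] by auto
qed auto

lemma funpow_frobenius: "a \<in> carrier M \<Longrightarrow> (\<phi> ^^ i) a = a [^]\<^bsub>M\<^esub> (q ^ i)"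
  by (induction i) (auto simp: M.nat_pow_pow mult.commute)

text \<open>A generator of the cyclic group of units works: if its q^i-th and q^j-th powers agreed
  for i < j < f, every unit would be a root of X^d - 1 with d = q^j - q^i, which is less than the
  number q^f - 1 of units.\<close>

lemma primitive_element:
  "\<exists>\<zeta> \<in> carrier M. \<zeta> \<noteq> \<zero>\<^bsub>M\<^esub> \<and> inj_on (\<lambda>i. \<zeta> [^]\<^bsub>M\<^esub> (q ^ i)) {..<f}"
proof -
  obtain \<zeta> where z: "\<zeta> \<in> carrier (mult_of M)" "carrier (mult_of M) = {\<zeta> [^]\<^bsub>M\<^esub> i | i::nat. i \<in> UNIV}"
    using M.finite_field_mult_group_has_gen[OF finite_M] by blast
  have zM: "\<zeta> \<in> carrier M" "\<zeta> \<noteq> \<zero>\<^bsub>M\<^esub>" using z(1) by auto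
  have lt: "\<zeta> [^]\<^bsub>M\<^esub> (q ^ i) \<noteq> \<zeta> [^]\<^bsub>M\<^esub> (q ^ j)" if ij: "i < j" "j < f" for i j
  proof
    assume eq: "\<zeta> [^]\<^bsub>M\<^esub> (q ^ i) = \<zeta> [^]\<^bsub>M\<^esub> (q ^ j)"
    define d where "d = q ^ j - q ^ i"
    have lt1: "q ^ i < q ^ j" using ij q_gt_1 by simp
    then have d0: "0 < d" by (simp add: d_def)
    have jd: "q ^ j = q ^ i + d" using lt1 by (simp add: d_def)
    have nz: "\<zeta> [^]\<^bsub>M\<^esub> (q ^ i) \<noteq> \<zero>\<^bsub>M\<^esub>" using zM pow_M_nonzero by blast
    have "\<zeta> [^]\<^bsub>M\<^esub> (q ^ i) \<otimes>\<^bsub>M\<^esub> \<zeta> [^]\<^bsub>M\<^esub> d = \<zeta> [^]\<^bsub>M\<^esub> (q ^ j)"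
      using zM by (simp add: jd M.nat_pow_mult)
    also have "\<dots> = \<zeta> [^]\<^bsub>M\<^esub> (q ^ i) \<otimes>\<^bsub>M\<^esub> \<one>\<^bsub>M\<^esub>"
      using eq zM by simp
    finally have one: "\<zeta> [^]\<^bsub>M\<^esub> d = \<one>\<^bsub>M\<^esub>"
      using M.m_lcancel[OF nz, of "\<zeta> [^]\<^bsub>M\<^esub> d" "\<one>\<^bsub>M\<^esub>"] zM by simp
    have "x [^]\<^bsub>M\<^esub> d = \<one>\<^bsub>M\<^esub>" if x: "x \<in> carrier (mult_of M)" for x
    proof -
      obtain n :: nat where "x = \<zeta> [^]\<^bsub>M\<^esub> n" using x unfolding z(2) by blast
      then have "x [^]\<^bsub>M\<^esub> d = (\<zeta> [^]\<^bsub>M\<^esub> d) [^]\<^bsub>M\<^esub> n" using zM by (simp add: M.nat_pow_pow mult.commute)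
      then show ?thesis by (simp add: one)
    qed
    then have "card (carrier (mult_of M)) \<le> d"
      by (intro M.card_nth_roots_le(2)[OF d0 M.one_closed]) auto
    moreover have "card (carrier (mult_of M)) = q ^ f - 1"
      using finite_M order_M by (simp add: order_def)
    moreover have "d < q ^ f - 1"
    proof -
      have "q ^ j < q ^ f" using ij q_gt_1 by simp
      moreover have "q ^ i \<ge> 1" using q_gt_1 by simp
      ultimately show ?thesis using lt1 unfolding d_def by linarith
    qed
    ultimately show False by simp
  qed
  have "inj_on (\<lambda>i. \<zeta> [^]\<^bsub>M\<^esub> (q ^ i)) {..<f}"
    by (rule inj_onI) (use lt in \<open>metis lessThan_iff linorder_neqE_nat\<close>)
  with zM show ?thesis by blast
qed

text \<open>Chosen once and for all, so that it can be a parameter of the locale instances that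
  follow.\<close>

definition \<zeta> where "\<zeta> = (SOME z. z \<in> carrier M \<and> z \<noteq> \<zero>\<^bsub>M\<^esub> \<and> inj_on (\<lambda>i. z [^]\<^bsub>M\<^esub> (q ^ i)) {..<f})"

lemma zeta: "\<zeta> \<in> carrier M" "\<zeta> \<noteq> \<zero>\<^bsub>M\<^esub>" "inj_on (\<lambda>i. \<zeta> [^]\<^bsub>M\<^esub> (q ^ i)) {..<f}"
proof -
  from primitive_element have "\<exists>z. z \<in> carrier M \<and> z \<noteq> \<zero>\<^bsub>M\<^esub> \<and> inj_on (\<lambda>i. z [^]\<^bsub>M\<^esub> (q ^ i)) {..<f}"
    by (simp only: Bex_def)
  from someI_ex[OF this, folded \<zeta>_def]
  show "\<zeta> \<in> carrier M" "\<zeta> \<noteq> \<zero>\<^bsub>M\<^esub>" "inj_on (\<lambda>i. \<zeta> [^]\<^bsub>M\<^esub> (q ^ i)) {..<f}"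
    by auto
qed

text \<open>The residue extension: the conjugates of \<open>\<zeta>\<close> under Frobenius are its
  powers with exponents q^i.\<close>

sublocale CM: cyclic_generation M k' "carrier M" \<phi> \<zeta> f
proof (intro cyclic_generation.intro cyclic_generation_axioms.intro)
  show "field M" by (rule M.field_axioms)
  show "subfield k' M" by (rule subfield_k')
  show "subfield (carrier M) M" by (rule M.carrier_is_subfield)
  show "k' \<subseteq> carrier M" using subfieldE(3)[OF subfield_k'] .
  show "ring.dimension M f k' (carrier M)" by (rule dim_res)
  show "\<phi> \<in> ring_hom (M\<lparr>carrier := carrier M\<rparr>) (M\<lparr>carrier := carrier M\<rparr>)" using frobenius_hom by simp
  show "inj_on (\<lambda>i. (\<phi> ^^ i) \<zeta>) {..<f}"
    using zeta by (simp add: funpow_frobenius)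
  show "\<phi> x = x" if "x \<in> k'" for x by (rule k'_pow[OF that])
  show "\<zeta> \<in> carrier M" by (rule zeta(1))
qed

lemma teich_F: "a \<in> carrier M \<Longrightarrow> T a \<in> F"
  using teich_carrier by simp

lemma teich_pow_order: "a \<in> carrier M \<Longrightarrow> a \<noteq> \<zero>\<^bsub>M\<^esub> \<Longrightarrow> T a [^] (q ^ f - 1) = \<one>"
  using LF.teichmueller_nonzero(3)[of a] unfolding M_def[symmetric] order_M subfield_nat_pow by simp

lemma teich_residue:
  assumes "x \<in> F" "x [^] (q ^ f - 1) = \<one>"
  shows "x \<in> O\<^sub>L" "T (res x) = x"
  using LF.teichmueller_residue[of x] LF.root_of_unity_integer(3)[of x "q ^ f - 1"] assms Q_gt_1
  unfolding M_def[symmetric] order_M subfield_nat_pow by simp_all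

text \<open>An automorphism preserves roots of unity, so the image of T(a) is the representative of
  its own residue, which is a^q.\<close>

lemma sigma_teich:
  assumes "a \<in> carrier M" "a \<noteq> \<zero>\<^bsub>M\<^esub>"
  shows "\<sigma> (T a) = T a [^] q"
proof -
  have "\<sigma> (T a) [^] (q ^ f - 1) = \<one>"
    using sigma_pow[OF teich_F[OF assms(1)], of "q ^ f - 1"] teich_pow_order[OF assms] sigma_one by simp
  then have "T (res (\<sigma> (T a))) = \<sigma> (T a)" 
    using teich_residue(2)[of "\<sigma> (T a)"] sigma_closed teich_F[OF assms(1)] by blast
  then show ?thesis
    using residue_sigma[of "T a"] teichmueller_closed[OF assms(1)] residue_teich[OF assms(1)] teich_pow[OF assms(1), of q] by simp
qed

lemma funpow_sigma_teich:
  assumes "a \<in> carrier M" "a \<noteq> \<zero>\<^bsub>M\<^esub>"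
  shows "(\<sigma> ^^ i) (T a) = T (a [^]\<^bsub>M\<^esub> (q ^ i))"
proof (induction i)
  case 0
  then show ?case using assms by simp
next
  case (Suc i)
  have "a [^]\<^bsub>M\<^esub> (q ^ i) \<in> carrier M" "a [^]\<^bsub>M\<^esub> (q ^ i) \<noteq> \<zero>\<^bsub>M\<^esub>" using assms pow_M_nonzero by auto
  then have "\<sigma> (T (a [^]\<^bsub>M\<^esub> (q ^ i))) = T ((a [^]\<^bsub>M\<^esub> (q ^ i)) [^]\<^bsub>M\<^esub> q)"
    using sigma_teich teich_pow by metis
  then show ?case using Suc assms(1) by (simp add: M.nat_pow_pow mult.commute)
qed

text \<open>The conjugates of \<open>T \<zeta>\<close> are distinct because their residues are. The
  locale then gives F = K(T \<zeta>) and shows that the automorphisms of \<open>F\<close> over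
  \<open>K\<close> are powers of \<open>\<sigma>\<close>.\<close>

lemma CF: "cyclic_generation \<Omega> K F \<sigma> (T \<zeta>) f"
proof (intro cyclic_generation.intro cyclic_generation_axioms.intro)
  show "field \<Omega>" by (rule field_axioms)
  show "inj_on (\<lambda>i. (\<sigma> ^^ i) (T \<zeta>)) {..<f}"
  proof (rule inj_onI)
    fix i j assume ij: "i \<in> {..<f}" "j \<in> {..<f}" "(\<sigma> ^^ i) (T \<zeta>) = (\<sigma> ^^ j) (T \<zeta>)"
    then have "res (T (\<zeta> [^]\<^bsub>M\<^esub> (q ^ i))) = res (T (\<zeta> [^]\<^bsub>M\<^esub> (q ^ j)))"
      using funpow_sigma_teich[OF zeta(1,2)] by simp
    then have "\<zeta> [^]\<^bsub>M\<^esub> (q ^ i) = \<zeta> [^]\<^bsub>M\<^esub> (q ^ j)"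
      using residue_teich zeta(1) by simp
    then show "i = j" using zeta(3) ij(1,2) by (auto simp: inj_on_def)
  qed
  show "subfield K \<Omega>" by (rule K)
  show "subfield F \<Omega>" by (rule F)
  show "K \<subseteq> F" by (rule KF)
  show "dimension f K F" by (rule dimKF)
  show "\<sigma> \<in> ring_hom \<F> \<F>" by (rule sigma_hom)
  show "\<sigma> x = x" if "x \<in> K" for x by (rule sigma_fix[OF that])
  show "T \<zeta> \<in> F" by (rule teich_F[OF zeta(1)])
qed

lemmas F_hom_carrier_mono = cyclic_generation.hom_carrier_mono[OF CF]
  and funpow_sigma_hom = cyclic_generation.funpow_hom[OF CF]
  and funpow_sigma_fix = cyclic_generation.funpow_fix[OF CF]
  and simple_extension_F = cyclic_generation.simple_extension_eq[OF CF]
  and element_of_F_as_eval = cyclic_generation.element_as_eval[OF CF]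
  and F_hom_is_funpow = cyclic_generation.hom_is_funpow[OF CF]

text \<open>It suffices to look at the generator \<open>T \<zeta>\<close>, and \<zeta>^(q^f) =
  \<zeta>.\<close>

lemma funpow_sigma_order: "x \<in> F \<Longrightarrow> (\<sigma> ^^ f) x = x"
proof -
  assume x: "x \<in> F"
  have "(\<sigma> ^^ f) (T \<zeta>) = T \<zeta>" using funpow_sigma_teich[OF zeta(1,2)] pow_M(1)[OF zeta(1)] by simp
  then show ?thesis
    using homs_agree_simple_extension[OF F_hom_carrier_mono[OF funpow_sigma_hom[of f]] 
        F_hom_carrier_mono[OF funpow_sigma_hom[of 0]] Fr KF teich_F[OF zeta(1)], of x]
      simple_extension_F x funpow_sigma_fix by simp
qed

end


section \<open>Galois groups and norms\<close>

lemma galois_group_iff: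
  "\<tau> \<in> carrier (galois_group R K) \<longleftrightarrow>
     \<tau> \<in> extensional (carrier R) \<and> bij_betw \<tau> (carrier R) (carrier R) \<and> \<tau> \<in> ring_hom R R \<and> (\<forall>x\<in>K. \<tau> x = x)"
  by (auto simp: galois_group_def Bij_def)

lemma galois_group_mult:
  "\<lbrakk>\<tau> \<in> carrier (galois_group R K); \<tau>' \<in> carrier (galois_group R K); x \<in> carrier R\<rbrakk>
     \<Longrightarrow> (\<tau> \<otimes>\<^bsub>galois_group R K\<^esub> \<tau>') x = \<tau> (\<tau>' x)"
  by (auto simp: galois_group_def BijGroup_def compose_def)

lemma galois_group_one: "\<one>\<^bsub>galois_group R K\<^esub> = (\<lambda>x\<in>carrier R. x)"
  by (simp add: galois_group_def BijGroup_def)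

lemma subgroup_galois_group:
  fixes R (structure)
  assumes "ring R" "K \<subseteq> carrier R"
  shows "subgroup (carrier (galois_group R K)) (BijGroup (carrier R))"
proof -
  interpret ring R by fact
  have Bij: "carrier (BijGroup (carrier R)) = Bij (carrier R)" by (simp add: BijGroup_def)
  show ?thesis
  proof (rule group.subgroupI[OF group_BijGroup])
    show "carrier (galois_group R K) \<subseteq> carrier (BijGroup (carrier R))"
      by (auto simp: galois_group_def Bij)
    have "(\<lambda>x\<in>carrier R. x) \<in> carrier (galois_group R K)"
      using assms(2) id_Bij[of "carrier R"] by (auto simp: galois_group_def intro!: ring_hom_memI)
    then show "carrier (galois_group R K) \<noteq> {}" by blast
  next
    fix \<tau> assume "\<tau> \<in> carrier (galois_group R K)"
    then have \<tau>: "\<tau> \<in> Bij (carrier R)" "\<tau> \<in> ring_hom R R" "\<And>x. x \<in> K \<Longrightarrow> \<tau> x = x"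
      by (auto simp: galois_group_def)
    let ?i = "\<lambda>x\<in>carrier R. inv_into (carrier R) \<tau> x"
    have inj: "inj_on \<tau> (carrier R)" using \<tau>(1) by (auto simp: Bij_def bij_betw_def)
    have inv: "inv_into (carrier R) \<tau> (\<tau> x) = x" if "x \<in> carrier R" for x
      using inv_into_f_f[OF inj that] .
    have "?i \<in> ring_hom R R"
    proof (rule ring_hom_memI)
      show "?i \<one> = \<one>" using inv[of \<one>] ring_hom_one[OF \<tau>(2)] by simp
      fix x y assume xy: "x \<in> carrier R" "y \<in> carrier R"
      then show "?i x \<in> carrier R" using Bij_inv_into_mem[OF \<tau>(1)] by simp
      have "inv_into (carrier R) \<tau> (x \<otimes> y) = inv_into (carrier R) \<tau> x \<otimes> inv_into (carrier R) \<tau> y"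
        by (rule Bij_inv_into_lemma[where g = "(\<otimes>)", OF _ \<tau>(1)]) (use xy ring_hom_mult[OF \<tau>(2)] in auto)
      then show "?i (x \<otimes> y) = ?i x \<otimes> ?i y" using xy by simp
      have "inv_into (carrier R) \<tau> (x \<oplus> y) = inv_into (carrier R) \<tau> x \<oplus> inv_into (carrier R) \<tau> y"
        by (rule Bij_inv_into_lemma[where g = "(\<oplus>)", OF _ \<tau>(1)]) (use xy ring_hom_add[OF \<tau>(2)] in auto)
      then show "?i (x \<oplus> y) = ?i x \<oplus> ?i y" using xy by simp
    qed
    moreover have "?i x = x" if "x \<in> K" for x
      using inv[of x] \<tau>(3)[OF that] assms(2) that by auto
    ultimately show "inv\<^bsub>BijGroup (carrier R)\<^esub> \<tau> \<in> carrier (galois_group R K)"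
      using inv_BijGroup[OF \<tau>(1)] restrict_inv_into_Bij[OF \<tau>(1)] by (simp add: galois_group_def)
  next
    fix \<tau> \<tau>' assume "\<tau> \<in> carrier (galois_group R K)" "\<tau>' \<in> carrier (galois_group R K)"
    then have t: "\<tau> \<in> Bij (carrier R)" "\<tau> \<in> ring_hom R R" "\<tau>' \<in> Bij (carrier R)" "\<tau>' \<in> ring_hom R R"
        "\<And>x. x \<in> K \<Longrightarrow> \<tau> x = x" "\<And>x. x \<in> K \<Longrightarrow> \<tau>' x = x"
      by (auto simp: galois_group_def)
    have "compose (carrier R) \<tau> \<tau>' \<in> ring_hom R R"
      using ring_hom_memE[OF t(2)] ring_hom_memE[OF t(4)]
      by (intro ring_hom_memI) (auto simp: compose_def)
    moreover have "compose (carrier R) \<tau> \<tau>' x = x" if "x \<in> K" for x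
      using t that assms(2) by (auto simp: compose_def)
    ultimately show "\<tau> \<otimes>\<^bsub>BijGroup (carrier R)\<^esub> \<tau>' \<in> carrier (galois_group R K)"
      using t compose_Bij[OF t(1,3)] by (simp add: galois_group_def BijGroup_def)
  qed
qed

lemma group_galois_group:
  assumes "ring R" "K \<subseteq> carrier R"
  shows "group (galois_group R K)"
  using subgroup.subgroup_is_group[OF subgroup_galois_group[OF assms] group_BijGroup]
  by (simp add: galois_group_def)

lemma galois_group_pow:
  assumes "ring R" "K \<subseteq> carrier R" "\<tau> \<in> carrier (galois_group R K)" "x \<in> carrier R"
  shows "(\<tau> [^]\<^bsub>galois_group R K\<^esub> (n::nat)) x = (\<tau> ^^ n) x"
proof -
  interpret G: group "galois_group R K" by (rule group_galois_group[OF assms(1,2)])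
  show ?thesis
    using assms(4)
  proof (induction n arbitrary: x)
    case 0
    then show ?case by (simp add: galois_group_one)
  next
    case (Suc n)
    have "\<tau> x \<in> carrier R" using assms(3) Suc(2) by (auto simp: galois_group_iff bij_betw_def)
    then show ?case
      using Suc galois_group_mult[OF G.nat_pow_closed[OF assms(3)] assms(3), of x n] by (simp add: funpow_swap1)
  qed
qed

lemma (in ring) eval_scalar:
  assumes "a \<in> carrier R" "set p \<subseteq> carrier R" "x \<in> carrier R"
  shows "eval (map (\<lambda>b. a \<otimes> b) p) x = a \<otimes> eval p x"
  using assms(2) by (induction p) (use assms(1,3) in \<open>auto simp: r_distr m_assoc eval_in_carrier\<close>)

context unramified_frobenius
begin

text \<open>Powers of Frobenius are injective on a finite field, hence bijective. The restriction is
  there because elements of \<open>BijGroup\<close> are extensional.\<close>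

lemma galois_group_residue: 
  "carrier (galois_group M k') = (\<lambda>i. restrict (\<phi> ^^ i) (carrier M)) ` {..<f}"
proof
  show "carrier (galois_group M k') \<subseteq> (\<lambda>i. restrict (\<phi> ^^ i) (carrier M)) ` {..<f}"
  proof
    fix \<tau> assume t: "\<tau> \<in> carrier (galois_group M k')"
    then obtain i where i: "i < f" "\<And>x. x \<in> carrier M \<Longrightarrow> \<tau> x = (\<phi> ^^ i) x"
      using CM.hom_is_funpow[of \<tau>] by (auto simp: galois_group_iff)
    have "\<tau> = restrict (\<phi> ^^ i) (carrier M)"
      by (rule extensionalityI[of _ "carrier M"]) (use t i in \<open>auto simp: galois_group_iff\<close>)
    with i(1) show "\<tau> \<in> (\<lambda>i. restrict (\<phi> ^^ i) (carrier M)) ` {..<f}" by blast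
  qed
next
  show "(\<lambda>i. restrict (\<phi> ^^ i) (carrier M)) ` {..<f} \<subseteq> carrier (galois_group M k')"
  proof safe
    fix i
    have h: "\<phi> ^^ i \<in> ring_hom M M" using CM.funpow_hom[of i] by simp
    note hm = ring_hom_memE[OF h]
    have "inj_on (\<phi> ^^ i) (carrier M)"
      using non_trivial_field_hom_is_inj[OF h M.field_axioms M.field_axioms] by blast
    moreover have "(\<phi> ^^ i) ` carrier M \<subseteq> carrier M" using hm(1) by auto
    ultimately have "bij_betw (\<phi> ^^ i) (carrier M) (carrier M)"
      using endo_inj_surj[OF finite_M] by (auto simp: bij_betw_def)
    then have "bij_betw (restrict (\<phi> ^^ i) (carrier M)) (carrier M) (carrier M)"
      by (simp add: bij_betw_restrict_eq)
    moreover have "restrict (\<phi> ^^ i) (carrier M) \<in> ring_hom M M"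
      by (rule ring_hom_memI) (use hm in auto)
    moreover have "restrict (\<phi> ^^ i) (carrier M) x = x" if "x \<in> k'" for x
      using CM.funpow_fix[OF that] that CM.KE by auto
    ultimately show "restrict (\<phi> ^^ i) (carrier M) \<in> carrier (galois_group M k')"
      by (simp add: galois_group_iff)
  qed
qed

lemma finprod_powers: "a \<in> carrier M \<Longrightarrow> finprod M (\<lambda>i. a [^]\<^bsub>M\<^esub> (h i)) {..<n::nat} = a [^]\<^bsub>M\<^esub> (\<Sum>i<n. h i :: nat)"
proof (induction n)
  case (Suc n)
  have "finprod M (\<lambda>i. a [^]\<^bsub>M\<^esub> (h i)) (insert n {..<n}) = a [^]\<^bsub>M\<^esub> (h n) \<otimes>\<^bsub>M\<^esub> finprod M (\<lambda>i. a [^]\<^bsub>M\<^esub> (h i)) {..<n}"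
    by (rule M.finprod_insert) (use Suc in auto)
  with Suc show ?case by (simp add: lessThan_Suc M.nat_pow_mult add.commute)
qed simp

abbreviation S where "S \<equiv> \<Sum>i<f. q ^ i"

text \<open>The Galois group is listed without repetition by i < f, since the conjugates of
  \<open>\<zeta>\<close> are distinct; the norm becomes the product of the a^(q^i).\<close>

lemma galois_norm_residue:
  assumes "a \<in> carrier M"
  shows "galois_norm M k' a = a [^]\<^bsub>M\<^esub> S"
proof -
  let ?h = "\<lambda>i. restrict (\<phi> ^^ i) (carrier M)"
  have inj: "inj_on ?h {..<f}"
  proof (rule inj_onI)
    fix i j assume ij: "i \<in> {..<f}" "j \<in> {..<f}" "?h i = ?h j"
    from fun_cong[OF ij(3), of \<zeta>] have "(\<phi> ^^ i) \<zeta> = (\<phi> ^^ j) \<zeta>" using zeta(1) by simp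
    then show "i = j" using CM.distinct ij(1,2) by (auto simp: inj_on_def)
  qed
  have "galois_norm M k' a = finprod M (\<lambda>i. (?h i) a) {..<f}"
    unfolding galois_norm_def galois_group_residue
    by (rule M.finprod_reindex[OF _ inj]) (use assms ring_hom_memE(1)[OF CM.funpow_hom] in auto)
  also have "\<dots> = finprod M (\<lambda>i. a [^]\<^bsub>M\<^esub> (q ^ i)) {..<f}"
    by (rule M.finprod_cong') (use assms funpow_frobenius in auto)
  finally show ?thesis using finprod_powers[OF assms] by simp
qed

lemma S_mult: "S * (q - 1) = q ^ f - 1"
proof -
  have "int q ^ f - 1 = (int q - 1) * (\<Sum>i<f. int q ^ i)" 
    by (rule power_diff_1_eq)
  then have "int (S * (q - 1)) = int (q ^ f - 1)"
    using q_gt_1 Q_gt_1 by (simp add: of_nat_diff mult.commute)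
  then show ?thesis by (simp only: of_nat_eq_iff)
qed

lemma subring_OL: "subring O\<^sub>L \<Omega>"
  by (rule ring_incl_imp_subring) (use LF.ring_integers LF.val_ge_carrier F_carrier in auto)

text \<open>
  Every \<open>x\<close> in \<open>F\<close> is a polynomial in \<open>T \<zeta>\<close> of degree less than \<open>f\<close> over \<open>K\<close>. After division by a
  coefficient of least valuation, its reduction is a nonzero polynomial in \<open>\<zeta>\<close>, hence nonzero: the
  valuation of \<open>x\<close> is that of a coefficient, and the ramification index is 1.
\<close>

lemma val_K:
  assumes "x \<in> K" "x \<noteq> \<zero>"
  shows "w x = v x"
proof -
  obtain r where r: "r > 0" "\<And>x. x \<in> K \<Longrightarrow> x \<noteq> \<zero> \<Longrightarrow> w x = r * v x" using ramification by blast
  \<comment> \<open>This \<open>x\<close> shadows the one of the statement. It has valuation 1, and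
    showing that its valuation is r times an integer forces r = 1.\<close>
  obtain x where "x \<in> carrier (mult_of \<F>)" "w x = 1" using LF.val_surj by (metis UNIV_I imageE)
  then have x: "x \<in> F" "x \<noteq> \<zero>" "w x = 1" by auto
  obtain p where p: "p \<in> carrier (K[X])" "length p \<le> f" "x = eval p (T \<zeta>)"
    by (rule element_of_F_as_eval[OF x(1)])
  note zF = teich_F[OF zeta(1)] and zc = F_carrier[OF teich_F[OF zeta(1)]]
  have pn: "p \<noteq> []" using p(3) x(2) by auto
  have pK: "set p \<subseteq> K" using p(1) by (simp add: polynomial_incl univ_poly_carrier)
  have pc: "set p \<subseteq> carrier \<Omega>" using pK subfieldE(3)[OF K] by auto
  have lc: "lead_coeff p \<in> set p - {\<zero>}" 
    using p(1) pn by (auto simp: univ_poly_carrier[symmetric] polynomial_def)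
  have "Min (v ` (set p - {\<zero>})) \<in> v ` (set p - {\<zero>})" by (rule Min_in) (use lc in auto)
  then obtain c where "Min (v ` (set p - {\<zero>})) = v c" "c \<in> set p - {\<zero>}" by (rule imageE)
  then have c: "c \<in> set p" "c \<noteq> \<zero>" "v c = Min (v ` (set p - {\<zero>}))" by auto
  have cmin: "v c \<le> v a" if "a \<in> set p" "a \<noteq> \<zero>" for a using that c(3) by simp
  have cK: "c \<in> K" using c pK by auto
  have icK: "inv c \<in> K" "inv c \<noteq> \<zero>" "inv c \<otimes> c = \<one>" 
    using subfield_m_inv[OF K, of c] c cK by auto
  have vic: "v (inv c) = - v c"
    using LK.val_inv[of c] cK c(2) by (simp add: subfield_inv[OF K])
  define p' where "p' = map (\<lambda>b. inv c \<otimes> b) p"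
  have p'O: "set p' \<subseteq> O\<^sub>K"
  proof -
    have "inv c \<otimes> a \<in> O\<^sub>K" if "a \<in> set p" for a
    proof (cases "a = \<zero>")
      case True
      then show ?thesis using icK(1) subfieldE(3)[OF K] subringE(2)[OF Kr] by (auto simp: LK.mem_val_ge)
    next
      case False
      then have "v (inv c \<otimes> a) = v (inv c) + v a"
        using LK.val_mult[of "inv c" a] icK pK that by auto
      then show ?thesis using cmin[OF that False] vic subringE(6)[OF Kr icK(1), of a] pK that
        by (auto simp: LK.mem_val_ge)
    qed
    then show ?thesis by (auto simp: p'_def)
  qed
  have ev: "eval p' (T \<zeta>) = inv c \<otimes> x"
    unfolding p'_def p(3) using eval_scalar[OF _ pc zc, of "inv c"] icK(1) subfieldE(3)[OF K] by auto
  have evO: "eval p' (T \<zeta>) \<in> O\<^sub>L"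
    using ring.eval_in_carrier[OF subring_is_ring[OF subring_OL], of p' "T \<zeta>"] p'O OK_subset teichmueller_closed[OF zeta(1)]
    by (auto simp: eval_consistent[OF subring_OL])
  have res_ev: "res (eval p' (T \<zeta>)) = M.eval (map res p') \<zeta>"
    using ring_hom_ring.eval_hom'[OF residue_ring_hom, of "T \<zeta>" p'] p'O OK_subset teichmueller_closed[OF zeta(1)]
      residue_teich[OF zeta(1)] by (auto simp: eval_consistent[OF subring_OL])
  have rk: "set (map res p') \<subseteq> k'" using p'O by (auto simp: k'_eq)
  define P where "P = M.normalize (map res p')"
  have P: "P \<in> carrier (k'[X]\<^bsub>M\<^esub>)"
    unfolding P_def using M.normalize_gives_polynomial[OF rk] by (simp add: univ_poly_carrier)
  have evP: "M.eval P \<zeta> = res (eval p' (T \<zeta>))"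
    unfolding P_def res_ev using M.eval_normalize[of "map res p'" \<zeta>] rk CM.KE zeta(1) by auto
  have "P \<noteq> []"
  proof
    assume "P = []"
    then have "set (map res p') \<subseteq> {\<zero>\<^bsub>M\<^esub>}" using M.normalize_eq_Nil unfolding P_def by blast
    \<comment> \<open>The coefficient \<open>c\<close> itself has become 1, which keeps the
      reduction from vanishing.\<close>
    moreover have "\<one>\<^bsub>M\<^esub> \<in> set (map res p')"
      using c(1) icK(3) residue_one by (force simp: p'_def)
    ultimately show False by auto
  qed
  moreover have "length P \<le> f" using M.normalize_length_le[of "map res p'"] p(2) by (simp add: P_def p'_def)
  ultimately have "\<not> f \<le> degree P" using f by (cases P) auto
  then have "M.eval P \<zeta> \<noteq> \<zero>\<^bsub>M\<^esub>" using CM.degree_ge[OF P \<open>P \<noteq> []\<close>] by blast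
  then have "eval p' (T \<zeta>) \<notin> val_ge \<F> w 1" using evP residue_eq_zero_iff[OF evO] by simp
  then have "w (inv c \<otimes> x) = 0" using LF.integer_unit(2)[OF evO] ev by simp
  moreover have "w (inv c \<otimes> x) = w (inv c) + w x"
    using LF.val_mult[of "inv c" x] icK x KF by auto
  ultimately have "r * v (inv c) = - 1" using r(2)[OF icK(1,2)] x(3) by simp
  then have "1 = r * (- v (inv c))" by simp
  then have "r dvd 1" by (rule dvdI)
  then have "r = 1" using r(1) by (simp add: zdvd1_eq)
  then show ?thesis using r(2) assms by simp
qed

text \<open>The Frobenius condition only says that \<open>\<sigma>\<close> preserves integrality. An
  element \<open>c\<close> of \<open>K\<close> with the valuation of \<open>x\<close>, available
  because the ramification index is 1, turns x/c and c/x into units; integrality of their images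
  bounds w(\<sigma>(x)) from below and from above.\<close>

lemma val_sigma:
  assumes "x \<in> F" "x \<noteq> \<zero>"
  shows "w (\<sigma> x) = w x"
proof -
  have unit: "w (\<sigma> y) \<ge> 0" if y: "y \<in> F" "y \<noteq> \<zero>" "w y = 0" for y
    using sigma_integer[of y] y sigma_nonzero[of y] by (simp add: LF.mem_val_ge)
  obtain c where "c \<in> carrier (mult_of (\<Omega>\<lparr>carrier := K\<rparr>))" "v c = w x"
    using LK.val_surj by (metis UNIV_I imageE)
  then have c: "c \<in> K" "c \<noteq> \<zero>" "w c = w x" using val_K by auto
  have cF: "c \<in> F" using c KF by auto
  have ic: "inv c \<in> K" "inv c \<noteq> \<zero>" "c \<otimes> inv c = \<one>" using subfield_m_inv[OF K, of c] c by auto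
  have icF: "inv c \<in> F" using ic KF by auto
  have ix: "inv x \<in> F" "inv x \<noteq> \<zero>" "x \<otimes> inv x = \<one>" using subfield_m_inv[OF F, of x] assms by auto
  have vi: "w (inv c) = - w x" "w (inv x) = - w x"
    using LF.val_inv[of c] LF.val_inv[of x] c cF assms by (simp_all add: subfield_inv[OF F])
  have wm: "w (a \<otimes> b) = w a + w b" "a \<otimes> b \<noteq> \<zero>" if "a \<in> F" "b \<in> F" "a \<noteq> \<zero>" "b \<noteq> \<zero>" for a b
    using LF.val_mult[of a b] that F_carrier integral[of a b] by auto
  have "0 \<le> w (\<sigma> (x \<otimes> inv c))"
    by (rule unit) (use subringE(6)[OF Fr] assms icF wm[of x "inv c"] ic vi in auto)
  moreover have "0 \<le> w (\<sigma> (inv x \<otimes> c))"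
    by (rule unit) (use subringE(6)[OF Fr] ix cF wm[of "inv x" c] c vi in auto)
  moreover have "w (\<sigma> (x \<otimes> inv c)) = w (\<sigma> x) + w (inv c)"
    using sigma_mult[OF assms(1) icF] sigma_fix[OF ic(1)] wm[of "\<sigma> x" "inv c"] sigma_closed[OF assms(1)] icF
      sigma_nonzero[OF assms] ic by simp
  moreover have "w (\<sigma> (inv x \<otimes> c)) = w (\<sigma> (inv x)) + w c"
    using sigma_mult[OF ix(1) cF] sigma_fix[OF c(1)] wm[of "\<sigma> (inv x)" c] sigma_closed[OF ix(1)] cF
      sigma_nonzero[OF ix(1,2)] c by simp
  moreover have "w (\<sigma> x) + w (\<sigma> (inv x)) = 0"
    using sigma_mult[OF assms(1) ix(1)] wm(1)[of "\<sigma> x" "\<sigma> (inv x)"] sigma_closed[OF ix(1)] sigma_closed[OF assms(1)]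
      sigma_nonzero[OF ix(1,2)] sigma_nonzero[OF assms] ix(3) sigma_one LF.val_one by simp
  ultimately show ?thesis using vi c(3) by linarith
qed

text \<open>The Teichmueller representatives of the q^f - 1 units already exhaust the roots of
  X^(q^f - 1) - 1.\<close>

lemma roots_of_unity_in_F:
  assumes "x \<in> carrier \<Omega>" "x [^] (q ^ f - 1) = \<one>"
  shows "x \<in> F"
proof -
  let ?A = "T ` (carrier M - {\<zero>\<^bsub>M\<^esub>})"
  have inj: "inj_on T (carrier M - {\<zero>\<^bsub>M\<^esub>})"
    by (rule inj_onI) (metis DiffD1 residue_teich)
  have "card ?A = q ^ f - 1"
    using card_image[OF inj] order_M finite_M by (simp add: order_def)
  have "x \<in> ?A"
  proof (rule ccontr)
    assume "x \<notin> ?A"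
    then have "card (insert x ?A) = Suc (q ^ f - 1)"
      using \<open>card ?A = q ^ f - 1\<close> finite_M by simp
    moreover have "card (insert x ?A) \<le> q ^ f - 1"
    proof (rule card_nth_roots_le(2)[OF _ one_closed])
      show "0 < q ^ f - 1" using Q_gt_1 by simp
      show "insert x ?A \<subseteq> carrier \<Omega>" using assms(1) F_carrier teich_F by auto
    qed (use assms teich_pow_order in auto)
    ultimately show False by simp
  qed
  then show ?thesis using teich_F by auto
qed

lemma galois_group_F:
  assumes "\<tau> \<in> carrier (galois_group \<F> K)"
  shows "\<exists>i<f. \<forall>x\<in>F. \<tau> x = (\<sigma> ^^ i) x"
  using assms by (intro F_hom_is_funpow) (auto simp: galois_group_iff)

text \<open>Both follow from S(q-1) = q^f - 1. The second is the easy half of Hilbert 90: the norm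
  kills a^(q-1), the quotient of the Frobenius image of a by a.\<close>

lemma S_power_unit: 
  assumes "a \<in> carrier M" "a \<noteq> \<zero>\<^bsub>M\<^esub>"
  shows "(a [^]\<^bsub>M\<^esub> S) [^]\<^bsub>M\<^esub> (q - 1) = \<one>\<^bsub>M\<^esub>" "(a [^]\<^bsub>M\<^esub> (q - 1)) [^]\<^bsub>M\<^esub> S = \<one>\<^bsub>M\<^esub>"
proof -
  show *: "(a [^]\<^bsub>M\<^esub> S) [^]\<^bsub>M\<^esub> (q - 1) = \<one>\<^bsub>M\<^esub>"
    unfolding M.nat_pow_pow[OF assms(1)] S_mult by (rule pow_M(2)[OF assms])
  show "(a [^]\<^bsub>M\<^esub> (q - 1)) [^]\<^bsub>M\<^esub> S = \<one>\<^bsub>M\<^esub>"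
    using * M.nat_pow_pow[OF assms(1)] by (simp only: mult.commute)
qed

end


section \<open>Stable ramified lines\<close>

lemma (in field) comm_group_mult_of: "comm_group (mult_of R)"
  using units_comm_group by (simp add: mult_of_is_Units)

lemma (in field) mult_of_nat_pow: "([^]\<^bsub>mult_of R\<^esub>) = (([^]) :: 'a \<Rightarrow> nat \<Rightarrow> 'a)"
  by (simp add: fun_eq_iff nat_pow_def)

lemma (in field) nat_pow_nonzero: "\<lbrakk>x \<in> carrier R; x \<noteq> \<zero>\<rbrakk> \<Longrightarrow> x [^] (n::nat) \<noteq> \<zero>"
  by (induction n) (auto simp: integral_iff)

lemma (in field) normal_powers: "powers (mult_of R) e \<lhd> mult_of R"
proof -
  interpret G: comm_group "mult_of R" by (rule comm_group_mult_of)
  have "subgroup (powers (mult_of R) e) (mult_of R)"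
  proof (rule G.subgroupI)
    show "powers (mult_of R) e \<subseteq> carrier (mult_of R)" "powers (mult_of R) e \<noteq> {}"
      unfolding powers_def using G.nat_pow_closed by blast+
    fix a assume "a \<in> powers (mult_of R) e"
    then obtain c where c: "c \<in> carrier (mult_of R)" "a = c [^]\<^bsub>mult_of R\<^esub> e" unfolding powers_def by blast
    then have "inv\<^bsub>mult_of R\<^esub> a = (inv\<^bsub>mult_of R\<^esub> c) [^]\<^bsub>mult_of R\<^esub> e" using G.nat_pow_inv by simp
    then show "inv\<^bsub>mult_of R\<^esub> a \<in> powers (mult_of R) e"
      unfolding powers_def using G.inv_closed[OF c(1)] by blast
  next
    fix a b assume "a \<in> powers (mult_of R) e" "b \<in> powers (mult_of R) e"
    then obtain c d where "c \<in> carrier (mult_of R)" "d \<in> carrier (mult_of R)"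
      "a = c [^]\<^bsub>mult_of R\<^esub> e" "b = d [^]\<^bsub>mult_of R\<^esub> e" unfolding powers_def by blast
    then have "a \<otimes>\<^bsub>mult_of R\<^esub> b = (c \<otimes>\<^bsub>mult_of R\<^esub> d) [^]\<^bsub>mult_of R\<^esub> e" "c \<otimes>\<^bsub>mult_of R\<^esub> d \<in> carrier (mult_of R)"
      using G.nat_pow_distrib[of c d e] G.m_closed[of c d] by simp_all
    then show "a \<otimes>\<^bsub>mult_of R\<^esub> b \<in> powers (mult_of R) e" unfolding powers_def by blast
  qed
  then show ?thesis by (rule G.subgroup_imp_normal)
qed

lemma (in field) power_class_hom: "power_class R e \<in> hom (mult_of R) (power_classes R e)"
  using normal.r_coset_hom_Mod[OF normal_powers] unfolding power_class_def power_classes_def by simp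

lemma (in field) group_power_classes: "group (power_classes R e)"
  using normal.factorgroup_is_group[OF normal_powers] unfolding power_classes_def .

lemma (in field) carrier_power_classes: "carrier (power_classes R e) = power_class R e ` (carrier R - {\<zero>})"
  by (auto simp: power_classes_def FactGroup_def RCOSETS_def power_class_def)

lemma (in field) mem_power_class:
  "y \<in> power_class R e x \<longleftrightarrow> (\<exists>c \<in> carrier R - {\<zero>}. y = c [^] e \<otimes> x)"
  by (auto simp: power_class_def r_coset_def powers_def mult_of_nat_pow)

lemma (in field) power_class_eq_iff:
  assumes "x \<in> carrier R - {\<zero>}" "y \<in> carrier R - {\<zero>}"
  shows "power_class R e x = power_class R e y \<longleftrightarrow> (\<exists>c \<in> carrier R - {\<zero>}. y = c [^] e \<otimes> x)"
proof -
  interpret G: comm_group "mult_of R" by (rule comm_group_mult_of)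
  have sub: "subgroup (powers (mult_of R) e) (mult_of R)"
    using normal_powers normal_imp_subgroup by blast
  have "y \<in> power_class R e y"
    unfolding power_class_def by (rule G.rcos_self[OF _ sub]) (use assms in auto)
  moreover have "y \<in> power_class R e x \<Longrightarrow> power_class R e x = power_class R e y"
    unfolding power_class_def by (rule G.repr_independence[OF _ _ sub]) (use assms in auto)
  ultimately show ?thesis using mem_power_class by blast
qed

locale stable_ramified_line = unramified_frobenius +
  fixes e :: nat and D :: "'a set set"
  assumes e: "0 < e" and q_cong: "[q ^ f = 1] (mod e)"
    and line: "ramified_line \<F> w e D" and stable: "stable_line (galois_group \<F> K) D"
begin

abbreviation cls where "cls \<equiv> power_class \<F> e"
abbreviation \<nu> where "\<nu> \<equiv> induced_valuation w e"

lemma e_dvd: "e dvd q ^ f - 1"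
  using q_cong by (rule cong_to_1_nat)

lemma F_nonzero_mult: "\<lbrakk>x \<in> F; x \<noteq> \<zero>; y \<in> F; y \<noteq> \<zero>\<rbrakk> \<Longrightarrow> x \<otimes> y \<in> F \<and> x \<otimes> y \<noteq> \<zero> \<and> w (x \<otimes> y) = w x + w y"
  using LF.val_mult[of x y] F_carrier integral[of x y] subringE(6)[OF Fr] by auto

lemma F_nonzero_pow: "\<lbrakk>x \<in> F; x \<noteq> \<zero>\<rbrakk> \<Longrightarrow> x [^] (n::nat) \<in> F \<and> x [^] n \<noteq> \<zero> \<and> w (x [^] n) = int n * w x"
  using LF.val_pow[of x n] F_pow[of x n] by (simp add: subfield_nat_pow)

lemma F_nonzero_inv: "\<lbrakk>x \<in> F; x \<noteq> \<zero>\<rbrakk> \<Longrightarrow> inv x \<in> F \<and> inv x \<noteq> \<zero> \<and> w (inv x) = - w x \<and> x \<otimes> inv x = \<one> \<and> inv x \<otimes> x = \<one>"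
  using LF.val_inv[of x] subfield_m_inv[OF F, of x] by (simp add: subfield_inv[OF F])

lemma mem_cls: "y \<in> cls x \<longleftrightarrow> (\<exists>c\<in>F. c \<noteq> \<zero> \<and> y = c [^] e \<otimes> x)"
  using LF.mem_power_class[of y e x] by (auto simp: subfield_nat_pow)

lemma cls_eq_iff: "\<lbrakk>x \<in> F; x \<noteq> \<zero>; y \<in> F; y \<noteq> \<zero>\<rbrakk> \<Longrightarrow> cls x = cls y \<longleftrightarrow> (\<exists>c\<in>F. c \<noteq> \<zero> \<and> y = c [^] e \<otimes> x)"
  using LF.power_class_eq_iff[of x y e] by (auto simp: subfield_nat_pow)

text \<open>An e-th power changes the valuation by a multiple of e, so the set in
  \<open>induced_valuation\<close> is a singleton and \<open>the_elem\<close> is meaningful.\<close>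

lemma nu_cls:
  assumes "x \<in> F" "x \<noteq> \<zero>"
  shows "\<nu> (cls x) = w x mod int e"
proof -
  have "w y mod int e = w x mod int e" if y: "y \<in> cls x" for y
  proof -
    obtain c where c: "c \<in> F" "c \<noteq> \<zero>" "y = c [^] e \<otimes> x" using y mem_cls by blast
    then have "w y = int e * w c + w x"
      using F_nonzero_mult[of "c [^] e" x] F_nonzero_pow[of c e] assms by auto
    then show ?thesis by simp
  qed
  moreover have "x \<in> cls x"
    using mem_cls[of x x] subringE(3)[OF Fr] F_carrier assms by (auto intro!: bexI[of _ \<one>])
  ultimately have "(\<lambda>x. w x mod int e) ` cls x = {w x mod int e}" by blast
  then show ?thesis by (simp add: induced_valuation_def)
qed

lemma subgroup_D: "subgroup D (power_classes \<F> e)"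
  and nu_bij: "bij_betw \<nu> D {0..<int e}"
  using line e by (auto simp: ramified_line_def iso_def carrier_integer_mod_group)

lemma D_cls:
  assumes "d \<in> D"
  obtains x where "x \<in> F" "x \<noteq> \<zero>" "d = cls x"
  using subgroup.subset[OF subgroup_D] assms LF.carrier_power_classes[of e] by auto

lemma cls_eqI:
  assumes "x \<in> F" "x \<noteq> \<zero>" "cls x \<in> D" "y \<in> F" "y \<noteq> \<zero>" "cls y \<in> D" "w x mod int e = w y mod int e"
  shows "cls x = cls y"
  using nu_bij assms nu_cls by (auto simp: bij_betw_def inj_on_def)

lemma cls_pow_mem:
  assumes "x \<in> F" "x \<noteq> \<zero>" "cls x \<in> D"
  shows "cls x [^]\<^bsub>power_classes \<F> e\<^esub> (n::nat) = cls (x [^] n)" "cls (x [^] n) \<in> D"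
proof -
  interpret h: group_hom "mult_of \<F>" "power_classes \<F> e" cls
    using LF.power_class_hom LF.group_power_classes LF.field_mult_group
    by (auto intro!: group_hom.intro simp: group_hom_axioms_def)
  interpret D: subgroup D "power_classes \<F> e" by (rule subgroup_D)
  show *: "cls x [^]\<^bsub>power_classes \<F> e\<^esub> n = cls (x [^] n)"
    using h.hom_nat_pow[of x n] assms by (simp add: LF.mult_of_nat_pow subfield_nat_pow)
  have "cls x [^]\<^bsub>power_classes \<F> e\<^esub> n \<in> D"
    by (induction n) (use assms in auto)
  then show "cls (x [^] n) \<in> D" using * by simp
qed

text \<open>With w x = 1, each class of \<open>D\<close> has the same valuation modulo e as some
  power of \<open>x\<close>, and on \<open>D\<close> that valuation is injective.\<close>

lemma line_generator_iff:
  assumes "x \<in> F" "x \<noteq> \<zero>" "w x = 1"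
  shows "line_generator \<F> e D x \<longleftrightarrow> cls x \<in> D"
proof
  assume "line_generator \<F> e D x"
  then show "cls x \<in> D" unfolding line_generator_def using generate.incl[of "cls x" "{cls x}"] by blast
next
  assume x: "cls x \<in> D"
  interpret P: group "power_classes \<F> e" by (rule LF.group_power_classes)
  have "D \<subseteq> generate (power_classes \<F> e) {cls x}"
  proof
    fix d assume d: "d \<in> D"
    then obtain t where t: "t \<in> F" "t \<noteq> \<zero>" "d = cls t" by (rule D_cls)
    define n where "n = nat (w t mod int e)"
    have n: "int n = w t mod int e" using e by (simp add: n_def)
    have "cls t = cls (x [^] n)"
      by (rule cls_eqI) (use t d assms x cls_pow_mem[of x n] F_nonzero_pow[of x n] n in auto)
    moreover have "cls x [^]\<^bsub>power_classes \<F> e\<^esub> n \<in> generate (power_classes \<F> e) {cls x}"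
    proof (induction n)
      case 0
      then show ?case by (simp add: generate.one)
    next
      case (Suc n)
      then show ?case by (simp add: generate.eng generate.incl)
    qed
    ultimately show "d \<in> generate (power_classes \<F> e) {cls x}"
      using t(3) cls_pow_mem(1)[OF assms(1,2) x, of n] by simp
  qed
  moreover have "generate (power_classes \<F> e) {cls x} \<subseteq> D"
    using P.generate_subgroup_incl[OF _ subgroup_D] x by simp
  ultimately show "line_generator \<F> e D x"
    using assms by (auto simp: line_generator_def)
qed

lemma uniformiser_K: "uniformiser (\<Omega>\<lparr>carrier := K\<rparr>) v \<pi> \<Longrightarrow> \<pi> \<in> K \<and> \<pi> \<in> F \<and> \<pi> \<noteq> \<zero> \<and> w \<pi> = 1"
  using val_K KF by (auto simp: uniformiser_def)

lemma teich_uniformiser: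
  assumes "uniformiser (\<Omega>\<lparr>carrier := K\<rparr>) v \<pi>" "\<xi> \<in> carrier M" "\<xi> \<noteq> \<zero>\<^bsub>M\<^esub>"
  shows "T \<xi> \<in> F" "T \<xi> \<noteq> \<zero>" "T \<xi> \<otimes> \<pi> \<in> F" "T \<xi> \<otimes> \<pi> \<noteq> \<zero>" "w (T \<xi> \<otimes> \<pi>) = 1"
proof -
  have t: "T \<xi> \<in> F" "T \<xi> \<noteq> \<zero>" "w (T \<xi>) = 0"
    using teich_F[OF assms(2)] LF.teichmueller_nonzero(1,2)[of \<xi>] assms(2,3) unfolding M_def[symmetric] by auto
  then show "T \<xi> \<in> F" "T \<xi> \<noteq> \<zero>" by auto
  show "T \<xi> \<otimes> \<pi> \<in> F" "T \<xi> \<otimes> \<pi> \<noteq> \<zero>" "w (T \<xi> \<otimes> \<pi>) = 1"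
    using t uniformiser_K[OF assms(1)] F_nonzero_mult[of "T \<xi>" \<pi>] by auto
qed

text \<open>The unit u/\<pi> may be replaced by the Teichmueller representative of its residue: the
  quotient of the two has residue 1 and is an e-th power by \<open>one_unit_root\<close>.\<close>

lemma F_uniformiser_decomposition:
  assumes "u \<in> F" "u \<noteq> \<zero>" "w u = 1" "uniformiser (\<Omega>\<lparr>carrier := K\<rparr>) v \<pi>"
  shows "\<exists>\<xi> \<in> carrier M - {\<zero>\<^bsub>M\<^esub>}. cls (T \<xi> \<otimes> \<pi>) = cls u"
proof -
  note \<pi> = uniformiser_K[OF assms(4)]
  have i\<pi>: "inv \<pi> \<in> F" "inv \<pi> \<noteq> \<zero>" "w (inv \<pi>) = -1" "inv \<pi> \<otimes> \<pi> = \<one>" using F_nonzero_inv[of \<pi>] \<pi> by auto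
  define \<epsilon> where "\<epsilon> = u \<otimes> inv \<pi>"
  have \<epsilon>: "\<epsilon> \<in> F" "\<epsilon> \<noteq> \<zero>" "w \<epsilon> = 0" using F_nonzero_mult[of u "inv \<pi>"] assms i\<pi> by (auto simp: \<epsilon>_def)
  have \<epsilon>\<pi>: "\<epsilon> \<otimes> \<pi> = u" using assms(1) \<pi> i\<pi> F_carrier by (simp add: \<epsilon>_def m_assoc)
  have \<epsilon>O: "\<epsilon> \<in> O\<^sub>L" using \<epsilon> by (simp add: LF.mem_val_ge)
  have i\<epsilon>: "inv \<epsilon> \<in> F" "inv \<epsilon> \<noteq> \<zero>" "inv \<epsilon> \<in> O\<^sub>L" "\<epsilon> \<otimes> inv \<epsilon> = \<one>" "inv \<epsilon> \<otimes> \<epsilon> = \<one>"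
    using F_nonzero_inv[of \<epsilon>] \<epsilon> by (auto simp: LF.mem_val_ge)
  define \<xi> where "\<xi> = res \<epsilon>"
  have \<xi>: "\<xi> \<in> carrier M" "\<xi> \<noteq> \<zero>\<^bsub>M\<^esub>"
    using residue_closed[OF \<epsilon>O] residue_eq_zero_iff[OF \<epsilon>O] \<epsilon> by (auto simp: \<xi>_def LF.mem_val_ge)
  note T\<xi> = teich_uniformiser[OF assms(4) \<xi>] teichmueller_closed[OF \<xi>(1)] residue_teich[OF \<xi>(1)]
  define u1 where "u1 = T \<xi> \<otimes> inv \<epsilon>"
  have u1: "u1 \<in> O\<^sub>L" using LF.integer_mult[of "T \<xi>" "inv \<epsilon>"] T\<xi> i\<epsilon> by (simp add: u1_def)
  have "res \<epsilon> \<otimes>\<^bsub>M\<^esub> res (inv \<epsilon>) = \<one>\<^bsub>M\<^esub>"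
    using residue_mult[OF \<epsilon>O i\<epsilon>(3)] i\<epsilon>(4) residue_one by simp
  moreover have "res u1 = res (T \<xi>) \<otimes>\<^bsub>M\<^esub> res (inv \<epsilon>)"
    using residue_mult[OF teichmueller_closed[OF \<xi>(1)] i\<epsilon>(3)] by (simp add: u1_def)
  ultimately have "res u1 = \<one>\<^bsub>M\<^esub>" unfolding residue_teich[OF \<xi>(1)] by (simp add: \<xi>_def)
  then obtain c where c: "c \<in> F" "c [^] e = u1"
    using LF.one_unit_root[OF u1, of e] e_dvd unfolding M_def[symmetric] order_M subfield_nat_pow by auto
  have "u1 \<noteq> \<zero>" using F_nonzero_mult[of "T \<xi>" "inv \<epsilon>"] T\<xi> i\<epsilon> by (simp add: u1_def)
  then have c0: "c \<noteq> \<zero>" using c nat_pow_zero[of e] e by auto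
  have "c [^] e \<otimes> u = T \<xi> \<otimes> (inv \<epsilon> \<otimes> (\<epsilon> \<otimes> \<pi>))"
    unfolding c(2) u1_def \<epsilon>\<pi> using T\<xi>(1) i\<epsilon>(1) assms(1) F_carrier by (simp add: m_assoc)
  also have "inv \<epsilon> \<otimes> (\<epsilon> \<otimes> \<pi>) = \<pi>"
    using i\<epsilon> \<epsilon> \<pi> F_carrier by (simp add: m_assoc[symmetric])
  finally have "cls u = cls (T \<xi> \<otimes> \<pi>)"
    using cls_eq_iff[of u "T \<xi> \<otimes> \<pi>"] assms T\<xi> c(1) c0 by auto
  with \<xi> show ?thesis by auto
qed

lemma exists_generator:
  "\<exists>\<pi> \<xi>. uniformiser (\<Omega>\<lparr>carrier := K\<rparr>) v \<pi> \<and> \<xi> \<in> carrier M - {\<zero>\<^bsub>M\<^esub>} \<and> cls (T \<xi> \<otimes> \<pi>) \<in> D"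
proof -
  \<comment> \<open>For e = 1 this value is 0, hence \<open>1 mod int e\<close> instead of 1.
    Multiplication by an e-th power then adjusts the valuation of a representative to exactly
    1.\<close>
  obtain d where d: "d \<in> D" "\<nu> d = 1 mod int e"
    using nu_bij e by (auto simp: bij_betw_def image_iff set_eq_iff) (metis Euclidean_Rings.pos_mod_bound Euclidean_Rings.pos_mod_sign of_nat_0_less_iff)
  obtain t where t: "t \<in> F" "t \<noteq> \<zero>" "d = cls t" using D_cls[OF d(1)] by blast
  have "w t mod int e = 1 mod int e" using d t nu_cls by simp
  then obtain k where k: "1 = w t + int e * k" by (metis mod_eq_dvd_iff dvdE diff_add_cancel add.commute mult.commute)
  obtain c where "c \<in> carrier (mult_of \<F>)" "w c = k" using LF.val_surj by (metis UNIV_I imageE)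
  then have c: "c \<in> F" "c \<noteq> \<zero>" "w c = k" by auto
  define u where "u = c [^] e \<otimes> t"
  have u: "u \<in> F" "u \<noteq> \<zero>" "w u = 1"
    using F_nonzero_mult[of "c [^] e" t] F_nonzero_pow[of c e] c t k by (auto simp: u_def)
  have "cls t = cls u" using cls_eq_iff[of t u] t u c by (auto simp: u_def)
  then have uD: "cls u \<in> D" using d t by simp
  obtain \<pi> where "\<pi> \<in> carrier (mult_of (\<Omega>\<lparr>carrier := K\<rparr>))" "v \<pi> = 1" using LK.val_surj by (metis UNIV_I imageE)
  then have \<pi>: "uniformiser (\<Omega>\<lparr>carrier := K\<rparr>) v \<pi>" by (auto simp: uniformiser_def)
  from F_uniformiser_decomposition[OF u \<pi>] uD \<pi> show ?thesis by metis
qed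

text \<open>Stability is about images of cosets as sets, so \<open>\<sigma>\<close> must carry the
  coset of \<open>x\<close> onto that of \<sigma>(x), not just into it; this uses surjectivity of
  \<open>\<sigma>\<close> on \<open>F\<close>.\<close>

lemma sigma_stable:
  assumes "x \<in> F" "x \<noteq> \<zero>" "cls x \<in> D"
  shows "cls (\<sigma> x) \<in> D"
proof -
  have "\<sigma> ` cls x = cls (\<sigma> x)"
  proof
    show "\<sigma> ` cls x \<subseteq> cls (\<sigma> x)"
    proof
      fix y assume "y \<in> \<sigma> ` cls x"
      then obtain c where c: "c \<in> F" "c \<noteq> \<zero>" "y = \<sigma> (c [^] e \<otimes> x)" by (auto simp: mem_cls)
      then have "y = \<sigma> c [^] e \<otimes> \<sigma> x" using assms by (simp add: sigma_mult sigma_pow F_pow)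
      then show "y \<in> cls (\<sigma> x)" using c sigma_closed[of c] sigma_nonzero[of c] mem_cls by blast
    qed
  next
    show "cls (\<sigma> x) \<subseteq> \<sigma> ` cls x"
    proof
      fix y assume "y \<in> cls (\<sigma> x)"
      then obtain c where c: "c \<in> F" "c \<noteq> \<zero>" "y = c [^] e \<otimes> \<sigma> x" by (auto simp: mem_cls)
      have "c \<in> \<sigma> ` F" using c(1) bij_betw_imp_surj_on[OF sigma_bij] by simp
      then obtain b where b: "\<sigma> b = c" "b \<in> F" by auto
      then have "b \<noteq> \<zero>" using c(2) sigma_zero by auto
      then have "b [^] e \<otimes> x \<in> cls x" unfolding mem_cls by (intro bexI[OF _ b(2)]) simp
      moreover have "y = \<sigma> (b [^] e \<otimes> x)" using b c assms by (simp add: sigma_mult sigma_pow F_pow)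
      ultimately show "y \<in> \<sigma> ` cls x" by (rule image_eqI[rotated])
    qed
  qed
  moreover have "\<sigma> ` cls x \<in> D"
    using stable sigma assms(3) unfolding stable_line_def by blast
  ultimately show ?thesis by simp
qed

text \<open>As \<open>\<sigma>\<close> preserves valuations, \<open>x\<close> and \<sigma>(x) have
  the same class in \<open>D\<close>. The \<open>b\<close> obtained here is what lets
  \<open>\<sigma>\<close> be lifted to \<open>L\<close>.\<close>

lemma sigma_generator:
  assumes "x \<in> F" "x \<noteq> \<zero>" "cls x \<in> D"
  shows "\<exists>b\<in>F. b \<noteq> \<zero> \<and> \<sigma> x = b [^] e \<otimes> x"
proof -
  have s: "\<sigma> x \<in> F" "\<sigma> x \<noteq> \<zero>" using assms sigma_closed sigma_nonzero by auto
  have "cls x = cls (\<sigma> x)"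
    by (rule cls_eqI) (use assms s sigma_stable val_sigma in auto)
  then show ?thesis using cls_eq_iff[of x "\<sigma> x"] assms s by simp
qed

lemma root_of_unity_e:
  assumes "x \<in> carrier \<Omega>" "x [^] e = \<one>"
  shows "x \<in> F" "x \<in> O\<^sub>L" "T (res x) = x" "x [^] (q ^ f - 1) = \<one>"
proof -
  obtain m where m: "q ^ f - 1 = e * m" using e_dvd by blast
  show *: "x [^] (q ^ f - 1) = \<one>"
    unfolding m nat_pow_pow[OF assms(1), symmetric] assms(2) by simp
  then show "x \<in> F" using roots_of_unity_in_F assms(1) by blast
  then show "x \<in> O\<^sub>L" "T (res x) = x" using teich_residue * by auto
qed

text \<open>The quotient is an e-th root of unity, and those lie in \<open>F\<close> because e
  divides q^f - 1.\<close>

lemma same_power: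
  assumes "x \<in> carrier \<Omega>" "y \<in> carrier \<Omega>" "y \<noteq> \<zero>" "x [^] e = y [^] e"
  shows "\<exists>\<omega>\<in>F. \<omega> [^] e = \<one> \<and> x = \<omega> \<otimes> y"
proof -
  note iy = nonzero_inv[OF assms(2,3)]
  let ?\<omega> = "x \<otimes> inv y"
  have "?\<omega> [^] e = y [^] e \<otimes> inv y [^] e" using assms iy by (simp add: nat_pow_distrib)
  also have "\<dots> = (y \<otimes> inv y) [^] e" by (rule nat_pow_distrib[OF assms(2) iy(1), symmetric])
  also have "\<dots> = \<one>" using iy(3) by (simp only: nat_pow_one)
  finally have \<omega>: "?\<omega> [^] e = \<one>" .
  moreover have "?\<omega> \<in> F" using root_of_unity_e(1)[OF _ \<omega>] assms iy by simp
  moreover have "x = ?\<omega> \<otimes> y" using assms iy by (simp add: m_assoc)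
  ultimately show ?thesis by blast
qed

end


section \<open>The Kummer extension and its Galois group\<close>

text \<open>One choice of \<pi>, \<xi> and y is fixed for the computations; \<open>L\<close>, its
  Galois group and the two classes are defined without it.\<close>

locale kummer_generator = stable_ramified_line +
  fixes \<pi> :: 'a and \<xi> :: "'a set" and y :: 'a
  assumes pi: "uniformiser (\<Omega>\<lparr>carrier := K\<rparr>) v \<pi>" and xi: "\<xi> \<in> carrier M" "\<xi> \<noteq> \<zero>\<^bsub>M\<^esub>"
    and generator: "cls (T \<xi> \<otimes> \<pi>) \<in> D"
    and y: "y \<in> carrier \<Omega>" and y_pow: "y [^] e = T \<xi> \<otimes> \<pi>"
begin

definition u where "u = T \<xi> \<otimes> \<pi>"
abbreviation L where "L \<equiv> adjoin_roots \<Omega> F e D"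
abbreviation \<L> where "\<L> \<equiv> \<Omega>\<lparr>carrier := L\<rparr>"

lemma u: "u \<in> F" "u \<noteq> \<zero>" "w u = 1" "cls u \<in> D" "u \<in> carrier \<Omega>" "y [^] e = u"
  using teich_uniformiser(3-5)[OF pi xi] generator y_pow F_carrier by (auto simp: u_def)

lemma y_nonzero: "y \<noteq> \<zero>"
  using u nat_pow_zero[of e] e by auto

lemma minus_one_pow: "(\<ominus> \<one>) [^] e \<in> F" "(\<ominus> \<one>) [^] e \<noteq> \<zero>" "w ((\<ominus> \<one>) [^] e) = 0"
proof -
  have m: "\<ominus> \<one> \<in> F" using subringE(3,5)[OF Fr] by simp
  have 2: "\<ominus> \<one> [^] (2::nat) = \<one>" by (simp add: numeral_2_eq_2 l_minus r_minus)
  have "\<ominus> \<one> \<noteq> \<zero>" "w (\<ominus> \<one>) = 0"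
    using LF.root_of_unity_integer[of "\<ominus> \<one>" 2] m 2 by (simp_all add: subfield_nat_pow)
  then show "(\<ominus> \<one>) [^] e \<in> F" "(\<ominus> \<one>) [^] e \<noteq> \<zero>" "w ((\<ominus> \<one>) [^] e) = 0"
    using F_nonzero_pow[OF m, of e] by auto
qed

lemma power_minus_u: "power_minus e u \<in> carrier (F[X])" "power_minus e u \<noteq> []" "eval (power_minus e u) y = \<zero>"
  using power_minus_closed[OF Fr u(1)] eval_power_minus[OF e u(5) y] u(5,6)
  by (auto simp: power_minus_def minus_eq r_neg)

lemma algebraic_y: "(algebraic over F) y"
  using algebraicI[OF power_minus_u] .

text \<open>The roots of the minimal polynomial of \<open>y\<close> are \<open>e\<close>-th roots of \<open>u\<close>, so that up to sign its
  constant coefficient is a product of \<open>d\<close> such roots, where \<open>d\<close> is its degree; comparing valuations,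
  \<open>e\<close> divides \<open>d\<close>.\<close>

lemma degree_ge_e:
  assumes "p \<in> carrier (F[X])" "p \<noteq> []" "eval p y = \<zero>"
  shows "e \<le> degree p"
proof -
  define g where "g = Irr F y"
  note g = IrrE[OF F y algebraic_y, folded g_def]
  have gn: "g \<noteq> []" using g(2) pirreducibleE(1)[OF Fr g(1)] by blast
  have gR: "g \<in> carrier (poly_ring \<Omega>)" using carrier_polynomial_shell[OF Fr g(1)] .
  have deg: "degree g \<le> degree p"
    using pdivides_imp_degree_le[OF Fr g(1) assms(1,2)] Irr_minimal[OF F y algebraic_y assms(1,3), folded g_def] by blast
  have d1: "degree g \<ge> 1" using pirreducible_degree[OF F g(1,2)] .
  \<comment> \<open>The value of (-r)^e for every root r; the sign is a unit, so the valuation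
    remains that of \<open>u\<close>.\<close>
  let ?c = "(\<ominus> \<one>) [^] e \<otimes> u"
  have cF: "?c \<in> F" "?c \<noteq> \<zero>" "w ?c = 1"
    using F_nonzero_mult[OF minus_one_pow(1,2) u(1,2)] minus_one_pow(3) u(3) by auto
  have roots: "(\<ominus> r) [^] e = ?c" if r: "r \<in> carrier \<Omega>" "eval g r = \<zero>" for r
  proof -
    have "g pdivides power_minus e u"
      using Irr_minimal[OF F y algebraic_y power_minus_u(1,3)] by (simp add: g_def)
    then have "eval (power_minus e u) r = \<zero>"
      using pdivides_imp_root_sharing[OF gR] r by blast
    then have "r [^] e = u"
      using eval_power_minus[OF e u(5) r(1)] u(5) r(1) by simp
    moreover have "\<ominus> r = \<ominus> \<one> \<otimes> r" using r(1) by (simp add: l_minus)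
    ultimately show ?thesis using r(1) by (simp add: nat_pow_distrib)
  qed
  have "eval g \<zero> [^] e = lead_coeff g [^] e \<otimes> ?c [^] degree g"
    by (rule const_coeff_of_power_roots[OF gR gn _ roots]) (use F_carrier[OF cF(1)] in auto)
  then have eq: "eval g \<zero> [^] e = ?c [^] degree g"
    using F_carrier[OF cF(1)] by (simp add: g(3))
  have gF: "set g \<subseteq> F" using g(1) by (simp add: polynomial_incl univ_poly_carrier)
  have evF: "eval g \<zero> \<in> F"
    using LF.eval_in_carrier[of g \<zero>] gF subringE(2)[OF Fr] by (simp add: eval_consistent[OF Fr])
  have "?c [^] degree g \<noteq> \<zero>" "w (?c [^] degree g) = int (degree g)"
    using F_nonzero_pow[OF cF(1,2), of "degree g"] cF(3) by auto
  moreover from this have "eval g \<zero> \<noteq> \<zero>" using eq nat_pow_zero[of e] e by auto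
  ultimately have "int e * w (eval g \<zero>) = int (degree g)"
    using eq F_nonzero_pow[OF evF, of e] by simp
  then have "int e dvd int (degree g)" by (metis dvd_triv_left)
  then have "e dvd degree g" by (simp only: int_dvd_int_iff)
  then have "e \<le> degree g" by (rule dvd_imp_le) (use d1 in simp)
  then show ?thesis using deg by simp
qed

text \<open>If t^e lies in a class of \<open>D\<close>, that class is the class of some u^n, so t^e
  = (a c y^n)^e with a, c in \<open>F\<close>. Hence t differs from an element of F(y) by an e-th
  root of unity of \<open>F\<close>.\<close>

lemma L_eq: "L = simple_extension F y"
proof
  let ?G = "F \<union> {y \<in> carrier \<Omega>. y [^] e \<in> \<Union>D}"
  have Gc: "?G \<subseteq> carrier \<Omega>" using F_carrier by auto
  have "u \<in> cls u"
    using mem_cls[of u u] subringE(3)[OF Fr] u(5) by (auto intro!: bexI[of _ \<one>])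
  then have yG: "y \<in> ?G" using y u(4,6) by auto
  have sub: "subfield L \<Omega>" unfolding adjoin_roots_def by (rule generate_field_is_subfield[OF Gc])
  have GL: "?G \<subseteq> L" unfolding adjoin_roots_def by (auto intro: generate_field.incl)
  show "simple_extension F y \<subseteq> L"
    by (rule simple_extension_subring_incl[OF subfieldE(1)[OF sub]]) (use GL yG in auto)
  have sub': "subfield (simple_extension F y) \<Omega>"
    using simple_extension_is_subfield[OF F y] algebraic_y by blast
  have Fs: "F \<subseteq> simple_extension F y" using simple_extension_incl[OF subfieldE(3)[OF F] y] .
  have ys: "y \<in> simple_extension F y" using simple_extension_mem[OF Fr y] .
  note mult = subringE(6)[OF subfieldE(1)[OF sub']]
  have ps: "y [^] n \<in> simple_extension F y" for n :: nat
    by (induction n) (use mult ys subringE(3)[OF subfieldE(1)[OF sub']] in auto)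
  have "t \<in> simple_extension F y" if t: "t \<in> carrier \<Omega>" "t [^] e \<in> d" "d \<in> D" for t d
  proof -
    obtain x where x: "x \<in> F" "x \<noteq> \<zero>" "d = cls x" using D_cls[OF t(3)] by blast
    then obtain a where a: "a \<in> F" "a \<noteq> \<zero>" "t [^] e = a [^] e \<otimes> x" using t(2) mem_cls by blast
    define n where "n = nat (w x mod int e)"
    have n: "int n = w x mod int e" using e by (simp add: n_def)
    have un: "u [^] n \<in> F" "u [^] n \<noteq> \<zero>" "w (u [^] n) = int n" "cls (u [^] n) \<in> D"
      using F_nonzero_pow[OF u(1,2), of n] u(3) cls_pow_mem(2)[OF u(1,2,4), of n] by auto
    have "cls (u [^] n) = cls x"
      by (rule cls_eqI) (use un x t(3) n in auto)
    then obtain c where c: "c \<in> F" "c \<noteq> \<zero>" "x = c [^] e \<otimes> u [^] n"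
      using cls_eq_iff[OF un(1,2) x(1,2)] by blast
    define b where "b = a \<otimes> c \<otimes> y [^] n"
    have cc: "a \<in> carrier \<Omega>" "c \<in> carrier \<Omega>" using a c F_carrier by auto
    have "b [^] e = a [^] e \<otimes> c [^] e \<otimes> (y [^] n) [^] e"
      using cc y by (simp add: b_def nat_pow_distrib)
    also have "(y [^] n) [^] e = u [^] n"
      using y by (simp add: nat_pow_pow mult.commute[of n]) (simp add: nat_pow_pow[symmetric] u(6))
    finally have "t [^] e = b [^] e" using a(3) c(3) cc u(5) by (simp add: m_assoc)
    moreover have bc: "b \<in> carrier \<Omega>" "b \<noteq> \<zero>" 
      using cc y a(2) c(2) y_nonzero by (auto simp: b_def integral_iff nat_pow_nonzero)
    ultimately obtain \<omega> where "\<omega> \<in> F" "t = \<omega> \<otimes> b" using same_power[OF t(1) bc] by blast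
    moreover have "b \<in> simple_extension F y" unfolding b_def using mult Fs a(1) c(1) ps by blast
    ultimately show ?thesis using mult Fs by blast
  qed
  then have "?G \<subseteq> simple_extension F y" using Fs by blast
  then show "L \<subseteq> simple_extension F y"
    unfolding adjoin_roots_def by (rule generate_field_min_subfield1[OF Gc sub'])
qed

lemma L: "subfield L \<Omega>" "F \<subseteq> L" "y \<in> L"
  unfolding L_eq using simple_extension_is_subfield[OF F y] algebraic_y
    simple_extension_incl[OF subfieldE(3)[OF F] y] simple_extension_mem[OF Fr y] by auto

lemma KL: "K \<subseteq> L" using KF L(2) by blast

lemma L_carrier: "x \<in> L \<Longrightarrow> x \<in> carrier \<Omega>" using subfieldE(3)[OF L(1)] by blast

section \<open>The Galois group of \<open>L\<close> over \<open>K\<close> and its restriction to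
  \<open>F\<close>\<close>

abbreviation \<Gamma> where "\<Gamma> \<equiv> galois_group \<L> K"
abbreviation G where "G \<equiv> galois_group \<F> K"

lemma ring_L: "ring \<L>" using subring_is_ring[OF subfieldE(1)[OF L(1)]] .

sublocale \<Gamma>: group \<Gamma> by (rule group_galois_group[OF ring_L]) (use KL in simp)
sublocale G: group G by (rule group_galois_group[OF LF.ring_axioms]) (use KF in simp)

lemma Gamma_iff:
  "\<tau> \<in> carrier \<Gamma> \<longleftrightarrow> \<tau> \<in> extensional L \<and> bij_betw \<tau> L L \<and> \<tau> \<in> ring_hom \<L> \<L> \<and> (\<forall>x\<in>K. \<tau> x = x)"
  by (simp add: galois_group_iff)

lemma G_iff:
  "\<tau> \<in> carrier G \<longleftrightarrow> \<tau> \<in> extensional F \<and> bij_betw \<tau> F F \<and> \<tau> \<in> ring_hom \<F> \<F> \<and> (\<forall>x\<in>K. \<tau> x = x)"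
  by (simp add: galois_group_iff)

lemma Gamma_hom:
  assumes "\<tau> \<in> carrier \<Gamma>"
  shows "x \<in> L \<Longrightarrow> \<tau> x \<in> L" "x \<in> L \<Longrightarrow> z \<in> L \<Longrightarrow> \<tau> (x \<otimes> z) = \<tau> x \<otimes> \<tau> z"
    "x \<in> L \<Longrightarrow> z \<in> L \<Longrightarrow> \<tau> (x \<oplus> z) = \<tau> x \<oplus> \<tau> z" "\<tau> \<one> = \<one>" "\<tau> \<zero> = \<zero>"
    "x \<in> L \<Longrightarrow> x \<noteq> \<zero> \<Longrightarrow> \<tau> x \<noteq> \<zero>"
proof -
  from assms have t: "\<tau> \<in> ring_hom \<L> \<L>" "bij_betw \<tau> L L" "\<forall>x\<in>K. \<tau> x = x" by (auto simp: Gamma_iff)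
  note m = ring_hom_memE[OF t(1)]
  show "x \<in> L \<Longrightarrow> \<tau> x \<in> L" "x \<in> L \<Longrightarrow> z \<in> L \<Longrightarrow> \<tau> (x \<otimes> z) = \<tau> x \<otimes> \<tau> z"
    "x \<in> L \<Longrightarrow> z \<in> L \<Longrightarrow> \<tau> (x \<oplus> z) = \<tau> x \<oplus> \<tau> z" "\<tau> \<one> = \<one>" using m by auto
  show z: "\<tau> \<zero> = \<zero>" using t(3) subringE(2)[OF Kr] by blast
  show "x \<in> L \<Longrightarrow> x \<noteq> \<zero> \<Longrightarrow> \<tau> x \<noteq> \<zero>"
    using t(2) z subringE(2)[OF subfieldE(1)[OF L(1)]] unfolding bij_betw_def inj_on_def by metis
qed

lemma L_pow: "x \<in> L \<Longrightarrow> x [^] (n::nat) \<in> L"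
  by (induction n) (use subringE(3,6)[OF subfieldE(1)[OF L(1)]] in auto)

lemma Gamma_pow: "\<tau> \<in> carrier \<Gamma> \<Longrightarrow> x \<in> L \<Longrightarrow> \<tau> (x [^] (n::nat)) = \<tau> x [^] n"
  by (induction n) (auto simp: Gamma_hom L_pow)

lemma Gamma_mult: "\<tau> \<in> carrier \<Gamma> \<Longrightarrow> \<tau>' \<in> carrier \<Gamma> \<Longrightarrow> x \<in> L \<Longrightarrow> (\<tau> \<otimes>\<^bsub>\<Gamma>\<^esub> \<tau>') x = \<tau> (\<tau>' x)"
  using galois_group_mult[of \<tau> \<L> K \<tau>' x] by simp

lemma Gamma_eqI:
  assumes "\<tau> \<in> carrier \<Gamma>" "\<tau>' \<in> carrier \<Gamma>" "\<And>x. x \<in> F \<Longrightarrow> \<tau> x = \<tau>' x" "\<tau> y = \<tau>' y"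
  shows "\<tau> = \<tau>'"
proof (rule extensionalityI[of _ L])
  have h: "\<tau> \<in> ring_hom \<L> \<Omega>" "\<tau>' \<in> ring_hom \<L> \<Omega>"
    using assms(1,2) L_carrier by (auto simp: Gamma_iff ring_hom_def)
  fix x assume "x \<in> L"
  then show "\<tau> x = \<tau>' x"
    using homs_agree_simple_extension[OF h subfieldE(1)[OF L(1)] L(2,3) assms(3,4)] L_eq by blast
qed (use assms in \<open>auto simp: Gamma_iff\<close>)

text \<open>The generator \<open>T \<zeta>\<close> of \<open>F\<close> over \<open>K\<close> is a root of unity of order dividing \<open>q\<^sup>f - 1\<close>,
  and \<open>F\<close> contains all of these.\<close>

lemma Gamma_F:
  assumes "\<tau> \<in> carrier \<Gamma>" "x \<in> F"
  shows "\<tau> x \<in> F"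
proof -
  have z: "T \<zeta> \<in> F" using teich_F[OF zeta(1)] .
  have "\<tau> (T \<zeta>) [^] (q ^ f - 1) = \<tau> (T \<zeta> [^] (q ^ f - 1))"
    using Gamma_pow[OF assms(1), of "T \<zeta>"] z L(2) by auto
  then have "\<tau> (T \<zeta>) [^] (q ^ f - 1) = \<one>"
    using teich_pow_order[OF zeta(1,2)] Gamma_hom(4)[OF assms(1)] by simp
  then have tz: "\<tau> (T \<zeta>) \<in> F"
    using roots_of_unity_in_F Gamma_hom(1)[OF assms(1)] z L(2) L_carrier by blast
  have "x \<in> simple_extension K (T \<zeta>)" using assms(2) simple_extension_F by simp
  then have "x \<in> F \<and> \<tau> x \<in> F"
  proof (induction rule: simple_extension.induct)
    case zero
    then show ?case using Gamma_hom(5)[OF assms(1)] subringE(2)[OF Fr] by simp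
  next
    case (lin a b)
    have "\<tau> b = b" using assms(1) lin(2) by (auto simp: Gamma_iff)
    moreover have "b \<in> F" using lin(2) KF by blast
    ultimately show ?case
      using lin(3) z tz subringE(6,7)[OF Fr] L(2) Gamma_hom(2,3)[OF assms(1)] by (auto simp: subset_iff)
  qed
  then show ?thesis ..
qed

lemma restrict_Gamma:
  assumes "\<tau> \<in> carrier \<Gamma>"
  shows "restrict \<tau> F \<in> carrier G"
proof -
  have "bij_betw \<tau> L L" using assms by (simp add: Gamma_iff)
  then have inj: "inj_on \<tau> F" using L(2) by (auto simp: bij_betw_def intro: inj_on_subset)
  have "\<tau> ` F = F"
  proof
    show "\<tau> ` F \<subseteq> F" using Gamma_F[OF assms] by auto
    show "F \<subseteq> \<tau> ` F"
    proof
      fix x assume x: "x \<in> F"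
      have "(inv\<^bsub>\<Gamma>\<^esub> \<tau>) x \<in> F" using Gamma_F[OF \<Gamma>.inv_closed[OF assms] x] .
      moreover have "\<tau> ((inv\<^bsub>\<Gamma>\<^esub> \<tau>) x) = x"
        using Gamma_mult[OF assms \<Gamma>.inv_closed[OF assms], of x] x L(2) \<Gamma>.r_inv[OF assms]
        by (auto simp: galois_group_one)
      ultimately show "x \<in> \<tau> ` F" by (metis imageI)
    qed
  qed
  then have "bij_betw \<tau> F F" using inj by (simp add: bij_betw_def)
  then have "bij_betw (restrict \<tau> F) F F" by (simp add: bij_betw_restrict_eq)
  moreover have "restrict \<tau> F \<in> ring_hom \<F> \<F>"
    by (rule ring_hom_memI)
      (use Gamma_F[OF assms] Gamma_hom[OF assms] L(2) subringE(3,6,7)[OF Fr] in \<open>auto simp: subset_iff\<close>)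
  moreover have "restrict \<tau> F x = x" if "x \<in> K" for x
    using that assms KF by (auto simp: Gamma_iff)
  ultimately show ?thesis by (simp add: G_iff)
qed

text \<open>By \<open>degree_ge_e\<close>, X^e - u has the least degree among the nonzero
  polynomials over \<open>F\<close> vanishing at \<open>y\<close>; \<open>s\<close> carries it to
  X^e - s(u), which vanishes at b y, so \<open>hom_extension\<close> applies. What remains is that
  the extension maps \<open>L\<close> onto itself.\<close>

lemma Gamma_lift:
  assumes "s \<in> carrier G" "b \<in> F" "b \<noteq> \<zero>" "s u = b [^] e \<otimes> u"
  shows "\<exists>\<tau> \<in> carrier \<Gamma>. (\<forall>x\<in>F. \<tau> x = s x) \<and> \<tau> y = b \<otimes> y"
proof -
  have s: "s \<in> ring_hom \<F> \<F>" "bij_betw s F F" "\<And>x. x \<in> K \<Longrightarrow> s x = x" using assms(1) by (auto simp: G_iff)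
  have s': "s \<in> ring_hom \<F> \<Omega>" using s(1) F_carrier by (auto simp: ring_hom_def)
  have bc: "b \<in> carrier \<Omega>" using F_carrier[OF assms(2)] .
  have sminus: "s (\<ominus> u) = \<ominus> s u"
  proof -
    have mu: "\<ominus> u \<in> F" using u(1) subringE(5)[OF Fr] by simp
    have "s (\<ominus> u \<oplus> u) = s (\<ominus> u) \<oplus> s u" using ring_hom_add[OF s(1), of "\<ominus> u" u] u(1) mu by simp
    then have "s (\<ominus> u) \<oplus> s u = \<zero>" using l_neg[OF u(5)] s(3)[OF subringE(2)[OF Kr]] by simp
    then show ?thesis using minus_equality ring_hom_memE(1)[OF s'] u(1) mu by simp
  qed
  have "map s (power_minus e u) = power_minus e (s u)"
    using s(3)[OF subringE(2)[OF Kr]] s(3)[OF subringE(3)[OF Kr]] sminus by (simp add: power_minus_def)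
  moreover have "eval (power_minus e (s u)) (b \<otimes> y) = \<zero>"
    using eval_power_minus[OF e, of "s u" "b \<otimes> y"] assms(4) bc y u(5) u(6) 
    by (simp add: nat_pow_distrib minus_eq r_neg)
  ultimately have ev: "eval (map s (power_minus e u)) (b \<otimes> y) = \<zero>" by simp
  have "\<exists>t \<in> ring_hom (\<Omega>\<lparr>carrier := simple_extension F y\<rparr>) \<Omega>. (\<forall>x\<in>F. t x = s x) \<and> t y = b \<otimes> y"
  proof (rule hom_extension[OF F s' y _ power_minus_u(1,2) _ power_minus_u(3) ev])
    show "b \<otimes> y \<in> carrier \<Omega>" using bc y by simp
    fix p assume "p \<in> carrier (F[X])" "p \<noteq> []" "eval p y = \<zero>"
    then show "degree (power_minus e u) \<le> degree p" using degree_ge_e unfolding degree_power_minus[OF e] by blast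
  qed
  then obtain t where t: "t \<in> ring_hom \<L> \<Omega>" "\<And>x. x \<in> F \<Longrightarrow> t x = s x" "t y = b \<otimes> y"
    unfolding L_eq by blast
  note th = ring_hom_memE[OF t(1)]
  note Lr = subfieldE(1)[OF L(1)]
  have sF: "s x \<in> F" if "x \<in> F" for x using ring_hom_memE(1)[OF s(1)] that by simp
  have tL: "t x \<in> L" if "x \<in> L" for x
  proof -
    have "x \<in> simple_extension F y" using that L_eq by simp
    then have "x \<in> L \<and> t x \<in> L"
    proof (induction rule: simple_extension.induct)
      case zero
      then show ?case using t(2)[OF subringE(2)[OF Fr]] s(3)[OF subringE(2)[OF Kr]] subringE(2)[OF Lr] by simp
    next
      case (lin a c)
      then have c: "c \<in> L" "t c \<in> L" using t(2) sF L(2) by auto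
      have "t (a \<otimes> y \<oplus> c) = t a \<otimes> t y \<oplus> t c"
        using th(2,3) lin(3) L(3) c subringE(6)[OF Lr] by simp
      then show ?case using lin(3) c t(3) L(2,3) assms(2) subringE(6,7)[OF Lr] by (auto simp: subset_iff)
    qed
    then show ?thesis ..
  qed
  interpret t: ring_hom_ring \<L> \<Omega> t using ring_hom_ringI2[OF ring_L ring_axioms t(1)] .
  have injt: "inj_on t L"
    using non_trivial_field_hom_is_inj[OF t(1) subfield_iff(2)[OF L(1)] field_axioms] by simp
  have sub: "subring (t ` L) \<Omega>"
    using t.img_is_subring[OF ring.carrier_is_subring[OF ring_L]] by simp
  have FtL: "F \<subseteq> t ` L"
  proof
    fix x assume "x \<in> F"
    then have "x \<in> s ` F" using bij_betw_imp_surj_on[OF s(2)] by simp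
    then obtain x' where "x' \<in> F" "x = s x'" by auto
    then have "x = t x'" "x' \<in> L" using t(2) L(2) by auto
    then show "x \<in> t ` L" by blast
  qed
  \<comment> \<open>The image contains b y and, \<open>s\<close> being onto, all of
    \<open>F\<close>, in particular the inverse of \<open>b\<close>.\<close>
  have ytL: "y \<in> t ` L"
  proof -
    have ib: "inv b \<in> F" "inv b \<otimes> b = \<one>" using F_nonzero_inv[OF assms(2,3)] by auto
    have "b \<otimes> y \<in> t ` L" using t(3) L(3) by (metis imageI)
    then have "inv b \<otimes> (b \<otimes> y) \<in> t ` L" using subringE(6)[OF sub] FtL ib(1) by blast
    then show ?thesis using ib bc y F_carrier by (simp add: m_assoc[symmetric])
  qed
  have "L \<subseteq> t ` L"
    using simple_extension_subring_incl[OF sub FtL ytL] L_eq by simp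
  then have "bij_betw t L L" using injt tL by (auto simp: bij_betw_def)
  then have "bij_betw (restrict t L) L L" by (simp add: bij_betw_restrict_eq)
  moreover have "restrict t L \<in> ring_hom \<L> \<L>"
    by (rule ring_hom_memI) (use th tL subringE(3,6,7)[OF Lr] in auto)
  moreover have "restrict t L x = x" if "x \<in> K" for x
    using that KL KF t(2) s(3) by auto
  ultimately have "restrict t L \<in> carrier \<Gamma>" by (simp add: Gamma_iff)
  moreover have "\<forall>x\<in>F. restrict t L x = s x" using t(2) L(2) by auto
  moreover have "restrict t L y = b \<otimes> y" using t(3) L(3) by simp
  ultimately show ?thesis by blast
qed

end


section \<open>The class of the extension\<close>

context kummer_generator
begin

abbreviation C where "C \<equiv> torsion (mult_of M) e"
abbreviation \<rho> where "\<rho> \<equiv> \<lambda>\<tau>. restrict \<tau> F"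
abbreviation \<theta> where "\<theta> \<equiv> inertia_character \<Omega> F w e D L"

lemma mem_C: "a \<in> carrier C \<longleftrightarrow> a \<in> carrier M \<and> a \<noteq> \<zero>\<^bsub>M\<^esub> \<and> a [^]\<^bsub>M\<^esub> e = \<one>\<^bsub>M\<^esub>"
  unfolding torsion_def by (simp add: M.mult_of_nat_pow)

lemma mult_C: "a \<otimes>\<^bsub>C\<^esub> b = a \<otimes>\<^bsub>M\<^esub> b" and one_C: "\<one>\<^bsub>C\<^esub> = \<one>\<^bsub>M\<^esub>"
  by (simp_all add: torsion_def)

lemma pow_C: "a [^]\<^bsub>C\<^esub> (n::nat) = a [^]\<^bsub>M\<^esub> n"
  by (simp add: nat_pow_def torsion_def)

lemma inv_M: "a \<in> carrier M \<Longrightarrow> a \<noteq> \<zero>\<^bsub>M\<^esub> \<Longrightarrow> \<exists>b. b \<in> carrier M \<and> b \<noteq> \<zero>\<^bsub>M\<^esub> \<and> b \<otimes>\<^bsub>M\<^esub> a = \<one>\<^bsub>M\<^esub>"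
  using M.nonzero_inv[of a] by (intro exI[of _ "inv\<^bsub>M\<^esub> a"]) simp

lemma C_closed:
  assumes "a \<in> carrier C" "b \<in> carrier C"
  shows "a \<otimes>\<^bsub>M\<^esub> b \<in> carrier C"
  using assms by (simp add: mem_C M.nat_pow_distrib M.integral_iff)

lemma C_inverse: "a \<in> carrier C \<Longrightarrow> \<exists>b \<in> carrier C. b \<otimes>\<^bsub>M\<^esub> a = \<one>\<^bsub>M\<^esub>"
proof -
  assume a: "a \<in> carrier C"
  then obtain b where b: "b \<in> carrier M" "b \<noteq> \<zero>\<^bsub>M\<^esub>" "b \<otimes>\<^bsub>M\<^esub> a = \<one>\<^bsub>M\<^esub>" using inv_M mem_C by blast
  have aM: "a \<in> carrier M" "a [^]\<^bsub>M\<^esub> e = \<one>\<^bsub>M\<^esub>" using a unfolding mem_C by blast+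
  have "(b \<otimes>\<^bsub>M\<^esub> a) [^]\<^bsub>M\<^esub> e = b [^]\<^bsub>M\<^esub> e \<otimes>\<^bsub>M\<^esub> a [^]\<^bsub>M\<^esub> e" by (rule M.nat_pow_distrib[OF b(1) aM(1)])
  then have "b [^]\<^bsub>M\<^esub> e = \<one>\<^bsub>M\<^esub>" unfolding b(3) aM(2) using b(1) by simp
  then have "b \<in> carrier C" using b unfolding mem_C by blast
  with b(3) show ?thesis by blast
qed

lemma group_C: "group C"
proof (rule groupI)
  show "\<one>\<^bsub>C\<^esub> \<in> carrier C" unfolding one_C by (simp add: mem_C)
qed (use C_closed C_inverse in \<open>auto simp: mult_C one_C mem_C M.m_assoc\<close>)

text \<open>Both \<tau>(y) and c y are e-th roots of \<tau>(u); the root of unity between them lies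
  in \<open>F\<close> and is absorbed into b.\<close>

lemma Gamma_y:
  assumes "\<tau> \<in> carrier \<Gamma>" "c \<in> F" "c \<noteq> \<zero>" "\<tau> u = c [^] e \<otimes> u"
  shows "\<exists>b\<in>F. b [^] e = c [^] e \<and> \<tau> y = b \<otimes> y"
proof -
  have cc: "c \<in> carrier \<Omega>" using F_carrier[OF assms(2)] .
  have "\<tau> y [^] e = \<tau> u" using Gamma_pow[OF assms(1) L(3), of e] u(6) by simp
  also have "\<dots> = (c \<otimes> y) [^] e" using assms(4) cc y u(6) by (simp add: nat_pow_distrib)
  finally obtain \<omega> where \<omega>: "\<omega> \<in> F" "\<omega> [^] e = \<one>" "\<tau> y = \<omega> \<otimes> (c \<otimes> y)"
    using same_power[of "\<tau> y" "c \<otimes> y"] Gamma_hom(1)[OF assms(1) L(3)] L_carrier cc y assms(3) y_nonzero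
    by (auto simp: integral_iff)
  have "(\<omega> \<otimes> c) [^] e = c [^] e" using \<omega> cc F_carrier by (simp add: nat_pow_distrib)
  moreover have "\<tau> y = (\<omega> \<otimes> c) \<otimes> y" using \<omega> cc y F_carrier by (simp add: m_assoc)
  moreover have "\<omega> \<otimes> c \<in> F" using subringE(6)[OF Fr \<omega>(1) assms(2)] .
  ultimately show ?thesis by blast
qed

lemma mem_kernel: "\<tau> \<in> kernel \<Gamma> G \<rho> \<longleftrightarrow> \<tau> \<in> carrier \<Gamma> \<and> (\<forall>x\<in>F. \<tau> x = x)"
proof -
  have "restrict \<tau> F = (\<lambda>x\<in>F. x) \<longleftrightarrow> (\<forall>x\<in>F. \<tau> x = x)" by (auto simp: restrict_def fun_eq_iff)
  then show ?thesis by (simp add: kernel_def galois_group_one)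
qed

lemma kernel_y:
  assumes "\<tau> \<in> kernel \<Gamma> G \<rho>"
  obtains \<omega> where "\<omega> \<in> F" "\<omega> [^] e = \<one>" "\<tau> y = \<omega> \<otimes> y"
proof -
  have t: "\<tau> \<in> carrier \<Gamma>" "\<tau> u = \<one> [^] e \<otimes> u" using assms u(1,5) by (simp_all add: mem_kernel)
  obtain \<omega> where "\<omega> \<in> F" "\<omega> [^] e = \<one> [^] e" "\<tau> y = \<omega> \<otimes> y"
    using Gamma_y[OF t(1) subringE(3)[OF Fr] one_not_zero t(2)] by blast
  then show ?thesis using that by simp
qed

text \<open>This resolves the definite description in \<open>inertia_character\<close>. Any other
  admissible root y' is \<open>y\<close> times an element of \<open>F\<close>, which \<tau> fixes,
  so the quotient \<tau>(y')/y' is the same.\<close>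

lemma inertia_character_eq:
  assumes "\<tau> \<in> kernel \<Gamma> G \<rho>" "\<omega> \<in> F" "\<omega> [^] e = \<one>" "\<tau> y = \<omega> \<otimes> y"
  shows "\<theta> \<tau> = res \<omega>"
proof -
  have t: "\<tau> \<in> carrier \<Gamma>" "\<And>x. x \<in> F \<Longrightarrow> \<tau> x = x" using assms(1) by (auto simp: mem_kernel)
  have \<omega>c: "\<omega> \<in> carrier \<Omega>" using F_carrier[OF assms(2)] .
  have "(THE z. \<exists>u. \<exists>y\<in>L. uniformiser \<F> w u \<and> line_generator \<F> e D u \<and> y [^] e = u \<and> z = \<tau> y \<otimes> inv y) = \<omega>"
  proof (rule the_equality)
    have "uniformiser \<F> w u" using u(1-3) by (simp add: uniformiser_def)
    moreover have "line_generator \<F> e D u" using line_generator_iff[OF u(1-3)] u(4) by simp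
    moreover have "\<omega> = \<tau> y \<otimes> inv y" using assms(4) nonzero_inv[OF y y_nonzero] y \<omega>c by (simp add: m_assoc)
    ultimately show "\<exists>u. \<exists>y\<in>L. uniformiser \<F> w u \<and> line_generator \<F> e D u \<and> y [^] e = u \<and> \<omega> = \<tau> y \<otimes> inv y"
      using u(6) L(3) by blast
  next
    fix z assume "\<exists>u. \<exists>y\<in>L. uniformiser \<F> w u \<and> line_generator \<F> e D u \<and> y [^] e = u \<and> z = \<tau> y \<otimes> inv y"
    then obtain u' y' where 1: "y' \<in> L" "uniformiser \<F> w u'" "line_generator \<F> e D u'" "y' [^] e = u'"
      "z = \<tau> y' \<otimes> inv y'" by blast
    have u': "u' \<in> F" "u' \<noteq> \<zero>" "w u' = 1" using 1(2) by (auto simp: uniformiser_def)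
    then have "cls u' \<in> D" using line_generator_iff 1(3) by blast
    then have "cls u = cls u'" by (intro cls_eqI) (use u' u in auto)
    then obtain c where c: "c \<in> F" "c \<noteq> \<zero>" "u' = c [^] e \<otimes> u" using cls_eq_iff[OF u(1,2) u'(1,2)] by blast
    have cc: "c \<in> carrier \<Omega>" using F_carrier[OF c(1)] .
    have y'c: "y' \<in> carrier \<Omega>" using L_carrier[OF 1(1)] .
    have "y' [^] e = (c \<otimes> y) [^] e" using 1(4) c(3) cc y u(6) by (simp add: nat_pow_distrib)
    then obtain \<omega>' where \<omega>': "\<omega>' \<in> F" "y' = \<omega>' \<otimes> (c \<otimes> y)"
      using same_power[OF y'c, of "c \<otimes> y"] cc y c(2) y_nonzero by (auto simp: integral_iff)
    have \<omega>'c: "\<omega>' \<in> carrier \<Omega>" using F_carrier[OF \<omega>'(1)] .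
    have "\<omega>' \<otimes> c \<in> F" using subringE(6)[OF Fr \<omega>'(1) c(1)] .
    then have "\<tau> ((\<omega>' \<otimes> c) \<otimes> y) = (\<omega>' \<otimes> c) \<otimes> (\<omega> \<otimes> y)"
      using Gamma_hom(2)[OF t(1), of "\<omega>' \<otimes> c" y] t(2) L(2,3) assms(4) by auto
    then have ty: "\<tau> y' = \<omega> \<otimes> y'" using \<omega>'(2) \<omega>'c cc y \<omega>c by (simp add: m_ac)
    have "y' \<noteq> \<zero>" using 1(4) u'(2) nat_pow_zero[of e] e by auto
    then show "z = \<omega>" using 1(5) ty nonzero_inv[OF y'c] y'c \<omega>c by (simp add: m_assoc)
  qed
  then show ?thesis by (simp add: inertia_character_def)
qed

lemma residue_root_of_unity:
  assumes "\<omega> \<in> F" "\<omega> [^] e = \<one>"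
  shows "res \<omega> \<in> carrier C"
proof -
  note r = root_of_unity_e[OF F_carrier[OF assms(1)] assms(2)]
  have *: "res \<omega> [^]\<^bsub>M\<^esub> e = \<one>\<^bsub>M\<^esub>" using residue_pow[OF r(2), of e] assms(2) residue_one by simp
  moreover have "res \<omega> \<noteq> \<zero>\<^bsub>M\<^esub>"
    using * M.nat_pow_zero[of e] e by auto
  ultimately show ?thesis using residue_closed[OF r(2)] by (simp add: mem_C)
qed

lemma teich_C:
  assumes "c \<in> carrier C"
  shows "T c \<in> F" "T c \<noteq> \<zero>" "T c [^] e = \<one>" "res (T c) = c"
proof -
  have c: "c \<in> carrier M" "c [^]\<^bsub>M\<^esub> e = \<one>\<^bsub>M\<^esub>" using assms by (auto simp: mem_C)
  show "T c \<in> F" "res (T c) = c" using teich_F residue_teich c by auto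
  have "T \<one>\<^bsub>M\<^esub> = \<one>"
    using teich_residue(2)[of \<one>] subringE(3)[OF Fr] residue_one by simp
  then show 1: "T c [^] e = \<one>" using teich_pow[OF c(1), of e] c(2) by simp
  then show "T c \<noteq> \<zero>" using nat_pow_zero[of e] e by auto
qed

text \<open>Injective because an e-th root of unity is the representative of its residue and \<tau>
  is determined by \<tau>(y); surjective by lifting the identity of \<open>F\<close> with y sent to
  T(c) y.\<close>

lemma inertia_character_iso: "\<theta> \<in> iso (\<Gamma>\<lparr>carrier := kernel \<Gamma> G \<rho>\<rparr>) C"
proof (rule isoI)
  show "\<theta> \<in> hom (\<Gamma>\<lparr>carrier := kernel \<Gamma> G \<rho>\<rparr>) C"
  proof (rule homI)
    fix \<tau> assume "\<tau> \<in> carrier (\<Gamma>\<lparr>carrier := kernel \<Gamma> G \<rho>\<rparr>)"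
    then have "\<tau> \<in> kernel \<Gamma> G \<rho>" by simp
    moreover then obtain \<omega> where "\<omega> \<in> F" "\<omega> [^] e = \<one>" "\<tau> y = \<omega> \<otimes> y" by (rule kernel_y)
    ultimately show "\<theta> \<tau> \<in> carrier C" using inertia_character_eq residue_root_of_unity by simp
  next
    fix \<tau> \<tau>' assume "\<tau> \<in> carrier (\<Gamma>\<lparr>carrier := kernel \<Gamma> G \<rho>\<rparr>)" "\<tau>' \<in> carrier (\<Gamma>\<lparr>carrier := kernel \<Gamma> G \<rho>\<rparr>)"
    then have k: "\<tau> \<in> kernel \<Gamma> G \<rho>" "\<tau>' \<in> kernel \<Gamma> G \<rho>" by auto
    from k(1) obtain \<omega> where 1: "\<omega> \<in> F" "\<omega> [^] e = \<one>" "\<tau> y = \<omega> \<otimes> y" by (rule kernel_y)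
    from k(2) obtain \<omega>' where 2: "\<omega>' \<in> F" "\<omega>' [^] e = \<one>" "\<tau>' y = \<omega>' \<otimes> y" by (rule kernel_y)
    have t: "\<tau> \<in> carrier \<Gamma>" "\<tau>' \<in> carrier \<Gamma>" "\<And>x. x \<in> F \<Longrightarrow> \<tau> x = x" "\<And>x. x \<in> F \<Longrightarrow> \<tau>' x = x"
      using k by (auto simp: mem_kernel)
    have cc: "\<omega> \<in> carrier \<Omega>" "\<omega>' \<in> carrier \<Omega>" using F_carrier 1 2 by auto
    have k3: "\<tau> \<otimes>\<^bsub>\<Gamma>\<^esub> \<tau>' \<in> kernel \<Gamma> G \<rho>"
      unfolding mem_kernel using t Gamma_mult[OF t(1,2)] L(2) by auto
    have "(\<tau> \<otimes>\<^bsub>\<Gamma>\<^esub> \<tau>') y = \<tau> (\<omega>' \<otimes> y)" using Gamma_mult[OF t(1,2) L(3)] 2(3) by simp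
    also have "\<dots> = \<omega>' \<otimes> (\<omega> \<otimes> y)" using Gamma_hom(2)[OF t(1), of \<omega>' y] 2(1) L(2,3) t(3) 1(3) by auto
    also have "\<dots> = (\<omega> \<otimes> \<omega>') \<otimes> y" using cc y by (simp add: m_ac)
    finally have "\<theta> (\<tau> \<otimes>\<^bsub>\<Gamma>\<^esub> \<tau>') = res (\<omega> \<otimes> \<omega>')"
      by (intro inertia_character_eq[OF k3]) (use 1 2 cc subringE(6)[OF Fr] in \<open>auto simp: nat_pow_distrib\<close>)
    also have "\<dots> = res \<omega> \<otimes>\<^bsub>M\<^esub> res \<omega>'"
      using residue_mult[OF root_of_unity_e(2)[OF cc(1) 1(2)] root_of_unity_e(2)[OF cc(2) 2(2)]] by simp
    finally show "\<theta> (\<tau> \<otimes>\<^bsub>\<Gamma>\<lparr>carrier := kernel \<Gamma> G \<rho>\<rparr>\<^esub> \<tau>') = \<theta> \<tau> \<otimes>\<^bsub>C\<^esub> \<theta> \<tau>'"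
      using inertia_character_eq[OF k(1) 1] inertia_character_eq[OF k(2) 2] by (simp add: mult_C)
  qed
  show "bij_betw \<theta> (carrier (\<Gamma>\<lparr>carrier := kernel \<Gamma> G \<rho>\<rparr>)) (carrier C)"
  proof (rule bij_betw_imageI)
    show "inj_on \<theta> (carrier (\<Gamma>\<lparr>carrier := kernel \<Gamma> G \<rho>\<rparr>))"
    proof (rule inj_onI)
      fix \<tau> \<tau>' assume "\<tau> \<in> carrier (\<Gamma>\<lparr>carrier := kernel \<Gamma> G \<rho>\<rparr>)" "\<tau>' \<in> carrier (\<Gamma>\<lparr>carrier := kernel \<Gamma> G \<rho>\<rparr>)"
        and eq: "\<theta> \<tau> = \<theta> \<tau>'"
      then have k: "\<tau> \<in> kernel \<Gamma> G \<rho>" "\<tau>' \<in> kernel \<Gamma> G \<rho>" by auto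
      from k(1) obtain \<omega> where 1: "\<omega> \<in> F" "\<omega> [^] e = \<one>" "\<tau> y = \<omega> \<otimes> y" by (rule kernel_y)
      from k(2) obtain \<omega>' where 2: "\<omega>' \<in> F" "\<omega>' [^] e = \<one>" "\<tau>' y = \<omega>' \<otimes> y" by (rule kernel_y)
      have "res \<omega> = res \<omega>'"
        using inertia_character_eq[OF k(1) 1] inertia_character_eq[OF k(2) 2] eq by simp
      then have "\<omega> = \<omega>'"
        using root_of_unity_e(3)[OF F_carrier[OF 1(1)] 1(2)] root_of_unity_e(3)[OF F_carrier[OF 2(1)] 2(2)] by metis
      then show "\<tau> = \<tau>'"
        by (intro Gamma_eqI) (use k 1 2 in \<open>auto simp: mem_kernel\<close>)
    qed
    show "\<theta> ` carrier (\<Gamma>\<lparr>carrier := kernel \<Gamma> G \<rho>\<rparr>) = carrier C"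
    proof
      show "\<theta> ` carrier (\<Gamma>\<lparr>carrier := kernel \<Gamma> G \<rho>\<rparr>) \<subseteq> carrier C"
      proof safe
        fix \<tau> assume "\<tau> \<in> carrier (\<Gamma>\<lparr>carrier := kernel \<Gamma> G \<rho>\<rparr>)"
        then have k: "\<tau> \<in> kernel \<Gamma> G \<rho>" by simp
        then obtain \<omega> where "\<omega> \<in> F" "\<omega> [^] e = \<one>" "\<tau> y = \<omega> \<otimes> y" by (rule kernel_y)
        then show "\<theta> \<tau> \<in> carrier C" using inertia_character_eq[OF k] residue_root_of_unity by simp
      qed
    next
      show "carrier C \<subseteq> \<theta> ` carrier (\<Gamma>\<lparr>carrier := kernel \<Gamma> G \<rho>\<rparr>)"
      proof
        fix c assume c: "c \<in> carrier C"
        note Tc = teich_C[OF c]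
        have id: "(\<lambda>x\<in>F. x) \<in> carrier G" using G.one_closed by (simp add: galois_group_one)
        obtain \<tau> where \<tau>: "\<tau> \<in> carrier \<Gamma>" "\<forall>x\<in>F. \<tau> x = (\<lambda>x\<in>F. x) x" "\<tau> y = T c \<otimes> y"
          using Gamma_lift[OF id Tc(1,2)] Tc(3) u(1,5) by auto
        then have k: "\<tau> \<in> kernel \<Gamma> G \<rho>" by (simp add: mem_kernel)
        have "\<theta> \<tau> = c" using inertia_character_eq[OF k Tc(1,3) \<tau>(3)] Tc(4) by simp
        with k show "c \<in> \<theta> ` carrier (\<Gamma>\<lparr>carrier := kernel \<Gamma> G \<rho>\<rparr>)" by force
      qed
    qed
  qed
qed

lemma lift_sigma:
  obtains s where "s \<in> carrier \<Gamma>" "\<rho> s = \<sigma>"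
proof -
  obtain b where b: "b \<in> F" "b \<noteq> \<zero>" "\<sigma> u = b [^] e \<otimes> u" using sigma_generator[OF u(1,2,4)] by blast
  from Gamma_lift[OF sigma b] obtain s where s: "s \<in> carrier \<Gamma>" "\<And>x. x \<in> F \<Longrightarrow> s x = \<sigma> x" by blast
  have "\<rho> s = \<sigma>" by (rule extensionalityI[of _ F]) (use s sigma_ext in auto)
  with s(1) show ?thesis by (rule that)
qed

lemma restriction_hom: "\<rho> \<in> hom \<Gamma> G"
proof (rule homI)
  fix \<tau> \<tau>' assume t: "\<tau> \<in> carrier \<Gamma>" "\<tau>' \<in> carrier \<Gamma>"
  note r = restrict_Gamma[OF t(1)] restrict_Gamma[OF t(2)]
  show "\<rho> (\<tau> \<otimes>\<^bsub>\<Gamma>\<^esub> \<tau>') = \<rho> \<tau> \<otimes>\<^bsub>G\<^esub> \<rho> \<tau>'"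
  proof (rule extensionalityI[of _ F])
    show "\<rho> \<tau> \<otimes>\<^bsub>G\<^esub> \<rho> \<tau>' \<in> extensional F" using G.m_closed[OF r] by (simp only: G_iff)
    fix x assume x: "x \<in> F"
    then show "\<rho> (\<tau> \<otimes>\<^bsub>\<Gamma>\<^esub> \<tau>') x = (\<rho> \<tau> \<otimes>\<^bsub>G\<^esub> \<rho> \<tau>') x"
      using Gamma_mult[OF t, of x] L(2) galois_group_mult[OF r, of x] Gamma_F[OF t(2) x] by auto
  qed simp
qed (rule restrict_Gamma)

text \<open>\<open>G\<close> consists of powers of \<open>\<sigma>\<close>, so one lift of
  \<open>\<sigma>\<close> suffices.\<close>

lemma restriction_epi: "\<rho> \<in> epi \<Gamma> G"
proof -
  interpret h: group_hom \<Gamma> G \<rho>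
    using restriction_hom by (intro group_hom.intro group_hom_axioms.intro \<Gamma>.group_axioms G.group_axioms)
  obtain s where s: "s \<in> carrier \<Gamma>" "\<rho> s = \<sigma>" by (rule lift_sigma)
  have "carrier G \<subseteq> \<rho> ` carrier \<Gamma>"
  proof
    fix t assume t: "t \<in> carrier G"
    then obtain i where i: "\<And>x. x \<in> F \<Longrightarrow> t x = (\<sigma> ^^ i) x" using galois_group_F by blast
    have p: "\<sigma> [^]\<^bsub>G\<^esub> i \<in> carrier G" using sigma by simp
    have "t = \<sigma> [^]\<^bsub>G\<^esub> i"
      by (rule extensionalityI[of _ F])
        (use t p i galois_group_pow[OF LF.ring_axioms _ sigma] KF in \<open>auto simp: G_iff\<close>)
    also have "\<dots> = \<rho> (s [^]\<^bsub>\<Gamma>\<^esub> i)" using h.hom_nat_pow[OF s(1), of i] s(2) by simp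
    finally show "t \<in> \<rho> ` carrier \<Gamma>" using s(1) by blast
  qed
  then show ?thesis using restriction_hom h.hom_closed by (auto simp: epi_def)
qed

text \<open>With r the conjugate of \<tau> by s, the relation r s = s \<tau> is evaluated at
  \<open>y\<close>, which avoids the inverse of s. As s(y) = b' y, it gives \<omega>' b' =
  \<sigma>(\<omega>) b', and \<open>\<sigma>\<close> raises residues to the q-th power.\<close>

lemma conjugation:
  assumes "s \<in> carrier \<Gamma>" "\<tau> \<in> kernel \<Gamma> G \<rho>" "\<rho> s = \<sigma>"
  shows "\<theta> (s \<otimes>\<^bsub>\<Gamma>\<^esub> \<tau> \<otimes>\<^bsub>\<Gamma>\<^esub> inv\<^bsub>\<Gamma>\<^esub> s) = \<theta> \<tau> [^]\<^bsub>C\<^esub> q"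
proof -
  from assms(2) obtain \<omega> where \<omega>: "\<omega> \<in> F" "\<omega> [^] e = \<one>" "\<tau> y = \<omega> \<otimes> y" by (rule kernel_y)
  have t: "\<tau> \<in> carrier \<Gamma>" "\<And>x. x \<in> F \<Longrightarrow> \<tau> x = x" using assms(2) by (auto simp: mem_kernel)
  have sF: "s x = \<sigma> x" if "x \<in> F" for x using fun_cong[OF assms(3), of x] that by simp
  interpret h: group_hom \<Gamma> G \<rho>
    using restriction_hom by (intro group_hom.intro group_hom_axioms.intro \<Gamma>.group_axioms G.group_axioms)
  define r where "r = s \<otimes>\<^bsub>\<Gamma>\<^esub> \<tau> \<otimes>\<^bsub>\<Gamma>\<^esub> inv\<^bsub>\<Gamma>\<^esub> s"
  have r: "r \<in> carrier \<Gamma>" "r \<otimes>\<^bsub>\<Gamma>\<^esub> s = s \<otimes>\<^bsub>\<Gamma>\<^esub> \<tau>" using assms(1) t(1) by (auto simp: r_def \<Gamma>.m_assoc)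
  have rk: "r \<in> kernel \<Gamma> G \<rho>"
    using normal.inv_op_closed2[OF h.normal_kernel assms(1,2)] by (simp add: r_def)
  obtain b where b: "b \<in> F" "b \<noteq> \<zero>" "\<sigma> u = b [^] e \<otimes> u" using sigma_generator[OF u(1,2,4)] by blast
  obtain b' where b': "b' \<in> F" "b' [^] e = b [^] e" "s y = b' \<otimes> y"
    using Gamma_y[OF assms(1) b(1,2)] b(3) sF[OF u(1)] by auto
  have "b' \<noteq> \<zero>" using b' F_nonzero_pow[OF b(1,2), of e] nat_pow_zero[of e] e by auto
  obtain \<omega>' where \<omega>': "\<omega>' \<in> F" "\<omega>' [^] e = \<one>" "r y = \<omega>' \<otimes> y" using kernel_y[OF rk] by blast
  have rF: "r x = x" if "x \<in> F" for x using rk that by (simp add: mem_kernel)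
  note cc = F_carrier[OF b'(1)] F_carrier[OF \<omega>'(1)] F_carrier[OF sigma_closed[OF \<omega>(1)]]
  have "r (s y) = (\<omega>' \<otimes> b') \<otimes> y"
    using b'(3) Gamma_hom(2)[OF r(1), of b' y] b'(1) L(2,3) rF \<omega>'(3) cc y by (auto simp: m_ac)
  moreover have "s (\<tau> y) = (\<sigma> \<omega> \<otimes> b') \<otimes> y"
    using \<omega>(3) Gamma_hom(2)[OF assms(1), of \<omega> y] \<omega>(1) L(2,3) sF b'(3) cc y by (auto simp: m_ac)
  moreover have "r (s y) = s (\<tau> y)"
    using Gamma_mult[OF r(1) assms(1) L(3)] Gamma_mult[OF assms(1) t(1) L(3)] r(2) by simp
  ultimately have "\<omega>' = \<sigma> \<omega>"
    using m_rcancel[OF y_nonzero y, of "\<omega>' \<otimes> b'" "\<sigma> \<omega> \<otimes> b'"] m_rcancel[OF \<open>b' \<noteq> \<zero>\<close> cc] cc by simp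
  then have "\<theta> r = res (\<sigma> \<omega>)" using inertia_character_eq[OF rk \<omega>'] by simp
  also have "\<dots> = res \<omega> [^]\<^bsub>M\<^esub> q"
    using residue_sigma root_of_unity_e(2)[OF F_carrier[OF \<omega>(1)] \<omega>(2)] by simp
  also have "res \<omega> = \<theta> \<tau>" using inertia_character_eq[OF assms(2) \<omega>] by simp
  finally show ?thesis by (simp add: r_def pow_C)
qed

lemma is_cyclic_extension: "cyclic_extension C q \<Gamma> G \<sigma> \<rho> \<theta>"
  unfolding cyclic_extension_def
  by (intro conjI ballI impI group_C \<Gamma>.group_axioms G.group_axioms restriction_epi
      inertia_character_iso conjugation)

text \<open>\<pi> lies in \<open>K\<close> and is fixed, while T(\<xi>) is raised exactly to its
  q-th power.\<close>

lemma sigma_u: "\<sigma> u = T \<xi> [^] (q - 1) \<otimes> u"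
proof -
  note p = uniformiser_K[OF pi] and t = teich_uniformiser(1)[OF pi xi]
  have "\<sigma> u = T \<xi> [^] q \<otimes> \<pi>"
    using sigma_mult[OF t] p sigma_teich[OF xi] sigma_fix by (simp add: u_def)
  also have "T \<xi> [^] q = T \<xi> [^] (q - 1) \<otimes> T \<xi>"
    using q_gt_1 F_carrier[OF t] by (simp add: nat_pow_Suc[symmetric] del: nat_pow_Suc)
  finally show ?thesis using F_carrier p t by (simp add: u_def m_assoc)
qed

text \<open>Cancelling \<open>u\<close> in \<sigma>(u) = b^e u gives b^e = T(\<xi>)^(q-1), so b is a
  unit whose residue satisfies the equation imposed on \<alpha> in
  \<open>line_class\<close>.\<close>

lemma lift_y:
  assumes "s \<in> carrier \<Gamma>" "\<rho> s = \<sigma>"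
  obtains b where "b \<in> O\<^sub>L" "b \<in> F" "res b \<noteq> \<zero>\<^bsub>M\<^esub>" "res b [^]\<^bsub>M\<^esub> e = \<xi> [^]\<^bsub>M\<^esub> (q - 1)" "s y = b \<otimes> y"
proof -
  have sF: "s x = \<sigma> x" if "x \<in> F" for x using fun_cong[OF assms(2), of x] that by simp
  obtain c where c: "c \<in> F" "c \<noteq> \<zero>" "\<sigma> u = c [^] e \<otimes> u" using sigma_generator[OF u(1,2,4)] by blast
  note t = teich_uniformiser(1,2)[OF pi xi]
  note tp = F_nonzero_pow[OF t, of "q - 1"]
  have "c [^] e = T \<xi> [^] (q - 1)"
    using m_rcancel[OF u(2,5), of "c [^] e" "T \<xi> [^] (q - 1)"] c sigma_u F_carrier tp by simp
  then obtain b where b: "b \<in> F" "b [^] e = T \<xi> [^] (q - 1)" "s y = b \<otimes> y"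
    using Gamma_y[OF assms(1) c(1,2)] c(3) sF[OF u(1)] by auto
  have b0: "b \<noteq> \<zero>" using b(2) tp nat_pow_zero[of e] e by auto
  have "w (T \<xi>) = 0"
    using LF.teichmueller_nonzero(2)[of \<xi>] xi unfolding M_def[symmetric] by simp
  then have "int e * w b = 0" using F_nonzero_pow[OF b(1) b0, of e] tp b(2) by simp
  then have wb: "w b = 0" using e by simp
  then have bO: "b \<in> O\<^sub>L" using b(1) by (simp add: LF.mem_val_ge)
  moreover have "res b \<noteq> \<zero>\<^bsub>M\<^esub>" using residue_eq_zero_iff[OF bO] wb b0 by (simp add: LF.mem_val_ge)
  moreover have "res b [^]\<^bsub>M\<^esub> e = \<xi> [^]\<^bsub>M\<^esub> (q - 1)"
    using residue_pow[OF bO, of e] residue_pow[OF teichmueller_closed[OF xi(1)], of "q - 1"] b(2) residue_teich[OF xi(1)] by simp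
  ultimately show ?thesis using b that by blast
qed

lemma funpow_sigma_integer:
  assumes "x \<in> O\<^sub>L"
  shows "(\<sigma> ^^ n) x \<in> O\<^sub>L" "res ((\<sigma> ^^ n) x) = res x [^]\<^bsub>M\<^esub> (q ^ n)"
proof -
  show *: "(\<sigma> ^^ n) x \<in> O\<^sub>L" for n
    by (induction n) (simp_all add: assms sigma_integer)
  show "res ((\<sigma> ^^ n) x) = res x [^]\<^bsub>M\<^esub> (q ^ n)"
  proof (induction n)
    case 0
    then show ?case using residue_closed[OF assms] by simp
  next
    case (Suc n)
    then show ?case
      using residue_sigma[OF *, of n] M.nat_pow_pow[OF residue_closed[OF assms], of "q ^ n" q]
      by (simp add: mult.commute)
  qed
qed

text \<open>\<open>S\<close> arises as the sum of the exponents q^i, since the residue of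
  \<sigma>^i(b) is the q^i-th power of that of \<open>b\<close>. The induction runs over the partial
  products.\<close>

lemma lift_power:
  assumes "s \<in> carrier \<Gamma>" "\<rho> s = \<sigma>" "b \<in> O\<^sub>L" "b \<in> F" "res b \<noteq> \<zero>\<^bsub>M\<^esub>" "s y = b \<otimes> y"
  shows "s [^]\<^bsub>\<Gamma>\<^esub> f \<in> kernel \<Gamma> G \<rho>" "\<theta> (s [^]\<^bsub>\<Gamma>\<^esub> f) = res b [^]\<^bsub>M\<^esub> S"
proof -
  have sF: "s x = \<sigma> x" if "x \<in> F" for x using fun_cong[OF assms(2), of x] that by simp
  have fF: "(\<sigma> ^^ n) x \<in> F" if "x \<in> F" for x n by (induction n) (auto simp: that sigma_closed)
  have pF: "(s [^]\<^bsub>\<Gamma>\<^esub> n) x = (\<sigma> ^^ n) x" if "x \<in> F" for x n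
  proof -
    have "(s ^^ n) x = (\<sigma> ^^ n) x" by (induction n) (use sF fF[OF that] in auto)
    then show ?thesis using galois_group_pow[OF ring_L _ assms(1), of x n] KL L(2) that by auto
  qed
  show k: "s [^]\<^bsub>\<Gamma>\<^esub> f \<in> kernel \<Gamma> G \<rho>"
    unfolding mem_kernel using assms(1) pF funpow_sigma_order by simp
  have "\<exists>B. B \<in> O\<^sub>L \<and> B \<in> F \<and> (s [^]\<^bsub>\<Gamma>\<^esub> n) y = B \<otimes> y \<and> res B = res b [^]\<^bsub>M\<^esub> (\<Sum>i<n. q ^ i)" for n
  proof (induction n)
    case 0
    then show ?case
      using LF.one_integer subringE(3)[OF Fr] L(3) y residue_one
      by (intro exI[of _ \<one>]) (auto simp: galois_group_one)
  next
    case (Suc n)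
    then obtain B where B: "B \<in> O\<^sub>L" "B \<in> F" "(s [^]\<^bsub>\<Gamma>\<^esub> n) y = B \<otimes> y"
      "res B = res b [^]\<^bsub>M\<^esub> (\<Sum>i<n. q ^ i)" by blast
    define b' where "b' = (\<sigma> ^^ n) b"
    have b': "b' \<in> F" "b' \<in> O\<^sub>L" "res b' = res b [^]\<^bsub>M\<^esub> (q ^ n)"
      using fF[OF assms(4)] funpow_sigma_integer[OF assms(3)] by (auto simp: b'_def)
    have sn: "s [^]\<^bsub>\<Gamma>\<^esub> n \<in> carrier \<Gamma>" using assms(1) by simp
    have "(s [^]\<^bsub>\<Gamma>\<^esub> Suc n) y = (s [^]\<^bsub>\<Gamma>\<^esub> n) (b \<otimes> y)"
      using Gamma_mult[OF sn assms(1) L(3)] assms(6) by simp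
    also have "\<dots> = b' \<otimes> (B \<otimes> y)"
      using Gamma_hom(2)[OF sn, of b y] assms(4) L(2,3) pF[OF assms(4)] B(3) by (auto simp: b'_def)
    also have "\<dots> = (b' \<otimes> B) \<otimes> y" using F_carrier b'(1) B(2) y by (simp add: m_assoc)
    finally have "(s [^]\<^bsub>\<Gamma>\<^esub> Suc n) y = (b' \<otimes> B) \<otimes> y" .
    moreover have "b' \<otimes> B \<in> O\<^sub>L" "b' \<otimes> B \<in> F"
      using LF.integer_mult[OF b'(2) B(1)] subringE(6)[OF Fr b'(1) B(2)] by auto
    moreover have "res (b' \<otimes> B) = res b [^]\<^bsub>M\<^esub> (\<Sum>i<Suc n. q ^ i)"
      using residue_mult[OF b'(2) B(1)] b'(3) B(4) residue_closed[OF assms(3)] by (simp add: M.nat_pow_mult add.commute)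
    ultimately show ?case by blast
  qed
  then obtain B where B: "B \<in> O\<^sub>L" "B \<in> F" "(s [^]\<^bsub>\<Gamma>\<^esub> f) y = B \<otimes> y" "res B = res b [^]\<^bsub>M\<^esub> S" by blast
  obtain \<omega> where \<omega>: "\<omega> \<in> F" "\<omega> [^] e = \<one>" "(s [^]\<^bsub>\<Gamma>\<^esub> f) y = \<omega> \<otimes> y" using kernel_y[OF k] by blast
  have "\<omega> = B" using m_rcancel[OF y_nonzero y, of \<omega> B] F_carrier \<omega>(1,3) B(2,3) by simp
  then show "\<theta> (s [^]\<^bsub>\<Gamma>\<^esub> f) = res b [^]\<^bsub>M\<^esub> S" using inertia_character_eq[OF k \<omega>] B(4) by simp
qed

section \<open>Independence of the cohomology classes of the choices\<close>

lemma H2_denominator_eq: "H2_denominator C q f = (\<lambda>c. c [^]\<^bsub>M\<^esub> S) ` carrier C"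
  by (simp add: H2_denominator_def pow_C)

lemma H2_class_mult:
  assumes "c \<in> carrier C" "a \<in> carrier M"
  shows "H2_class C q f (c [^]\<^bsub>M\<^esub> S \<otimes>\<^bsub>M\<^esub> a) = H2_class C q f a"
proof -
  have sub: "H2_class C q f (c [^]\<^bsub>M\<^esub> S \<otimes>\<^bsub>M\<^esub> a) \<subseteq> H2_class C q f a"
    if c: "c \<in> carrier C" and a: "a \<in> carrier M" for c a
  proof
    fix x assume "x \<in> H2_class C q f (c [^]\<^bsub>M\<^esub> S \<otimes>\<^bsub>M\<^esub> a)"
    then obtain d where d: "d \<in> carrier C" "x = d [^]\<^bsub>M\<^esub> S \<otimes>\<^bsub>M\<^esub> (c [^]\<^bsub>M\<^esub> S \<otimes>\<^bsub>M\<^esub> a)"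
      by (auto simp: H2_class_def r_coset_def H2_denominator_eq mult_C)
    have "x = (d \<otimes>\<^bsub>M\<^esub> c) [^]\<^bsub>M\<^esub> S \<otimes>\<^bsub>M\<^esub> a"
      using c a d by (simp add: mem_C M.nat_pow_distrib M.m_assoc)
    then show "x \<in> H2_class C q f a"
      using C_closed[OF d(1) c] by (auto simp: H2_class_def r_coset_def H2_denominator_eq mult_C)
  qed
  obtain d where d: "d \<in> carrier C" "d \<otimes>\<^bsub>M\<^esub> c = \<one>\<^bsub>M\<^esub>" using C_inverse[OF assms(1)] by blast
  have cM: "c \<in> carrier M" "d \<in> carrier M" using assms(1) d(1) by (auto simp: mem_C)
  have "d [^]\<^bsub>M\<^esub> S \<otimes>\<^bsub>M\<^esub> (c [^]\<^bsub>M\<^esub> S \<otimes>\<^bsub>M\<^esub> a) = (d \<otimes>\<^bsub>M\<^esub> c) [^]\<^bsub>M\<^esub> S \<otimes>\<^bsub>M\<^esub> a"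
    using cM assms(2) by (simp add: M.nat_pow_distrib M.m_assoc)
  also have "\<dots> = a" using d(2) assms(2) by simp
  finally have "H2_class C q f a \<subseteq> H2_class C q f (c [^]\<^bsub>M\<^esub> S \<otimes>\<^bsub>M\<^esub> a)"
    using sub[OF d(1), of "c [^]\<^bsub>M\<^esub> S \<otimes>\<^bsub>M\<^esub> a"] cM assms(2) by simp
  with sub[OF assms] show ?thesis by blast
qed

text \<open>The common form of all changes of choice: a' is a times a (q-1)-st power times an e-th
  root of unity. The exponent \<open>S\<close> kills the power and sends the root of unity into the
  denominator of H2.\<close>

lemma H2_class_eqI:
  assumes "a \<in> carrier M" "a \<noteq> \<zero>\<^bsub>M\<^esub>" "a' \<in> carrier M" "a' \<noteq> \<zero>\<^bsub>M\<^esub>" "g \<in> carrier M" "g \<noteq> \<zero>\<^bsub>M\<^esub>"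
    and "a' [^]\<^bsub>M\<^esub> e = (g [^]\<^bsub>M\<^esub> (q - 1) \<otimes>\<^bsub>M\<^esub> a) [^]\<^bsub>M\<^esub> e"
  shows "H2_class C q f (a' [^]\<^bsub>M\<^esub> S) = H2_class C q f (a [^]\<^bsub>M\<^esub> S)"
proof -
  define h where "h = g [^]\<^bsub>M\<^esub> (q - 1) \<otimes>\<^bsub>M\<^esub> a"
  have h: "h \<in> carrier M" "h \<noteq> \<zero>\<^bsub>M\<^esub>"
    using assms pow_M_nonzero[of g "q - 1"] by (auto simp: h_def M.integral_iff)
  obtain i where i: "i \<in> carrier M" "i \<noteq> \<zero>\<^bsub>M\<^esub>" "i \<otimes>\<^bsub>M\<^esub> h = \<one>\<^bsub>M\<^esub>" using inv_M[OF h] by blast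
  define c where "c = a' \<otimes>\<^bsub>M\<^esub> i"
  have "c [^]\<^bsub>M\<^esub> e = h [^]\<^bsub>M\<^esub> e \<otimes>\<^bsub>M\<^esub> i [^]\<^bsub>M\<^esub> e"
    using assms(3,7) i(1) by (simp add: c_def h_def M.nat_pow_distrib)
  also have "\<dots> = (h \<otimes>\<^bsub>M\<^esub> i) [^]\<^bsub>M\<^esub> e" by (rule M.nat_pow_distrib[OF h(1) i(1), symmetric])
  also have "\<dots> = \<one>\<^bsub>M\<^esub>" using i h by (simp add: M.m_comm)
  finally have c: "c \<in> carrier C" using i assms(3,4) by (simp add: mem_C c_def M.integral_iff)
  have "a' = c \<otimes>\<^bsub>M\<^esub> h" using assms(3) i h by (simp add: c_def M.m_assoc)
  then have "a' [^]\<^bsub>M\<^esub> S = c [^]\<^bsub>M\<^esub> S \<otimes>\<^bsub>M\<^esub> h [^]\<^bsub>M\<^esub> S"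
    using c h by (simp add: mem_C M.nat_pow_distrib)
  also have "h [^]\<^bsub>M\<^esub> S = (g [^]\<^bsub>M\<^esub> (q - 1)) [^]\<^bsub>M\<^esub> S \<otimes>\<^bsub>M\<^esub> a [^]\<^bsub>M\<^esub> S"
    unfolding h_def using assms by (intro M.nat_pow_distrib) auto
  also have "\<dots> = a [^]\<^bsub>M\<^esub> S" unfolding S_power_unit(2)[OF assms(5,6)] using assms(1) by simp
  finally show ?thesis using H2_class_mult[OF c] assms(1) by simp
qed

text \<open>The quotient of the two uniformisers is a unit of \<open>K\<close>; its residue lies in
  \<open>k'\<close> and is killed by the exponent q - 1. Generating the same line contributes an
  e-th power c^e, and g is the residue of c.\<close>

lemma residue_generators:
  assumes "uniformiser (\<Omega>\<lparr>carrier := K\<rparr>) v \<pi>'" "\<xi>' \<in> carrier M" "\<xi>' \<noteq> \<zero>\<^bsub>M\<^esub>" "cls (T \<xi>' \<otimes> \<pi>') \<in> D"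
  shows "\<exists>g \<in> carrier M. g \<noteq> \<zero>\<^bsub>M\<^esub> \<and> \<xi>' [^]\<^bsub>M\<^esub> (q - 1) = (g [^]\<^bsub>M\<^esub> (q - 1)) [^]\<^bsub>M\<^esub> e \<otimes>\<^bsub>M\<^esub> \<xi> [^]\<^bsub>M\<^esub> (q - 1)"
proof -
  note p = uniformiser_K[OF pi] and p' = uniformiser_K[OF assms(1)]
  note t = teich_uniformiser[OF pi xi] and t' = teich_uniformiser[OF assms(1-3)]
  have "cls u = cls (T \<xi>' \<otimes> \<pi>')" by (rule cls_eqI) (use u t' assms(4) in auto)
  then obtain c where c: "c \<in> F" "c \<noteq> \<zero>" "T \<xi>' \<otimes> \<pi>' = c [^] e \<otimes> u"
    using cls_eq_iff[OF u(1,2) t'(3,4)] by blast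
  have ip: "inv \<pi> \<in> K" "inv \<pi> \<in> F" "inv \<pi> \<noteq> \<zero>" "w (inv \<pi>) = -1" "\<pi> \<otimes> inv \<pi> = \<one>"
    using subfield_m_inv(1)[OF K, of \<pi>] F_nonzero_inv[of \<pi>] p by auto
  define a where "a = \<pi>' \<otimes> inv \<pi>"
  have a: "a \<in> K" "a \<in> F" "a \<noteq> \<zero>" "w a = 0"
    using subringE(6)[OF Kr] F_nonzero_mult[of \<pi>' "inv \<pi>"] p' ip by (auto simp: a_def)
  have aK: "a \<in> O\<^sub>K" using a val_K by (simp add: LK.mem_val_ge)
  then have aO: "a \<in> O\<^sub>L" using OK_subset by blast
  have "w (c [^] e \<otimes> u) = int e * w c + 1"
    using F_nonzero_mult[of "c [^] e" u] F_nonzero_pow[OF c(1,2), of e] u by auto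
  then have "int e * w c = 0" using t'(5) c(3) by simp
  then have wc: "w c = 0" using e by simp
  then have cO: "c \<in> O\<^sub>L" using c(1) by (simp add: LF.mem_val_ge)
  note cc = F_carrier[OF c(1)] F_carrier[OF t(1)] F_carrier[OF t'(1)] 
  have ppc: "\<pi> \<in> carrier \<Omega>" "\<pi>' \<in> carrier \<Omega>" "inv \<pi> \<in> carrier \<Omega>" using p p' ip F_carrier by auto
  have "T \<xi>' \<otimes> a = (T \<xi>' \<otimes> \<pi>') \<otimes> inv \<pi>" using cc ppc by (simp add: a_def m_assoc)
  also have "\<dots> = (c [^] e \<otimes> (T \<xi> \<otimes> \<pi>)) \<otimes> inv \<pi>" unfolding c(3) u_def ..
  also have "\<dots> = c [^] e \<otimes> T \<xi>" using cc ppc ip(5) by (simp add: m_assoc)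
  finally have "res (T \<xi>' \<otimes> a) = res (c [^] e \<otimes> T \<xi>)" by simp
  moreover have "res (T \<xi>' \<otimes> a) = \<xi>' \<otimes>\<^bsub>M\<^esub> res a"
    using residue_mult[OF teichmueller_closed[OF assms(2)] aO] residue_teich[OF assms(2)] by simp
  moreover have "c [^] e \<in> O\<^sub>L" using LF.integer_pow[OF cO, of e] by (simp add: subfield_nat_pow)
  then have "res (c [^] e \<otimes> T \<xi>) = res c [^]\<^bsub>M\<^esub> e \<otimes>\<^bsub>M\<^esub> \<xi>"
    using residue_mult[OF _ teichmueller_closed[OF xi(1)], of "c [^] e"] residue_pow[OF cO, of e] residue_teich[OF xi(1)] by simp
  ultimately have eq: "\<xi>' \<otimes>\<^bsub>M\<^esub> res a = res c [^]\<^bsub>M\<^esub> e \<otimes>\<^bsub>M\<^esub> \<xi>" by simp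
  have ra: "res a \<in> carrier M" "res a \<noteq> \<zero>\<^bsub>M\<^esub>" "res a \<in> k'"
    using residue_closed[OF aO] residue_eq_zero_iff[OF aO] a aK by (auto simp: LF.mem_val_ge k'_eq)
  have rc: "res c \<in> carrier M" "res c \<noteq> \<zero>\<^bsub>M\<^esub>"
    using residue_closed[OF cO] residue_eq_zero_iff[OF cO] c wc by (auto simp: LF.mem_val_ge)
  have ra1: "res a [^]\<^bsub>M\<^esub> (q - 1) = \<one>\<^bsub>M\<^esub>"
  proof -
    have "res a [^]\<^bsub>M\<^esub> Suc (q - 1) = res a" using k'_pow[OF ra(3)] q_gt_1 by simp
    then have "res a [^]\<^bsub>M\<^esub> (q - 1) \<otimes>\<^bsub>M\<^esub> res a = \<one>\<^bsub>M\<^esub> \<otimes>\<^bsub>M\<^esub> res a" using ra(1) by simp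
    then show ?thesis using M.m_rcancel[OF ra(2,1), of "res a [^]\<^bsub>M\<^esub> (q - 1)" "\<one>\<^bsub>M\<^esub>"] ra(1) by simp
  qed
  have "\<xi>' [^]\<^bsub>M\<^esub> (q - 1) = (\<xi>' \<otimes>\<^bsub>M\<^esub> res a) [^]\<^bsub>M\<^esub> (q - 1)"
    using M.nat_pow_distrib[OF assms(2) ra(1), of "q - 1"] ra1 assms(2) by simp
  also have "\<dots> = (res c [^]\<^bsub>M\<^esub> e) [^]\<^bsub>M\<^esub> (q - 1) \<otimes>\<^bsub>M\<^esub> \<xi> [^]\<^bsub>M\<^esub> (q - 1)"
    unfolding eq using rc xi(1) by (intro M.nat_pow_distrib) auto
  also have "(res c [^]\<^bsub>M\<^esub> e) [^]\<^bsub>M\<^esub> (q - 1) = (res c [^]\<^bsub>M\<^esub> (q - 1)) [^]\<^bsub>M\<^esub> e"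
    using rc by (simp add: M.nat_pow_pow mult.commute)
  finally show ?thesis using rc by blast
qed

text \<open>Both descriptions are resolved to the class of a^S for one fixed lift of
  \<open>\<sigma>\<close>. Another lift is the case g = 1 of \<open>eq\<close>; other \<pi>, \<xi>,
  \<alpha> use the g of \<open>residue_generators\<close>.\<close>

lemma extension_class_eq_line_class:
  "line_class \<Omega> K v F w q e f D \<in> carrier (H2 C q f) \<and>
   extension_class C q f \<Gamma> \<sigma> \<rho> \<theta> = line_class \<Omega> K v F w q e f D"
proof -
  obtain s where s: "s \<in> carrier \<Gamma>" "\<rho> s = \<sigma>" by (rule lift_sigma)
  obtain b where b: "b \<in> O\<^sub>L" "b \<in> F" "res b \<noteq> \<zero>\<^bsub>M\<^esub>" "res b [^]\<^bsub>M\<^esub> e = \<xi> [^]\<^bsub>M\<^esub> (q - 1)" "s y = b \<otimes> y"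
    by (rule lift_y[OF s])
  define a where "a = res b"
  have a: "a \<in> carrier M" "a \<noteq> \<zero>\<^bsub>M\<^esub>" "a [^]\<^bsub>M\<^esub> e = \<xi> [^]\<^bsub>M\<^esub> (q - 1)"
    using residue_closed[OF b(1)] b by (auto simp: a_def)
  let ?c = "H2_class C q f (a [^]\<^bsub>M\<^esub> S)"
  have eq: "H2_class C q f (a' [^]\<^bsub>M\<^esub> S) = ?c"
    if a': "a' \<in> carrier M" "a' \<noteq> \<zero>\<^bsub>M\<^esub>" "a' [^]\<^bsub>M\<^esub> e = (g [^]\<^bsub>M\<^esub> (q - 1)) [^]\<^bsub>M\<^esub> e \<otimes>\<^bsub>M\<^esub> \<xi> [^]\<^bsub>M\<^esub> (q - 1)"
      and g: "g \<in> carrier M" "g \<noteq> \<zero>\<^bsub>M\<^esub>" for a' g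
    by (rule H2_class_eqI[OF a(1,2) a'(1,2) g])
      (use a a' g in \<open>simp add: M.nat_pow_distrib\<close>)
  have ext: "extension_class C q f \<Gamma> \<sigma> \<rho> \<theta> = ?c"
    unfolding extension_class_def
  proof (rule the_equality)
    show "\<exists>s\<in>carrier \<Gamma>. \<rho> s = \<sigma> \<and> ?c = H2_class C q f (\<theta> (s [^]\<^bsub>\<Gamma>\<^esub> f))"
      using s lift_power(2)[OF s b(1-3,5)] by (auto simp: a_def)
  next
    fix c assume "\<exists>s\<in>carrier \<Gamma>. \<rho> s = \<sigma> \<and> c = H2_class C q f (\<theta> (s [^]\<^bsub>\<Gamma>\<^esub> f))"
    then obtain s' where s': "s' \<in> carrier \<Gamma>" "\<rho> s' = \<sigma>" "c = H2_class C q f (\<theta> (s' [^]\<^bsub>\<Gamma>\<^esub> f))" by blast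
    obtain b' where b': "b' \<in> O\<^sub>L" "b' \<in> F" "res b' \<noteq> \<zero>\<^bsub>M\<^esub>" "res b' [^]\<^bsub>M\<^esub> e = \<xi> [^]\<^bsub>M\<^esub> (q - 1)" "s' y = b' \<otimes> y"
      by (rule lift_y[OF s'(1,2)])
    have "H2_class C q f (res b' [^]\<^bsub>M\<^esub> S) = ?c"
      by (rule eq[of _ "\<one>\<^bsub>M\<^esub>"]) (use b' xi residue_closed in auto)
    then show "c = ?c" using s'(3) lift_power(2)[OF s'(1,2) b'(1-3,5)] by simp
  qed
  have line_class: "line_class \<Omega> K v F w q e f D = ?c"
    unfolding line_class_def Let_def M_def[symmetric]
  proof (rule the_equality)
    have "line_generator \<F> e D (T \<xi> \<otimes> \<pi>)"
      using line_generator_iff[OF u(1-3)] u(4) by (simp add: u_def)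
    moreover have "?c = H2_class C q f (galois_norm M k' a)" using galois_norm_residue[OF a(1)] by simp
    ultimately show "\<exists>\<pi> \<xi> \<alpha>. uniformiser (\<Omega>\<lparr>carrier := K\<rparr>) v \<pi> \<and> \<xi> \<in> carrier (mult_of M) \<and>
        line_generator \<F> e D (T \<xi> \<otimes> \<pi>) \<and> \<alpha> \<in> carrier (mult_of M) \<and>
        \<xi> [^]\<^bsub>M\<^esub> (q - 1) = \<alpha> [^]\<^bsub>M\<^esub> e \<and> ?c = H2_class C q f (galois_norm M k' \<alpha>)"
      using pi xi a by (intro exI[of _ \<pi>] exI[of _ \<xi>] exI[of _ a]) simp
  next
    fix c assume "\<exists>\<pi> \<xi> \<alpha>. uniformiser (\<Omega>\<lparr>carrier := K\<rparr>) v \<pi> \<and> \<xi> \<in> carrier (mult_of M) \<and>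
        line_generator \<F> e D (T \<xi> \<otimes> \<pi>) \<and> \<alpha> \<in> carrier (mult_of M) \<and>
        \<xi> [^]\<^bsub>M\<^esub> (q - 1) = \<alpha> [^]\<^bsub>M\<^esub> e \<and> c = H2_class C q f (galois_norm M k' \<alpha>)"
    then obtain \<pi>' \<xi>' a' where 1: "uniformiser (\<Omega>\<lparr>carrier := K\<rparr>) v \<pi>'" "\<xi>' \<in> carrier M" "\<xi>' \<noteq> \<zero>\<^bsub>M\<^esub>"
      "line_generator \<F> e D (T \<xi>' \<otimes> \<pi>')" "a' \<in> carrier M" "a' \<noteq> \<zero>\<^bsub>M\<^esub>"
      "\<xi>' [^]\<^bsub>M\<^esub> (q - 1) = a' [^]\<^bsub>M\<^esub> e" "c = H2_class C q f (galois_norm M k' a')" by auto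
    have "cls (T \<xi>' \<otimes> \<pi>') \<in> D"
      using line_generator_iff[OF teich_uniformiser(3-5)[OF 1(1-3)]] 1(4) by simp
    then obtain g where "g \<in> carrier M" "g \<noteq> \<zero>\<^bsub>M\<^esub>"
      "\<xi>' [^]\<^bsub>M\<^esub> (q - 1) = (g [^]\<^bsub>M\<^esub> (q - 1)) [^]\<^bsub>M\<^esub> e \<otimes>\<^bsub>M\<^esub> \<xi> [^]\<^bsub>M\<^esub> (q - 1)"
      using residue_generators[OF 1(1-3)] by blast
    then have "H2_class C q f (a' [^]\<^bsub>M\<^esub> S) = ?c" using eq[OF 1(5,6), of g] 1(7) by simp
    then show "c = ?c" using 1(8) galois_norm_residue[OF 1(5)] by simp
  qed
  \<comment> \<open>The norm of \<open>a\<close> is an e-th root of unity because its e-th power is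
    the norm of \<xi>^(q-1), which is 1.\<close>
  have "(a [^]\<^bsub>M\<^esub> S) [^]\<^bsub>M\<^esub> e = (a [^]\<^bsub>M\<^esub> e) [^]\<^bsub>M\<^esub> S" using a(1) by (simp add: M.nat_pow_pow mult.commute)
  also have "\<dots> = \<one>\<^bsub>M\<^esub>" unfolding a(3) by (rule S_power_unit(2)[OF xi])
  finally have "a [^]\<^bsub>M\<^esub> S \<in> carrier C" using a pow_M_nonzero by (simp add: mem_C)
  then have "a [^]\<^bsub>M\<^esub> S \<in> kernel C C (\<lambda>x. x [^]\<^bsub>C\<^esub> (q - 1))"
    using S_power_unit(1)[OF a(1,2)] by (simp add: kernel_def pow_C one_C)
  then have "?c \<in> carrier (H2 C q f)"
    by (auto simp: H2_def FactGroup_def RCOSETS_def H2_class_def r_coset_def)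
  with ext line_class show ?thesis by simp
qed

end

text \<open>The first two conjuncts give the equation its meaning: the sequence is an extension
  inducing the prescribed action, and the common value is an element of H2.\<close>

theorem proposition7p2p2:
  fixes \<Omega> :: "('a, 'm) ring_scheme"
    and K K\<^sub>f L :: "'a set"
    and v w :: "'a \<Rightarrow> int"
    and p q e f :: nat
    and D :: "'a set set"
    and G\<^sub>f \<Gamma> :: "('a \<Rightarrow> 'a) monoid"
    and \<sigma> :: "'a \<Rightarrow> 'a"
    and C :: "'a set monoid"
  assumes "algebraically_closed \<Omega>"
    and "subfield K \<Omega>"
    and "local_field (\<Omega>\<lparr>carrier := K\<rparr>) v"
    and "p = characteristic (residue_field (\<Omega>\<lparr>carrier := K\<rparr>) v)"
    and "q = order (residue_field (\<Omega>\<lparr>carrier := K\<rparr>) v)"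
    and "0 < e"
    and "\<not> [e = 0] (mod p)"
    and "0 < f"
    and "[q ^ f = 1] (mod e)"
    and "subfield K\<^sub>f \<Omega>"
    and "local_field (\<Omega>\<lparr>carrier := K\<^sub>f\<rparr>) w"
    and "unramified_extension \<Omega> K v K\<^sub>f w f"
    and "G\<^sub>f = galois_group (\<Omega>\<lparr>carrier := K\<^sub>f\<rparr>) K"
    and "\<sigma> \<in> carrier G\<^sub>f"
    and "induces_frobenius (\<Omega>\<lparr>carrier := K\<^sub>f\<rparr>) w q \<sigma>"
    and "ramified_line (\<Omega>\<lparr>carrier := K\<^sub>f\<rparr>) w e D"
    and "stable_line G\<^sub>f D"
    and "L = adjoin_roots \<Omega> K\<^sub>f e D"
    and "\<Gamma> = galois_group (\<Omega>\<lparr>carrier := L\<rparr>) K"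
    and "C = torsion (mult_of (residue_field (\<Omega>\<lparr>carrier := K\<^sub>f\<rparr>) w)) e"
  shows "cyclic_extension C q \<Gamma> G\<^sub>f \<sigma> (\<lambda>\<tau>. restrict \<tau> K\<^sub>f) (inertia_character \<Omega> K\<^sub>f w e D L) \<and>
    line_class \<Omega> K v K\<^sub>f w q e f D \<in> carrier (H2 C q f) \<and>
    extension_class C q f \<Gamma> \<sigma> (\<lambda>\<tau>. restrict \<tau> K\<^sub>f) (inertia_character \<Omega> K\<^sub>f w e D L)
      = line_class \<Omega> K v K\<^sub>f w q e f D"
proof -
  interpret algebraically_closed \<Omega> by fact
  have unramified: "unramified_frobenius \<Omega> K K\<^sub>f v w q f \<sigma>"
    by (intro unramified_frobenius.intro unramified_frobenius_axioms.intro) (use assms in auto)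
  have stable_line: "stable_ramified_line \<Omega> K K\<^sub>f v w q f \<sigma> e D"
    by (intro stable_ramified_line.intro stable_ramified_line_axioms.intro unramified) (use assms in auto)
  obtain \<pi> \<xi> where \<pi>: "uniformiser (\<Omega>\<lparr>carrier := K\<rparr>) v \<pi>"
    and \<xi>: "\<xi> \<in> carrier (unramified_frobenius.M \<Omega> K\<^sub>f w)" "\<xi> \<noteq> \<zero>\<^bsub>unramified_frobenius.M \<Omega> K\<^sub>f w\<^esub>"
    and gen: "power_class (\<Omega>\<lparr>carrier := K\<^sub>f\<rparr>) e (teichmueller (\<Omega>\<lparr>carrier := K\<^sub>f\<rparr>) w \<xi> \<otimes>\<^bsub>\<Omega>\<^esub> \<pi>) \<in> D"
    using stable_ramified_line.exists_generator[OF stable_line] by blast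
  define u where "u = teichmueller (\<Omega>\<lparr>carrier := K\<^sub>f\<rparr>) w \<xi> \<otimes>\<^bsub>\<Omega>\<^esub> \<pi>"
  have u: "u \<in> carrier \<Omega>"
    using stable_ramified_line.teich_uniformiser(3)[OF stable_line \<pi> \<xi>] subfieldE(3)[OF assms(10)]
    by (auto simp: u_def)
  have P: "power_minus e u \<in> carrier (poly_ring \<Omega>)" by (rule power_minus_closed[OF carrier_is_subring u])
  \<comment> \<open>Algebraic closedness of the ambient field and the positive degree e provide the
    root \<open>y\<close>.\<close>
  have "splitted (power_minus e u)" by (rule roots_over_carrier[OF P])
  then have "roots (power_minus e u) \<noteq> {#}"
    using degree_power_minus[OF assms(6), of u] assms(6) by (auto simp: splitted_def)
  then obtain y where "y \<in># roots (power_minus e u)" by blast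
  then have "y \<in> carrier \<Omega>" "eval (power_minus e u) y = \<zero>\<^bsub>\<Omega>\<^esub>"
    using roots_mem_iff_is_root[OF P] by (auto simp: is_root_def)
  then have y: "y \<in> carrier \<Omega>" "y [^]\<^bsub>\<Omega>\<^esub> e = u"
    using eval_power_minus[OF assms(6) u] u by auto
  interpret kummer_generator \<Omega> K K\<^sub>f v w q f \<sigma> e D \<pi> \<xi> y
    by (intro kummer_generator.intro kummer_generator_axioms.intro stable_line \<pi> \<xi> gen y(1) y(2)[unfolded u_def])
  show ?thesis
    using is_cyclic_extension extension_class_eq_line_class
    unfolding assms(13,18,19,20) M_def by blast
qed

end
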